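(* Let $N\geq 5$ and $0<\mu<N-4$, and let $$C_{\mu,1}=\frac{N^2-4N+8}{2(N-4)^2}\mu[2(N-4)-\mu],\qquad C_{\mu,2}=\frac{N^2}{16(N-4)^2}\mu^2[2(N-4)-\mu]^2-\frac{N-2}{2}\mu[2(N-4)-\mu],$$ and $2^{**}=\frac{2N}{N-4}$. Then the problem $$\Delta^2 u+C_{\mu,1}\,\mathrm{div}\Big(\frac{\nabla u}{|x|^2}\Big)+C_{\mu,2}\frac{u}{|x|^4}=u^{2^{**}-1},\quad u>0\ \text{ in } \mathbb{R}^N\setminus\{0\},\quad u\in\mathcal{E}_\mu,$$ admits a unique (up to scalings) positive radial solution, which is of the form $U_{\mu,\lambda}(x)=\lambda^{\frac{N-4}{2}}U_\mu(\lambda x)$, $\lambda>0$, where $$U_\mu(x)=K_{N,\mu}|x|^{-\frac{\mu}{2}}\left(1+|x|^{2(1-\frac{\mu}{N-4})}\right)^{-\frac{N-4}{2}},\qquad K_{N,\mu}=\left[\Big(1-\frac{\mu}{N-4}\Big)^4(N-4)(N-2)N(N+2)\right]^{\frac{N-4}{8}}.$$ That is, every positive radial solution equals $U_{\mu,\lambda}$ for some $\lambda>0$.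
   Context: $\mathcal{D}^{2,2}_0(\mathbb{R}^N)=\{u\in L^{2^{**}}(\mathbb{R}^N):\Delta u\in L^2(\mathbb{R}^N)\}$. $\mathcal{E}_\mu$ is the set of $u\in\mathcal{D}^{2,2}_0(\mathbb{R}^N)$ with $\int_{\mathbb{R}^N}|\Delta u|^2dx-C_{\mu,1}\int_{\mathbb{R}^N}\frac{|\nabla u|^2}{|x|^2}dx+C_{\mu,2}\int_{\mathbb{R}^N}\frac{u^2}{|x|^4}dx<\infty$, equipped with the inner product $\langle u,v\rangle_\mu=\int_{\mathbb{R}^N}\Delta u\Delta v\,dx-C_{\mu,1}\int_{\mathbb{R}^N}\frac{\nabla u\cdot\nabla v}{|x|^2}dx+C_{\mu,2}\int_{\mathbb{R}^N}\frac{uv}{|x|^4}dx$ and norm $\|u\|_\mu=\langle u,u\rangle_\mu^{1/2}$. *)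

theory Defs
  imports "HOL-Analysis.Analysis"
begin

definition pd :: "'n::finite \<Rightarrow> (real^'n \<Rightarrow> real) \<Rightarrow> real^'n \<Rightarrow> real" where
  "pd i f x = (SOME d. ((\<lambda>t. f (x + t *\<^sub>R axis i 1)) has_real_derivative d) (at 0))"

fun Ck :: "nat \<Rightarrow> (real^'n::finite \<Rightarrow> real) \<Rightarrow> bool" where
  "Ck 0 f = continuous_on UNIV f"
| "Ck (Suc k) f = (continuous_on UNIV f \<and>
      (\<forall>i x. (\<lambda>t. f (x + t *\<^sub>R axis i 1)) differentiable (at 0)) \<and>
      (\<forall>i. Ck k (pd i f)))"

definition tsupport :: "(real^'n::finite \<Rightarrow> real) \<Rightarrow> (real^'n) set" where
  "tsupport f = closure {x. f x \<noteq> 0}"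

definition test_fun :: "(real^'n::finite) set \<Rightarrow> (real^'n \<Rightarrow> real) \<Rightarrow> bool" where
  "test_fun \<Omega> \<phi> \<longleftrightarrow> (\<forall>k. Ck k \<phi>) \<and> compact (tsupport \<phi>) \<and> tsupport \<phi> \<subseteq> \<Omega>"

definition grad :: "(real^'n::finite \<Rightarrow> real) \<Rightarrow> real^'n \<Rightarrow> real^'n" where
  "grad f x = (\<chi> i. pd i f x)"

definition lap :: "(real^'n::finite \<Rightarrow> real) \<Rightarrow> real^'n \<Rightarrow> real" where
  "lap f x = (\<Sum>i\<in>UNIV. pd i (pd i f) x)"

definition weak_grad :: "(real^'n::finite \<Rightarrow> real) \<Rightarrow> (real^'n \<Rightarrow> real^'n) \<Rightarrow> bool" where
  "weak_grad u g \<longleftrightarrow> (\<forall>\<phi>. test_fun UNIV \<phi> \<longrightarrow> (\<forall>i.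
      integrable lborel (\<lambda>x. u x * pd i \<phi> x) \<and> integrable lborel (\<lambda>x. g x $ i * \<phi> x) \<and>
      (\<integral>x. u x * pd i \<phi> x \<partial>lborel) = - (\<integral>x. g x $ i * \<phi> x \<partial>lborel)))"

definition weak_lap :: "(real^'n::finite \<Rightarrow> real) \<Rightarrow> (real^'n \<Rightarrow> real) \<Rightarrow> bool" where
  "weak_lap u h \<longleftrightarrow> (\<forall>\<phi>. test_fun UNIV \<phi> \<longrightarrow>
      integrable lborel (\<lambda>x. u x * lap \<phi> x) \<and> integrable lborel (\<lambda>x. h x * \<phi> x) \<and>
      (\<integral>x. u x * lap \<phi> x \<partial>lborel) = (\<integral>x. h x * \<phi> x \<partial>lborel))"

definition crit_exp :: "nat \<Rightarrow> real" where
  "crit_exp N = 2 * real N / (real N - 4)"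

definition C1 :: "nat \<Rightarrow> real \<Rightarrow> real" where
  "C1 N \<mu> = (real N ^ 2 - 4 * real N + 8) / (2 * (real N - 4) ^ 2) * \<mu> * (2 * (real N - 4) - \<mu>)"

definition C2 :: "nat \<Rightarrow> real \<Rightarrow> real" where
  "C2 N \<mu> = real N ^ 2 / (16 * (real N - 4) ^ 2) * \<mu> ^ 2 * (2 * (real N - 4) - \<mu>) ^ 2
            - (real N - 2) / 2 * \<mu> * (2 * (real N - 4) - \<mu>)"

definition K_const :: "nat \<Rightarrow> real \<Rightarrow> real" where
  "K_const N \<mu> = ((1 - \<mu> / (real N - 4)) ^ 4 * (real N - 4) * (real N - 2) * real N * (real N + 2))
                  powr ((real N - 4) / 8)"

definition U_mu :: "real \<Rightarrow> real^'n::finite \<Rightarrow> real" where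
  "U_mu \<mu> x = (let N = CARD('n) in
     K_const N \<mu> * norm x powr (- \<mu> / 2)
       * (1 + norm x powr (2 * (1 - \<mu> / (real N - 4)))) powr (- (real N - 4) / 2))"

definition U_scaled :: "real \<Rightarrow> real \<Rightarrow> real^'n::finite \<Rightarrow> real" where
  "U_scaled \<mu> lam x = lam powr ((real CARD('n) - 4) / 2) * U_mu \<mu> (lam *\<^sub>R x)"

definition E_mu_wit :: "real \<Rightarrow> (real^'n::finite \<Rightarrow> real) \<Rightarrow> (real^'n \<Rightarrow> real^'n) \<Rightarrow> (real^'n \<Rightarrow> real) \<Rightarrow> bool" where
  "E_mu_wit \<mu> u g h \<longleftrightarrow>
     u \<in> borel_measurable lborel \<and>
     integrable lborel (\<lambda>x. \<bar>u x\<bar> powr crit_exp CARD('n)) \<and>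
     weak_lap u h \<and> h \<in> borel_measurable lborel \<and> integrable lborel (\<lambda>x. (h x)\<^sup>2) \<and>
     weak_grad u g \<and> g \<in> borel_measurable lborel \<and>
     integrable lborel (\<lambda>x. (norm (g x))\<^sup>2 / (norm x)\<^sup>2) \<and>
     integrable lborel (\<lambda>x. (u x)\<^sup>2 / (norm x) ^ 4)"

definition E_mu :: "real \<Rightarrow> (real^'n::finite \<Rightarrow> real) set" where
  "E_mu \<mu> = {u. \<exists>g h. E_mu_wit \<mu> u g h}"

definition weak_solution :: "real \<Rightarrow> (real^'n::finite \<Rightarrow> real) \<Rightarrow> bool" where
  "weak_solution \<mu> u \<longleftrightarrow> (\<exists>g h. E_mu_wit \<mu> u g h \<and>
     (\<forall>\<phi>. test_fun (- {0}) \<phi> \<longrightarrow>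
        integrable lborel (\<lambda>x. u x powr (crit_exp CARD('n) - 1) * \<phi> x) \<and>
        (\<integral>x. h x * lap \<phi> x \<partial>lborel)
          - C1 CARD('n) \<mu> * (\<integral>x. (g x \<bullet> grad \<phi> x) / (norm x)\<^sup>2 \<partial>lborel)
          + C2 CARD('n) \<mu> * (\<integral>x. u x * \<phi> x / (norm x) ^ 4 \<partial>lborel)
        = (\<integral>x. u x powr (crit_exp CARD('n) - 1) * \<phi> x \<partial>lborel)))"

definition radial :: "(real^'n::finite \<Rightarrow> real) \<Rightarrow> bool" where
  "radial u \<longleftrightarrow> (\<forall>x y. norm x = norm y \<longrightarrow> u x = u y)"

definition pos_radial_solution :: "real \<Rightarrow> (real^'n::finite \<Rightarrow> real) \<Rightarrow> bool" where
  "pos_radial_solution \<mu> u \<longleftrightarrow>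
     weak_solution \<mu> u \<and> radial u \<and> (AE x in lborel. u x > 0)"

end

theory Submission
  imports Defs
begin

text \<open>
  Write \<open>N = 2 b + 4\<close>, \<open>k = 1 - \<mu> / (N - 4)\<close> and \<open>u x = |x| powr (- b) * w (ln |x|)\<close>. In these
  Emden--Fowler coordinates the equation for a radial \<open>u\<close> becomes
  \<open>(D\<^sup>2 - \<alpha>\<^sup>2) (D\<^sup>2 - \<beta>\<^sup>2) w = w powr p\<close> on the line, with \<open>\<alpha> = k (b + 2)\<close>, \<open>\<beta> = k b\<close> and
  \<open>p = (b + 4) / b\<close>, and the conditions defining the energy space give \<open>w\<close> square integrable.
  The function \<open>cosh (k t) powr (- b)\<close> solves it up to a constant factor.

  Conversely, testing with cut-off convolutions of the positive Green function \<open>G\<close> of the operator shows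
  \<open>w = G * w powr p\<close> almost everywhere. This makes \<open>w\<close> bounded and, after a bootstrap, exponentially
  decaying at \<open>- \<infinity>\<close>, fast enough to rewrite the equation as a Volterra equation started at \<open>- \<infinity>\<close>:
  \<open>w t = P exp (\<beta> t) - Q exp (\<alpha> t) + \<integral> K (t - s) w s powr p\<close> over \<open>s \<le> t\<close>, with
  a nonnegative kernel \<open>K\<close>. A translation in \<open>t\<close>, that is a scaling of \<open>u\<close>, prescribes \<open>P\<close>. For equal \<open>P\<close>
  a Gronwall argument shows that the solution with the smaller \<open>Q\<close> lies above the other one, and if the
  \<open>Q\<close> differ, the difference grows like \<open>exp (\<alpha> t)\<close>, contradicting boundedness. Hence \<open>Q\<close> agrees too and the
  solutions coincide.
\<close>


section \<open>Smooth functions of one variable\<close>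

text \<open>Two obstacles shape the argument. Membership in the energy space is tested across the
  origin, where \<open>U_mu\<close> is singular, so its weak derivatives need an integration by
  parts with cutoffs near 0; N > 4 makes the error terms integrable. Conversely, of an arbitrary
  solution only the integrability of powers of \<open>w\<close> is available, neither continuity nor
  any derivative. All derivatives are therefore moved to the test function, and regularity is
  replaced by passing to the representative \<open>G * w powr p\<close>, which is defined at every
  point. The rates make the analysis at minus infinity possible:
  \<open>p * \<beta> = k * (b + 4)\<close> exceeds \<open>\<alpha> = k * (b + 2)\<close>, so some
  decay rate below \<beta> already makes \<open>exp (- \<alpha> * s) * w s powr p\<close> integrable
  there, and \<open>Q\<close> is finite along with \<open>P\<close>. In the uniqueness proof the
  explicit family is treated as a solution like any other: it passes through the same reduction, so
  that no integral equation has to be verified for it by hand.\<close>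

fun Ck_real :: "nat \<Rightarrow> (real \<Rightarrow> real) \<Rightarrow> bool" where
  "Ck_real 0 f = continuous_on UNIV f"
| "Ck_real (Suc k) f = (\<exists>f'. (\<forall>x. (f has_real_derivative f' x) (at x)) \<and> Ck_real k f')"

definition smooth_real :: "(real \<Rightarrow> real) \<Rightarrow> bool" where
  "smooth_real f \<longleftrightarrow> (\<forall>k. Ck_real k f)"

lemma DERIV_transform_nhds:
  "(f has_real_derivative D) (at x) \<Longrightarrow> eventually (\<lambda>y. f y = g y) (nhds x) \<Longrightarrow>
    (g has_real_derivative D) (at x)"
  using DERIV_cong_ev[of x x f g D D] by simp

lemma Ck_real_SucI:
  "(\<And>x. (f has_real_derivative f' x) (at x)) \<Longrightarrow> Ck_real k f' \<Longrightarrow> Ck_real (Suc k) f"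
  by auto

lemma Ck_real_decr: "Ck_real (Suc k) f \<Longrightarrow> Ck_real k f"
proof (induction k arbitrary: f)
  case 0
  then obtain f' where "\<And>x. (f has_real_derivative f' x) (at x)" by auto
  then show ?case
    by (auto intro!: continuous_at_imp_continuous_on intro: DERIV_isCont)
next
  case (Suc k)
  then show ?case by (metis Ck_real.simps(2))
qed

lemma Ck_real_const: "Ck_real k (\<lambda>_. c)"
  by (induction k arbitrary: c) (auto intro!: exI[of _ "\<lambda>_. 0"])

lemma Ck_real_id: "Ck_real k (\<lambda>x. x)"
  by (cases k) (auto intro!: exI[of _ "\<lambda>_. 1"] Ck_real_const)

lemma Ck_real_add: "Ck_real k f \<Longrightarrow> Ck_real k g \<Longrightarrow> Ck_real k (\<lambda>x. f x + g x)"
proof (induction k arbitrary: f g)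
  case (Suc k)
  then obtain f' g' where "\<forall>x. (f has_real_derivative f' x) (at x)" "Ck_real k f'"
     "\<forall>x. (g has_real_derivative g' x) (at x)" "Ck_real k g'" by auto
  then show ?case using Suc.IH[of f' g']
    by (auto intro!: exI[of _ "\<lambda>x. f' x + g' x"] derivative_eq_intros)
qed (auto intro!: continuous_intros)

lemma Ck_real_mult: "Ck_real k f \<Longrightarrow> Ck_real k g \<Longrightarrow> Ck_real k (\<lambda>x. f x * g x)"
proof (induction k arbitrary: f g)
  case (Suc k)
  from Suc.prems(1) obtain f' where d: "\<And>x. (f has_real_derivative f' x) (at x)" "Ck_real k f'"
    by auto
  from Suc.prems(2) obtain g' where e: "\<And>x. (g has_real_derivative g' x) (at x)" "Ck_real k g'"
    by auto
  have "Ck_real k (\<lambda>x. f' x * g x + f x * g' x)"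
    by (intro Ck_real_add Suc.IH d(2) e(2) Ck_real_decr[OF Suc.prems(1)] Ck_real_decr[OF Suc.prems(2)])
  moreover have "((\<lambda>x. f x * g x) has_real_derivative f' x * g x + f x * g' x) (at x)" for x
    using DERIV_mult[OF d(1) e(1)] by (simp add: mult.commute)
  ultimately show ?case by (intro Ck_real_SucI)
qed (auto intro!: continuous_intros)

lemma Ck_real_inverse:
  "Ck_real k f \<Longrightarrow> (\<And>x. f x \<noteq> 0) \<Longrightarrow> Ck_real k (\<lambda>x. inverse (f x))"
proof (induction k arbitrary: f)
  case (Suc k)
  from Suc.prems obtain f' where d: "\<And>x. (f has_real_derivative f' x) (at x)" "Ck_real k f'"
    by auto
  have i: "Ck_real k (\<lambda>x. inverse (f x))"
    by (rule Suc.IH[OF Ck_real_decr]) (use Suc.prems in auto)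
  have "Ck_real k (\<lambda>x. (- 1) * (inverse (f x) * f' x * inverse (f x)))"
    by (intro Ck_real_mult i d(2) Ck_real_const)
  moreover have "((\<lambda>x. inverse (f x)) has_real_derivative
      (- 1) * (inverse (f x) * f' x * inverse (f x))) (at x)" for x
    using DERIV_inverse'[OF d(1) Suc.prems(2)] by simp
  ultimately show ?case by (intro Ck_real_SucI)
qed (auto intro!: continuous_intros)

lemma Ck_real_affine: "Ck_real k f \<Longrightarrow> Ck_real k (\<lambda>x. f (c * x + d))"
proof (induction k arbitrary: f)
  case 0
  then show ?case by (auto intro!: continuous_on_compose2[of UNIV f] continuous_intros)
next
  case (Suc k)
  from Suc.prems obtain f' where d: "\<And>x. (f has_real_derivative f' x) (at x)" "Ck_real k f'"
    by auto
  have "Ck_real k (\<lambda>x. c * f' (c * x + d))"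
    by (intro Ck_real_mult Ck_real_const Suc.IH d(2))
  moreover have "((\<lambda>x. f (c * x + d)) has_real_derivative c * f' (c * x + d)) (at x)" for x
  proof -
    have "((\<lambda>x. c * x + d) has_real_derivative c) (at x)"
      by (auto intro!: derivative_eq_intros)
    from DERIV_chain2[OF d(1) this] show ?thesis by (simp add: mult.commute)
  qed
  ultimately show ?case by (intro Ck_real_SucI)
qed

lemma Ck_real_exp: "Ck_real k (\<lambda>x. exp (c * x))"
proof (induction k)
  case (Suc k)
  have "Ck_real k (\<lambda>x. c * exp (c * x))"
    by (intro Ck_real_mult Ck_real_const Suc.IH)
  moreover have "((\<lambda>x. exp (c * x)) has_real_derivative c * exp (c * x)) (at x)" for x
    by (auto intro!: derivative_eq_intros)
  ultimately show ?case by (intro Ck_real_SucI)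
qed (auto intro!: continuous_intros)

lemma smooth_real_const: "smooth_real (\<lambda>_. c)"
  and smooth_real_id: "smooth_real (\<lambda>x. x)"
  and smooth_real_add: "smooth_real f \<Longrightarrow> smooth_real g \<Longrightarrow> smooth_real (\<lambda>x. f x + g x)"
  and smooth_real_mult: "smooth_real f \<Longrightarrow> smooth_real g \<Longrightarrow> smooth_real (\<lambda>x. f x * g x)"
  and smooth_real_affine: "smooth_real f \<Longrightarrow> smooth_real (\<lambda>x. f (c * x + d))"
  and smooth_real_exp: "smooth_real (\<lambda>x. exp (c * x))"
  by (auto simp: smooth_real_def
      intro: Ck_real_const Ck_real_id Ck_real_add Ck_real_mult Ck_real_affine Ck_real_exp)

lemma smooth_real_diff: "smooth_real f \<Longrightarrow> smooth_real g \<Longrightarrow> smooth_real (\<lambda>x. f x - g x)"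
  using smooth_real_add[of f "\<lambda>x. (- 1) * g x"] smooth_real_mult[OF smooth_real_const[of "- 1"], of g]
  by simp

lemmas smooth_real_intros = smooth_real_const smooth_real_id smooth_real_add smooth_real_mult
  smooth_real_affine smooth_real_exp smooth_real_diff

lemma smooth_real_deriv:
  assumes "smooth_real f"
  shows "(f has_real_derivative deriv f x) (at x)" and "smooth_real (deriv f)"
proof -
  have *: "(\<forall>x. (f has_real_derivative deriv f x) (at x)) \<and> Ck_real k (deriv f)" for k
  proof -
    obtain f' where f': "\<forall>x. (f has_real_derivative f' x) (at x)" "Ck_real k f'"
      using assms unfolding smooth_real_def by (metis Ck_real.simps(2))
    then have "f' = deriv f" by (metis DERIV_imp_deriv ext)
    then show ?thesis using f' by auto
  qed
  show "(f has_real_derivative deriv f x) (at x)" "smooth_real (deriv f)"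
    using * by (auto simp: smooth_real_def)
qed

lemma smooth_real_continuous: "smooth_real f \<Longrightarrow> continuous_on A f"
  using smooth_real_def[of f] Ck_real.simps(1)[of f] continuous_on_subset[of UNIV f A] by blast

lemma smooth_real_borel [measurable_dest]: "smooth_real f \<Longrightarrow> f \<in> borel_measurable borel"
  by (intro borel_measurable_continuous_onI smooth_real_continuous)

section \<open>Flat functions, the smooth step and test functions on the line\<close>

definition flat_exp :: "nat \<Rightarrow> real \<Rightarrow> real" where
  "flat_exp n x = (if x > 0 then (1 / x) ^ n * exp (- (1 / x)) else 0)"

lemma flat_exp_tendsto: "(flat_exp n \<longlongrightarrow> 0) (at_right 0)"
proof -
  have "((\<lambda>y. y ^ n / exp y) \<longlongrightarrow> (0::real)) at_top"
    by (rule tendsto_power_div_exp_0)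
  then have "((\<lambda>x. (inverse x) ^ n / exp (inverse x)) \<longlongrightarrow> (0::real)) (at_right 0)"
    by (rule filterlim_compose) (rule filterlim_inverse_at_top_right)
  moreover have "eventually (\<lambda>x. (inverse x) ^ n / exp (inverse x) = flat_exp n x) (at_right 0)"
    by (auto simp: flat_exp_def eventually_at_filter exp_minus divide_simps)
  ultimately show ?thesis by (rule Lim_transform_eventually)
qed

text \<open>Differentiating x^(-n) exp (- 1 / x) only produces functions of the same kind with
  larger n, so the family is closed under derivatives and smoothness of every member becomes a plain
  induction.\<close>

lemma flat_exp_deriv:
  "(flat_exp n has_real_derivative (flat_exp (Suc (Suc n)) x - real n * flat_exp (Suc n) x)) (at x)"
proof -
  consider "x > 0" | "x < 0" | "x = 0" by linarith
  then show ?thesis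
  proof cases
    case 1
    have "((\<lambda>x. (1 / x) ^ n * exp (- (1 / x))) has_real_derivative
       (flat_exp (Suc (Suc n)) x - real n * flat_exp (Suc n) x)) (at x)"
    proof (cases n)
      case 0
      then show ?thesis using 1
        by (auto intro!: derivative_eq_intros simp: flat_exp_def field_simps power2_eq_square)
    next
      case (Suc m)
      have "((\<lambda>x. (1 / x) ^ Suc m) has_real_derivative real (Suc m) * (1 / x) ^ m * (- 1 / x\<^sup>2)) (at x)"
      proof -
        have "((\<lambda>x. 1 / x) has_real_derivative - 1 / x\<^sup>2) (at x)"
          using 1 by (auto intro!: derivative_eq_intros simp: power2_eq_square)
        from DERIV_power_Suc[OF this, of m] show ?thesis by (simp add: mult_ac)
      qed
      moreover have "((\<lambda>x. exp (- (1 / x))) has_real_derivative exp (- (1 / x)) * (1 / x\<^sup>2)) (at x)"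
        using 1 by (auto intro!: derivative_eq_intros simp: power2_eq_square)
      ultimately have "((\<lambda>x. (1 / x) ^ Suc m * exp (- (1 / x))) has_real_derivative
         real (Suc m) * (1 / x) ^ m * (- 1 / x\<^sup>2) * exp (- (1 / x))
          + exp (- (1 / x)) * (1 / x\<^sup>2) * (1 / x) ^ Suc m) (at x)"
        by (rule DERIV_mult)
      moreover have "real (Suc m) * (1 / x) ^ m * (- 1 / x\<^sup>2) * exp (- (1 / x))
          + exp (- (1 / x)) * (1 / x\<^sup>2) * (1 / x) ^ Suc m
         = flat_exp (Suc (Suc n)) x - real n * flat_exp (Suc n) x"
        using 1 Suc by (simp add: flat_exp_def power2_eq_square add_divide_distrib algebra_simps)
      ultimately show ?thesis using Suc by simp
    qed
    moreover have "eventually (\<lambda>y. (1 / y) ^ n * exp (- (1 / y)) = flat_exp n y) (nhds x)"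
      by (rule eventually_mono[OF eventually_nhds_in_open[of "{0<..}"]])
        (use 1 in \<open>auto simp: flat_exp_def\<close>)
    ultimately show ?thesis by (rule DERIV_transform_nhds)
  next
    case 2
    have "((\<lambda>x::real. 0) has_real_derivative
       (flat_exp (Suc (Suc n)) x - real n * flat_exp (Suc n) x)) (at x)"
      using 2 by (auto simp: flat_exp_def)
    moreover have "eventually (\<lambda>y. 0 = flat_exp n y) (nhds x)"
      by (rule eventually_mono[OF eventually_nhds_in_open[of "{..<0}"]])
        (use 2 in \<open>auto simp: flat_exp_def\<close>)
    ultimately show ?thesis by (rule DERIV_transform_nhds)
  next
    case 3
    have l: "((\<lambda>y. (flat_exp n y - flat_exp n 0) / (y - 0)) \<longlongrightarrow> 0) (at_left 0)"
      by (rule tendsto_eventually) (auto simp: flat_exp_def eventually_at_filter)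
    \<comment> \<open>Right of 0 the difference quotient of \<open>flat_exp n\<close> is
      \<open>flat_exp (Suc n)\<close> itself, since dividing by \<open>y\<close> adds one power of 1
      / y; the limit known for the whole family thus also yields the derivative.\<close>
    have "eventually (\<lambda>y. flat_exp (Suc n) y = (flat_exp n y - flat_exp n 0) / (y - 0)) (at_right 0)"
      by (auto simp: flat_exp_def eventually_at_filter)
    from Lim_transform_eventually[OF flat_exp_tendsto this]
    have "((\<lambda>y. (flat_exp n y - flat_exp n 0) / (y - 0)) \<longlongrightarrow> 0) (at 0)"
      using l by (simp add: filterlim_split_at)
    then show ?thesis using 3 by (simp add: has_field_derivative_iff flat_exp_def)
  qed
qed

lemma Ck_real_flat_exp: "Ck_real k (flat_exp n)"
proof (induction k arbitrary: n)
  case 0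
  then show ?case
    by (auto intro!: continuous_at_imp_continuous_on DERIV_isCont flat_exp_deriv)
next
  case (Suc k)
  have "Ck_real k (\<lambda>x. flat_exp (Suc (Suc n)) x + (- real n) * flat_exp (Suc n) x)"
    by (intro Ck_real_add Ck_real_mult Ck_real_const Suc.IH)
  then have "Ck_real k (\<lambda>x. flat_exp (Suc (Suc n)) x - real n * flat_exp (Suc n) x)" by simp
  then show ?case using flat_exp_deriv[of n] by (intro Ck_real_SucI)
qed

text \<open>The quotient f(x) / (f(x) + f(1 - x)) with f(x) = exp (- 1 / x) for positive x; the
  reflected argument is written \<open>- 1 * x + 1\<close> so that \<open>Ck_real_affine\<close>
  matches it.\<close>

definition smooth_step :: "real \<Rightarrow> real" where
  "smooth_step x = flat_exp 0 x * inverse (flat_exp 0 x + flat_exp 0 (- 1 * x + 1))"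

lemma smooth_step_denom: "flat_exp 0 x + flat_exp 0 (- 1 * x + 1) > 0"
  by (auto simp: flat_exp_def add_pos_nonneg)

lemma smooth_smooth_step: "smooth_real smooth_step"
proof -
  have "Ck_real k (\<lambda>x. flat_exp 0 x * inverse (flat_exp 0 x + flat_exp 0 (- 1 * x + 1)))" for k
    using smooth_step_denom
    by (intro Ck_real_mult Ck_real_inverse Ck_real_add Ck_real_flat_exp Ck_real_affine)
      (auto simp: less_le)
  then show ?thesis unfolding smooth_real_def smooth_step_def[abs_def] by blast
qed

lemma smooth_step_eq_0: "x \<le> 0 \<Longrightarrow> smooth_step x = 0"
  and smooth_step_eq_1: "x \<ge> 1 \<Longrightarrow> smooth_step x = 1"
  by (auto simp: smooth_step_def flat_exp_def)

lemma smooth_step_bounds: "0 \<le> smooth_step x" "smooth_step x \<le> 1"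
  by (auto simp: smooth_step_def flat_exp_def field_simps add_pos_pos)

definition test_real :: "(real \<Rightarrow> real) \<Rightarrow> bool" where
  "test_real \<psi> \<longleftrightarrow> smooth_real \<psi> \<and> (\<exists>T. \<forall>t. T \<le> \<bar>t\<bar> \<longrightarrow> \<psi> t = 0)"

lemma test_real_smooth: "test_real \<psi> \<Longrightarrow> smooth_real \<psi>"
  by (simp add: test_real_def)

lemma deriv_zero_outside:
  assumes "\<And>t::real. T \<le> \<bar>t\<bar> \<Longrightarrow> f t = (0::real)" "T < \<bar>t\<bar>"
  shows "deriv f t = 0"
proof (rule DERIV_imp_deriv)
  have "eventually (\<lambda>y. 0 = f y) (nhds t)"
    by (rule eventually_mono[OF eventually_nhds_in_open[of "{y. T < \<bar>y\<bar>}"]])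
      (use assms in \<open>auto intro!: open_Collect_less continuous_intros\<close>)
  then show "(f has_real_derivative 0) (at t)"
    by (rule DERIV_transform_nhds[rotated]) simp
qed

lemma test_real_deriv:
  assumes "test_real \<psi>"
  shows "test_real (deriv \<psi>)"
proof -
  obtain T where "\<And>t. T \<le> \<bar>t\<bar> \<Longrightarrow> \<psi> t = 0" using assms by (auto simp: test_real_def)
  from deriv_zero_outside[of T \<psi>, OF this] have "\<forall>t. T + 1 \<le> \<bar>t\<bar> \<longrightarrow> deriv \<psi> t = 0" by auto
  then show ?thesis using assms smooth_real_deriv(2) unfolding test_real_def by blast
qed

lemma test_real_mult: "smooth_real f \<Longrightarrow> test_real \<psi> \<Longrightarrow> test_real (\<lambda>t. f t * \<psi> t)"
  unfolding test_real_def by (auto intro: smooth_real_mult)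

lemma test_real_cmult: "test_real \<psi> \<Longrightarrow> test_real (\<lambda>t. c * \<psi> t)"
  by (intro test_real_mult smooth_real_const)

lemma test_real_add:
  assumes "test_real f" "test_real g"
  shows "test_real (\<lambda>t. f t + g t)"
proof -
  obtain S T where "\<forall>t. S \<le> \<bar>t\<bar> \<longrightarrow> f t = 0" "\<forall>t. T \<le> \<bar>t\<bar> \<longrightarrow> g t = 0"
    using assms by (auto simp: test_real_def)
  then have "\<forall>t. max S T \<le> \<bar>t\<bar> \<longrightarrow> f t + g t = 0" by auto
  then show ?thesis using assms smooth_real_add unfolding test_real_def by blast
qed

lemma test_real_bounded:
  assumes "test_real \<psi>"
  obtains B where "\<And>t. \<bar>\<psi> t\<bar> \<le> B" "B \<ge> 0"
proof -
  obtain T where T: "\<And>t. T \<le> \<bar>t\<bar> \<Longrightarrow> \<psi> t = 0" using assms by (auto simp: test_real_def)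
  have "bounded (\<psi> ` {-T..T})"
    by (intro compact_imp_bounded compact_continuous_image smooth_real_continuous
        test_real_smooth assms) auto
  then obtain B where B: "\<And>t. t \<in> {-T..T} \<Longrightarrow> \<bar>\<psi> t\<bar> \<le> B" 
    unfolding bounded_iff by (metis imageI real_norm_def)
  have "\<bar>\<psi> t\<bar> \<le> max B 0" for t
    using B[of t] T[of t] by (cases "\<bar>t\<bar> \<le> T") (auto simp: abs_le_iff)
  then show ?thesis using that[of "max B 0"] by auto
qed


section \<open>Radial test functions\<close>

text \<open>\<open>pd\<close> is a choice term and says nothing before a derivative is known to
  exist; this relation carries existence and value together, and \<open>pd_eqI\<close> converts
  back.\<close>

definition has_pd :: "'n::finite \<Rightarrow> (real^'n \<Rightarrow> real) \<Rightarrow> real \<Rightarrow> real^'n \<Rightarrow> bool" where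
  "has_pd i f d x \<longleftrightarrow> ((\<lambda>t. f (x + t *\<^sub>R axis i 1)) has_real_derivative d) (at 0)"

lemma pd_eqI: "has_pd i f d x \<Longrightarrow> pd i f x = d"
  unfolding pd_def has_pd_def by (rule some_equality) (auto intro: DERIV_unique)

lemma Ck_has_pd:
  assumes "Ck (Suc k) f"
  shows "has_pd i f (pd i f x) x"
proof -
  have "(\<lambda>t. f (x + t *\<^sub>R axis i 1)) differentiable (at 0)" using assms by simp
  then have "\<exists>d. has_pd i f d x" by (simp add: real_differentiable_def has_pd_def)
  then show ?thesis unfolding pd_def has_pd_def by (rule someI_ex)
qed

text \<open>The induction on \<open>k\<close> only uses that the class is stable under partial
  derivatives, so no derivative of order \<open>k\<close> has to be written down.\<close>

lemma Ck_of_closed_class: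
  assumes "\<And>f. f \<in> S \<Longrightarrow> continuous_on UNIV f"
    and "\<And>f i. f \<in> S \<Longrightarrow> \<exists>g\<in>S. \<forall>x. has_pd i f (g x) x"
    and "f \<in> S"
  shows "Ck k f"
  using assms(3)
proof (induction k arbitrary: f)
  case 0
  then show ?case using assms(1) by simp
next
  case (Suc k)
  have "Ck k (pd i f) \<and> (\<forall>x. (\<lambda>t. f (x + t *\<^sub>R axis i 1)) differentiable (at 0))" for i
  proof -
    obtain g where g: "g \<in> S" "\<And>x. has_pd i f (g x) x" using assms(2)[OF Suc.prems] by blast
    then have "pd i f = g" by (auto intro: pd_eqI)
    then show ?thesis using g Suc.IH real_differentiable_def unfolding has_pd_def by blast
  qed
  then show ?case using assms(1)[OF Suc.prems] by simp
qed

lemma has_pd_transform: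
  fixes x :: "real^'n::finite"
  assumes "has_pd i f d x" "open A" "x \<in> A" "\<And>y. y \<in> A \<Longrightarrow> f y = g y"
  shows "has_pd i g d x"
  unfolding has_pd_def
proof (rule DERIV_transform_nhds[OF assms(1)[unfolded has_pd_def]])
  have "((\<lambda>t. x + t *\<^sub>R axis i 1) \<longlongrightarrow> x + 0 *\<^sub>R axis i 1) (nhds 0)"
    by (intro tendsto_intros filterlim_ident)
  then have "eventually (\<lambda>t. x + t *\<^sub>R axis i 1 \<in> A) (nhds 0)"
    using assms(2,3) by (auto simp: tendsto_def)
  then show "eventually (\<lambda>t. f (x + t *\<^sub>R axis i 1) = g (x + t *\<^sub>R axis i 1)) (nhds 0)"
    by eventually_elim (rule assms(4))
qed

lemma has_pd_add: "has_pd i f d x \<Longrightarrow> has_pd i g e x \<Longrightarrow> has_pd i (\<lambda>x. f x + g x) (d + e) x"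
  unfolding has_pd_def by (rule DERIV_add)

lemma has_pd_mult:
  "has_pd i f d x \<Longrightarrow> has_pd i g e x \<Longrightarrow> has_pd i (\<lambda>x. f x * g x) (d * g x + f x * e) x"
  using DERIV_mult[of "\<lambda>t. f (x + t *\<^sub>R axis i 1)" d 0 UNIV "\<lambda>t. g (x + t *\<^sub>R axis i 1)" e]
  by (simp add: mult.commute has_pd_def)

lemma has_pd_const: "has_pd i (\<lambda>_. c) 0 x"
  by (simp add: has_pd_def)

lemma has_pd_coord: "has_pd i (\<lambda>x. x $ j) (if i = j then 1 else 0) x"
  unfolding has_pd_def by (auto intro!: derivative_eq_intros simp: axis_def)

lemma exp_minus2_ln: "r > 0 \<Longrightarrow> exp (- 2 * ln r) = 1 / r\<^sup>2" for r :: real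
  by (simp add: exp_minus exp_double divide_inverse)

text \<open>The chain rule factor 1 / |x|^2 is written as \<open>exp (- 2 * ln (norm x))\<close>, so
  the result is again a coordinate times a function of \<open>ln (norm x)\<close> and the rule can
  be iterated.\<close>

lemma has_pd_ln_norm:
  fixes x :: "real^'n::finite"
  assumes "x \<noteq> 0" "(\<psi> has_real_derivative d) (at (ln (norm x)))"
  shows "has_pd i (\<lambda>x. \<psi> (ln (norm x))) (x $ i * (exp (- 2 * ln (norm x)) * d)) x"
proof -
  have n: "norm (x + t *\<^sub>R axis i 1) = sqrt ((norm x)\<^sup>2 + 2 * t * x $ i + t\<^sup>2)" for t
  proof -
    have "(norm (x + t *\<^sub>R axis i 1))\<^sup>2 = (norm x)\<^sup>2 + 2 * t * x $ i + t\<^sup>2"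
      unfolding power2_norm_eq_inner
      by (simp add: inner_add_left inner_add_right inner_commute[of "axis i 1"]
          inner_axis power2_eq_square algebra_simps)
    then show ?thesis by (metis norm_ge_zero real_sqrt_unique)
  qed
  have "norm x > 0" using assms by simp
  then have "((\<lambda>t. ln (norm (x + t *\<^sub>R axis i 1))) has_real_derivative
      x $ i * exp (- 2 * ln (norm x))) (at 0)"
    unfolding n exp_minus2_ln[OF \<open>norm x > 0\<close>]
    by (auto intro!: derivative_eq_intros simp: field_simps power2_eq_square)
  from DERIV_chain2[OF _ this, of \<psi> d] assms(2) show ?thesis by (simp add: mult_ac has_pd_def)
qed

text \<open>The value 0 at the origin matches \<open>0 powr a = 0\<close> in \<open>U_mu\<close>, so
  that the later identity of functions holds at every point, and it makes the lift of a compactly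
  supported function continuous.\<close>

definition radial_lift :: "(real \<Rightarrow> real) \<Rightarrow> real^'n::finite \<Rightarrow> real" where
  "radial_lift \<psi> x = (if x = 0 then 0 else \<psi> (ln (norm x)))"

definition annular :: "(real^'n::finite \<Rightarrow> real) \<Rightarrow> bool" where
  "annular f \<longleftrightarrow> (\<exists>r R. 0 < r \<and> (\<forall>x. norm x < r \<or> R < norm x \<longrightarrow> f x = 0))"

lemma annular_radial_lift:
  assumes "test_real \<psi>"
  shows "annular (radial_lift \<psi> :: real^'n::finite \<Rightarrow> real)"
proof -
  obtain T where T: "\<And>t. T \<le> \<bar>t\<bar> \<Longrightarrow> \<psi> t = 0" using assms by (auto simp: test_real_def)
  have "radial_lift \<psi> x = 0" if "norm x < exp (- T) \<or> exp T < norm x" for x :: "real^'n"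
  proof (cases "x = 0")
    case False
    then have "ln (norm x) < - T \<or> T < ln (norm x)" using that
      by (metis exp_less_cancel_iff exp_ln zero_less_norm_iff)
    then show ?thesis by (auto simp: radial_lift_def T)
  qed (simp add: radial_lift_def)
  then show ?thesis unfolding annular_def by (meson exp_gt_zero)
qed

lemma annular_test_fun:
  fixes f :: "real^'n::finite \<Rightarrow> real"
  assumes "\<And>k. Ck k f" "annular f"
  shows "test_fun (- {0}) f" and "test_fun UNIV f"
proof -
  obtain r R where rR: "0 < r" "\<And>x. norm x < r \<or> R < norm x \<Longrightarrow> f x = 0"
    using assms(2) by (auto simp: annular_def)
  have sub: "tsupport f \<subseteq> cball 0 R \<inter> {x. r \<le> norm x}"
    unfolding tsupport_def
  proof (rule closure_minimal)
    show "{x. f x \<noteq> 0} \<subseteq> cball 0 R \<inter> {x. r \<le> norm x}"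
      using rR(2) by (force simp: not_less[symmetric])
    show "closed (cball 0 R \<inter> {x::real^'n. r \<le> norm x})"
      by (intro closed_Int closed_cball closed_Collect_le continuous_intros)
  qed
  then have "bounded (tsupport f)" using bounded_cball bounded_subset by blast
  then have "compact (tsupport f)" unfolding tsupport_def
    by (simp add: compact_eq_bounded_closed)
  then show "test_fun (- {0}) f" "test_fun UNIV f"
    using assms(1) sub rR(1) by (auto simp: test_fun_def)
qed

lemma has_pd_radial_lift:
  fixes x :: "real^'n::finite"
  assumes "test_real \<psi>"
  shows "has_pd i (radial_lift \<psi>) (x $ i * radial_lift (\<lambda>t. exp (- 2 * t) * deriv \<psi> t) x) x"
proof (cases "x = 0")
  case False
  have "has_pd i (\<lambda>x. \<psi> (ln (norm x))) (x $ i * (exp (- 2 * ln (norm x)) * deriv \<psi> (ln (norm x)))) x"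
    using assms by (intro has_pd_ln_norm False smooth_real_deriv test_real_smooth)
  then have "has_pd i (radial_lift \<psi>) (x $ i * (exp (- 2 * ln (norm x)) * deriv \<psi> (ln (norm x)))) x"
    by (rule has_pd_transform[where A = "- {0}"]) (use False in \<open>auto simp: radial_lift_def\<close>)
  then show ?thesis using False by (simp add: radial_lift_def)
next
  case True
  obtain r where r: "0 < r" "\<And>x::real^'n. norm x < r \<Longrightarrow> radial_lift \<psi> x = 0"
    using annular_radial_lift[OF assms, where 'n = 'n] by (auto simp: annular_def)
  have "has_pd i (\<lambda>_. 0) 0 x" by (rule has_pd_const)
  then have "has_pd i (radial_lift \<psi>) 0 x"
    by (rule has_pd_transform[where A = "ball 0 r"]) (use True r in \<open>auto\<close>)
  then show ?thesis using True by simp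
qed

lemma continuous_on_vanishing_near_0:
  fixes g :: "real^'n::finite \<Rightarrow> real"
  assumes c: "continuous_on (- {0}) g" and r: "0 < r" "\<And>x. norm x < r \<Longrightarrow> g x = 0"
  shows "continuous_on UNIV g"
proof -
  have "continuous_on (ball 0 r) g"
    by (rule continuous_on_eq[of _ "\<lambda>_. 0"]) (auto simp: r)
  moreover have "- {0} \<union> ball 0 r = (UNIV :: (real^'n) set)" using r(1) by auto
  ultimately show ?thesis using continuous_on_open_Un[OF _ _ c, of "ball 0 r"] by auto
qed

lemma continuous_radial_lift:
  assumes "test_real \<psi>"
  shows "continuous_on UNIV (radial_lift \<psi> :: real^'n::finite \<Rightarrow> real)"
proof -
  obtain r where r: "0 < r" "\<And>x::real^'n. norm x < r \<Longrightarrow> radial_lift \<psi> x = 0"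
    using annular_radial_lift[OF assms, where 'n = 'n] by (auto simp: annular_def)
  have "continuous_on (- {0}) (\<lambda>x::real^'n. \<psi> (ln (norm x)))"
    by (rule continuous_on_compose2[of UNIV \<psi>])
      (auto intro!: continuous_intros smooth_real_continuous test_real_smooth assms)
  then have "continuous_on (- {0}) (radial_lift \<psi> :: real^'n \<Rightarrow> real)"
    by (rule continuous_on_eq) (auto simp: radial_lift_def)
  then show ?thesis by (rule continuous_on_vanishing_near_0[OF _ r])
qed

text \<open>A partial derivative of a radial lift is a coordinate times another lift, so products
  with coordinates and sums must be included to obtain a class stable under \<open>pd\<close>. All
  members vanish near the origin and are therefore test functions on the punctured space.\<close>

inductive_set lift_class :: "(real^'n::finite \<Rightarrow> real) set" where
  lift: "test_real \<psi> \<Longrightarrow> radial_lift \<psi> \<in> lift_class"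
| coord: "f \<in> lift_class \<Longrightarrow> (\<lambda>x. x $ i * f x) \<in> lift_class"
| add: "f \<in> lift_class \<Longrightarrow> g \<in> lift_class \<Longrightarrow> (\<lambda>x. f x + g x) \<in> lift_class"

lemma test_real_lift_deriv: "test_real \<psi> \<Longrightarrow> test_real (\<lambda>t. exp (c * t) * deriv \<psi> t)"
  by (intro test_real_mult smooth_real_exp test_real_deriv)

lemma lift_class_zero: "(\<lambda>x. 0) \<in> lift_class"
proof -
  have "test_real (\<lambda>_. 0)" by (simp add: test_real_def smooth_real_const)
  then have "radial_lift (\<lambda>_. 0) \<in> lift_class" by (rule lift_class.lift)
  then show ?thesis by (simp add: radial_lift_def[abs_def])
qed

lemma lift_class_pd: "f \<in> lift_class \<Longrightarrow> \<exists>g\<in>lift_class. \<forall>x. has_pd j f (g x) x"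
proof (induction rule: lift_class.induct)
  case (lift \<psi>)
  show ?case
    by (intro bexI allI)
      (rule has_pd_radial_lift[OF lift],
       rule lift_class.coord[OF lift_class.lift[OF test_real_lift_deriv[OF lift]]])
next
  case (coord f i)
  then obtain g where g: "g \<in> lift_class" "\<forall>x. has_pd j f (g x) x" by blast
  have "has_pd j (\<lambda>x. x $ i * f x) ((if j = i then f x else 0) + x $ i * g x) x" for x
    using has_pd_mult[OF has_pd_coord[of j i x], of f "g x"] g(2) by (auto split: if_splits)
  moreover have "(\<lambda>x. (if j = i then f x else 0) + x $ i * g x) \<in> lift_class"
    using coord.hyps g(1) lift_class_zero
    by (cases "j = i") (auto intro!: lift_class.add[of "\<lambda>x. 0", simplified] lift_class.intros)
  ultimately show ?case by (intro bexI allI)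
next
  case (add f g)
  then obtain f' g' where "f' \<in> lift_class" "\<forall>x. has_pd j f (f' x) x"
    "g' \<in> lift_class" "\<forall>x. has_pd j g (g' x) x" by blast
  then show ?case 
    by (intro bexI[of _ "\<lambda>x. f' x + g' x"] allI has_pd_add lift_class.add) auto
qed

lemma lift_class_continuous: "f \<in> lift_class \<Longrightarrow> continuous_on UNIV f"
  by (induction rule: lift_class.induct)
    (auto intro!: continuous_intros continuous_radial_lift)

lemma lift_class_annular: "f \<in> lift_class \<Longrightarrow> annular f"
proof (induction rule: lift_class.induct)
  case (lift \<psi>)
  then show ?case by (rule annular_radial_lift)
next
  case (coord f i)
  then show ?case by (auto simp: annular_def)
next
  case (add f g)
  then obtain r R s S where "0 < r" "\<And>x. norm x < r \<or> R < norm x \<Longrightarrow> f x = 0"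
    "0 < s" "\<And>x. norm x < s \<or> S < norm x \<Longrightarrow> g x = 0"
    unfolding annular_def by metis
  then have "0 < min r s \<and> (\<forall>x. norm x < min r s \<or> max R S < norm x \<longrightarrow> f x + g x = 0)"
    by auto
  then show ?case unfolding annular_def by blast
qed

lemma lift_class_test_fun:
  assumes "f \<in> lift_class"
  shows "test_fun (- {0}) f" and "test_fun UNIV f"
  using annular_test_fun[OF Ck_of_closed_class[OF lift_class_continuous lift_class_pd assms]
      lift_class_annular[OF assms]] by blast+

lemma sum_square_norm: "(\<Sum>i\<in>UNIV. x $ i * (x $ i * c)) = (norm x)\<^sup>2 * c" for x :: "real^'n::finite"
proof -
  have "(\<Sum>i\<in>UNIV. x $ i * (x $ i * c)) = (\<Sum>i\<in>UNIV. x $ i * x $ i) * c"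
    by (simp add: sum_distrib_right mult.assoc)
  then show ?thesis by (simp add: power2_norm_eq_inner inner_vec_def)
qed

lemma exp_minus2_ln_norm: "x \<noteq> 0 \<Longrightarrow> (norm x)\<^sup>2 * (exp (- 2 * ln (norm x)) * c) = c"
  for x :: "'a::real_normed_vector"
  using exp_minus2_ln[of "norm x"] by simp

lemma pd_coord_radial_lift:
  fixes x :: "real^'n::finite"
  assumes "test_real \<psi>"
  shows "pd i (\<lambda>x. x $ i * radial_lift \<psi> x) x =
    radial_lift \<psi> x + x $ i * (x $ i * radial_lift (\<lambda>t. exp (- 2 * t) * deriv \<psi> t) x)"
  using has_pd_mult[OF has_pd_coord[of i i x] has_pd_radial_lift[OF assms]]
  by (intro pd_eqI) simp

text \<open>This is the divergence of the field x psi(ln |x|): the Euler operator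
  \<open>x \<bullet> grad\<close> acts as d/dt on functions of t = ln |x|, and the divergence of x
  contributes the dimension.\<close>

lemma sum_pd_coord_radial_lift:
  fixes x :: "real^'n::finite"
  assumes "test_real \<psi>"
  shows "(\<Sum>i\<in>UNIV. pd i (\<lambda>x. x $ i * radial_lift \<psi> x) x) =
    radial_lift (\<lambda>t. real CARD('n) * \<psi> t + deriv \<psi> t) x"
proof -
  have "(\<Sum>i\<in>UNIV. pd i (\<lambda>x. x $ i * radial_lift \<psi> x) x) =
    real CARD('n) * radial_lift \<psi> x + (norm x)\<^sup>2 * radial_lift (\<lambda>t. exp (- 2 * t) * deriv \<psi> t) x"
    by (simp add: pd_coord_radial_lift[OF assms] sum.distrib sum_square_norm)
  then show ?thesis by (simp add: radial_lift_def exp_minus2_ln_norm[simplified])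
qed

lemma pd_radial_lift:
  assumes "test_real \<psi>"
  shows "pd i (radial_lift \<psi>) = (\<lambda>x. x $ i * radial_lift (\<lambda>t. exp (- 2 * t) * deriv \<psi> t) x)"
  by (rule ext) (rule pd_eqI[OF has_pd_radial_lift[OF assms]])

text \<open>The gradient is x times the lift of \<open>exp (- 2 * t) * deriv \<psi> t\<close>, so
  the divergence formula applies; differentiating the weight subtracts 2 from the dimension.\<close>

lemma lap_radial_lift:
  assumes "test_real \<psi>"
  shows "lap (radial_lift \<psi>) = (radial_lift (\<lambda>t. exp (- 2 * t) *
      (deriv (deriv \<psi>) t + (real CARD('n) - 2) * deriv \<psi> t)) :: real^'n::finite \<Rightarrow> real)"
proof
  fix x :: "real^'n"
  have "lap (radial_lift \<psi>) x =
     radial_lift (\<lambda>t. real CARD('n) * (exp (- 2 * t) * deriv \<psi> t) +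
       deriv (\<lambda>t. exp (- 2 * t) * deriv \<psi> t) t) x"
    unfolding lap_def pd_radial_lift[OF assms]
    by (rule sum_pd_coord_radial_lift) (rule test_real_lift_deriv[OF assms])
  also have "deriv (\<lambda>t. exp (- 2 * t) * deriv \<psi> t) =
      (\<lambda>t. exp (- 2 * t) * (deriv (deriv \<psi>) t - 2 * deriv \<psi> t))"
  proof
    fix t
    have "(deriv \<psi> has_real_derivative deriv (deriv \<psi>) t) (at t)"
      by (intro smooth_real_deriv test_real_smooth assms)
    then show "deriv (\<lambda>t. exp (- 2 * t) * deriv \<psi> t) t =
        exp (- 2 * t) * (deriv (deriv \<psi>) t - 2 * deriv \<psi> t)"
      by (intro DERIV_imp_deriv) (auto intro!: derivative_eq_intros simp: algebra_simps)
  qed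
  finally show "lap (radial_lift \<psi>) x = radial_lift (\<lambda>t. exp (- 2 * t) *
      (deriv (deriv \<psi>) t + (real CARD('n) - 2) * deriv \<psi> t)) x"
    by (simp add: algebra_simps)
qed


section \<open>Polar coordinates\<close>

lemma has_bochner_integral_exp_atLeast:
  fixes c t :: real
  assumes "c > 0"
  shows "has_bochner_integral lborel (\<lambda>s. indicator {t..} s * exp (- c * s)) (exp (- c * t) / c)"
proof (rule has_bochner_integral_nn_integral)
  have "((\<lambda>s. - (exp (- c * s) / c)) \<longlongrightarrow> - (0 / c)) at_top"
  proof (intro tendsto_intros)
    have "filterlim (\<lambda>s. c * s) at_top at_top"
      using assms by (intro filterlim_tendsto_pos_mult_at_top[OF tendsto_const _ filterlim_ident])
    then show "((\<lambda>s. exp (- c * s)) \<longlongrightarrow> 0) at_top"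
      by (auto intro!: filterlim_compose[OF exp_at_bot] simp: filterlim_uminus_at_bot)
  qed (use assms in auto)
  then have "(\<integral>\<^sup>+s. ennreal (exp (- c * s)) * indicator {t..} s \<partial>lborel)
      = ennreal (0 - - (exp (- c * t) / c))"
    using assms by (intro nn_integral_FTC_atLeast) (auto intro!: derivative_eq_intros)
  moreover have "ennreal (indicator {t..} s * exp (- c * s)) =
      ennreal (exp (- c * s)) * indicator {t..} s" for s
    by (simp add: indicator_def)
  ultimately show "(\<integral>\<^sup>+s. ennreal (indicator {t..} s * exp (- c * s)) \<partial>lborel)
      = ennreal (exp (- c * t) / c)" by simp
qed (use assms in auto)

lemma has_bochner_integral_exp_atMost:
  fixes c t :: real
  assumes "c > 0"
  shows "has_bochner_integral lborel (\<lambda>s. indicator {..t} s * exp (c * s)) (exp (c * t) / c)"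
  using has_bochner_integral_exp_atLeast[OF assms, of "- t"]
  by (subst lborel_has_bochner_integral_real_affine_iff[of "-1" _ _ 0])
    (auto simp: indicator_def minus_le_iff)

lemma integrable_exp_abs:
  fixes c :: real
  assumes "c > 0"
  shows "integrable lborel (\<lambda>s. exp (- c * \<bar>s\<bar>))"
proof (rule Bochner_Integration.integrable_bound)
  show "integrable lborel (\<lambda>s. indicator {0..} s * exp (- c * s) + indicator {..0} s * exp (c * s))"
    using has_bochner_integral_exp_atLeast[OF assms, of 0] has_bochner_integral_exp_atMost[OF assms, of 0]
    by (intro Bochner_Integration.integrable_add) (auto simp: has_bochner_integral_iff)
  show "AE s in lborel. norm (exp (- c * \<bar>s\<bar>))
      \<le> norm (indicator {0..} s * exp (- c * s) + indicator {..0} s * exp (c * s))"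
    by (intro AE_I2) (auto simp: indicator_def abs_if)
qed auto

text \<open>The surface area of the unit sphere in dimension \<open>N\<close>.\<close>

definition radial_const :: "nat \<Rightarrow> real" where
  "radial_const N = real N * unit_ball_vol (real N)"

lemma radial_const_pos: "N > 0 \<Longrightarrow> radial_const N > 0"
  by (simp add: radial_const_def)

text \<open>Polar coordinates without a change of variables: measures on the line are compared on
  half-lines, where the image measure is the volume of a ball. The comparison runs for
  \<open>- ln (norm x)\<close>, since \<open>{t<..}\<close> then pulls back to a set of finite
  measure, as \<open>measure_eqI_lessThan\<close> requires; a reflection finishes.\<close>

lemma distr_ln_norm:
  "distr lborel borel (\<lambda>x::real^'n::finite. ln (norm x)) =
    density lborel (\<lambda>t. ennreal (radial_const CARD('n) * exp (real CARD('n) * t)))"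
proof -
  let ?N = "real CARD('n)" and ?c = "radial_const CARD('n)"
  let ?f = "\<lambda>x::real^'n. - ln (norm x)"
  let ?d = "\<lambda>t. ennreal (?c * exp (- ?N * t))"
  have N: "?N > 0" by simp
  note c = radial_const_pos[of "CARD('n)", simplified]
  have m: "emeasure (distr lborel borel ?f) {t<..} = ennreal (unit_ball_vol ?N * exp (- ?N * t))" for t
  proof -
    have "emeasure (distr lborel borel ?f) {t<..} = emeasure lborel (?f -` {t<..} \<inter> space lborel)"
      by (rule emeasure_distr) auto
    also have "\<dots> = emeasure lborel {x::real^'n. t < - ln (norm x)}"
      by (simp add: vimage_def)
    also have "\<dots> = emeasure lborel (ball (0::real^'n) (exp (- t)))"
    proof (rule emeasure_eq_AE)
      have "x \<in> {x. t < - ln (norm x)} \<longleftrightarrow> norm x < exp (- t)" if "x \<noteq> 0" for x :: "real^'n"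
      proof -
        have "ln (norm x) < - t \<longleftrightarrow> norm x < exp (- t)"
          using that by (metis exp_less_cancel_iff exp_ln zero_less_norm_iff)
        then show ?thesis by auto
      qed
      then show "AE x in lborel. (x \<in> {x. t < - ln (norm x)}) = (x \<in> ball (0::real^'n) (exp (- t)))"
        by (intro AE_mp[OF AE_lborel_singleton[of "0::real^'n"] AE_I2]) auto
    qed auto
    also have "\<dots> = ennreal (unit_ball_vol ?N * exp (- t) ^ CARD('n))"
      by (subst emeasure_ball) auto
    also have "exp (- t) ^ CARD('n) = exp (- ?N * t)"
      by (simp add: exp_of_nat_mult[symmetric])
    finally show ?thesis .
  qed
  have d: "emeasure (density lborel ?d) {t<..} = ennreal (unit_ball_vol ?N * exp (- ?N * t))" for t
  proof -
    have "emeasure (density lborel ?d) {t<..} = (\<integral>\<^sup>+s. ?d s * indicator {t<..} s \<partial>lborel)"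
      by (rule emeasure_density) auto
    also have "\<dots> = (\<integral>\<^sup>+s. ennreal ?c * ennreal (indicator {t..} s * exp (- ?N * s)) \<partial>lborel)"
    proof (rule nn_integral_cong_AE)
      show "AE s in lborel. ?d s * indicator {t<..} s =
          ennreal ?c * ennreal (indicator {t..} s * exp (- ?N * s))"
        using AE_lborel_singleton[of t] c
        by (auto simp: indicator_def ennreal_mult elim!: eventually_mono)
    qed
    also have "\<dots> = ennreal ?c * (\<integral>\<^sup>+s. ennreal (indicator {t..} s * exp (- ?N * s)) \<partial>lborel)"
      by (rule nn_integral_cmult) auto
    also have "(\<integral>\<^sup>+s. ennreal (indicator {t..} s * exp (- ?N * s)) \<partial>lborel) = ennreal (exp (- ?N * t) / ?N)"
      using has_bochner_integral_exp_atLeast[OF N, of t]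
      by (subst nn_integral_eq_integral) (auto simp: has_bochner_integral_iff)
    also have "ennreal ?c * \<dots> = ennreal (unit_ball_vol ?N * exp (- ?N * t))"
      using c by (subst ennreal_mult[symmetric]) (auto simp: radial_const_def)
    finally show ?thesis .
  qed
  have eq: "distr lborel borel ?f = density lborel ?d"
    by (rule measure_eqI_lessThan, unfold m d) auto
  have "distr lborel borel (\<lambda>x::real^'n. ln (norm x)) = distr (distr lborel borel ?f) borel uminus"
    by (subst distr_distr) (auto simp: o_def)
  also have "\<dots> = distr (density lborel (\<lambda>x. (\<lambda>t. ennreal (?c * exp (?N * t))) (- x))) borel uminus"
    unfolding eq by simp
  also have "\<dots> = density (distr lborel borel uminus) (\<lambda>t. ennreal (?c * exp (?N * t)))"
    by (rule density_distr[symmetric]) auto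
  finally show ?thesis by (simp add: lborel_distr_uminus)
qed

lemma integrable_radial_iff:
  assumes [measurable]: "f \<in> borel_measurable borel"
  shows "integrable lborel (\<lambda>x::real^'n::finite. f (ln (norm x)) :: real) \<longleftrightarrow>
    integrable lborel (\<lambda>t. exp (real CARD('n) * t) * f t)"
proof -
  have c: "radial_const CARD('n) > 0" by (simp add: radial_const_pos)
  have "integrable lborel (\<lambda>x::real^'n. f (ln (norm x))) \<longleftrightarrow>
      integrable (distr lborel borel (\<lambda>x::real^'n. ln (norm x))) f"
    by (rule integrable_distr_eq[symmetric]) auto
  also have "\<dots> \<longleftrightarrow> integrable lborel (\<lambda>t. (radial_const CARD('n) * exp (real CARD('n) * t)) *\<^sub>R f t)"
    unfolding distr_ln_norm using c by (intro integrable_density) (auto intro: less_imp_le)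
  also have "\<dots> \<longleftrightarrow> integrable lborel (\<lambda>t. radial_const CARD('n) * (exp (real CARD('n) * t) * f t))"
    by (simp add: mult.assoc)
  finally show ?thesis using c by simp
qed

lemma integral_radial:
  assumes [measurable]: "f \<in> borel_measurable borel"
  shows "(\<integral>x. f (ln (norm (x::real^'n::finite))) \<partial>lborel) =
    radial_const CARD('n) * (\<integral>t. exp (real CARD('n) * t) * f t \<partial>lborel)"
proof -
  have c: "radial_const CARD('n) > 0" by (simp add: radial_const_pos)
  have "(\<integral>x. f (ln (norm (x::real^'n))) \<partial>lborel) =
      integral\<^sup>L (distr lborel borel (\<lambda>x::real^'n. ln (norm x))) f"
    by (rule integral_distr[symmetric]) auto
  also have "\<dots> = (\<integral>t. (radial_const CARD('n) * exp (real CARD('n) * t)) *\<^sub>R f t \<partial>lborel)"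
    unfolding distr_ln_norm using c by (intro integral_density) (auto intro: less_imp_le)
  finally show ?thesis by (simp add: mult.assoc)
qed

lemma AE_radial_iff:
  assumes [measurable]: "Measurable.pred borel P"
  shows "(AE x in lborel. P (ln (norm (x::real^'n::finite)))) \<longleftrightarrow> (AE t in lborel. P t)"
proof -
  have c: "radial_const CARD('n) > 0" by (simp add: radial_const_pos)
  have "(AE x in lborel. P (ln (norm (x::real^'n)))) \<longleftrightarrow>
      (AE t in distr lborel borel (\<lambda>x::real^'n. ln (norm x)). P t)"
    by (rule AE_distr_iff[symmetric]) auto
  also have "\<dots> \<longleftrightarrow> (AE t in lborel. P t)"
    unfolding distr_ln_norm using c by (subst AE_density) auto
  finally show ?thesis .
qed


section \<open>Integration by parts across the origin\<close>

lemma has_pd_unique: "has_pd i f d x \<Longrightarrow> has_pd i f e x \<Longrightarrow> d = e"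
  unfolding has_pd_def by (rule DERIV_unique)

lemma has_pd_locally_zero:
  assumes "has_pd i f d x" "open A" "x \<in> A" "\<And>y. y \<in> A \<Longrightarrow> f y = 0"
  shows "d = 0"
  using has_pd_transform[OF has_pd_const[of i 0 x] assms(2,3), of f] assms
  by (metis has_pd_unique)

lemma has_pd_along_line:
  assumes "has_pd i f d (x + s *\<^sub>R axis i 1)"
  shows "((\<lambda>t. f (x + t *\<^sub>R axis i 1)) has_real_derivative d) (at s)"
proof -
  have "((\<lambda>t. f (x + (t + s) *\<^sub>R axis i 1)) has_real_derivative d) (at 0)"
    using assms unfolding has_pd_def by (simp add: algebra_simps)
  then show ?thesis
    using DERIV_shift[of "\<lambda>t. f (x + t *\<^sub>R axis i 1)" d 0 s] by simp
qed

lemma integrable_continuous_compact_support: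
  fixes f :: "'a::euclidean_space \<Rightarrow> real"
  assumes "continuous_on UNIV f" "\<And>x. R < norm x \<Longrightarrow> f x = 0"
  shows "integrable lborel f"
proof -
  have "integrable lborel (\<lambda>x. indicator (cball 0 R) x *\<^sub>R f x)"
    by (rule borel_integrable_compact) (auto intro: continuous_on_subset[OF assms(1)])
  moreover have "(\<lambda>x. indicator (cball 0 R) x *\<^sub>R f x) = f"
    using assms(2) by (auto simp: indicator_def fun_eq_iff)
  ultimately show ?thesis by simp
qed

lemma bounded_continuous_compact_support:
  fixes f :: "'a::euclidean_space \<Rightarrow> real"
  assumes "continuous_on UNIV f" "\<And>x. R < norm x \<Longrightarrow> f x = 0"
  obtains B where "\<And>x. \<bar>f x\<bar> \<le> B" "B \<ge> 0"
proof -
  have "bounded (f ` cball 0 R)"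
    by (intro compact_imp_bounded compact_continuous_image continuous_on_subset[OF assms(1)]) auto
  then obtain B where B: "\<And>x. norm x \<le> R \<Longrightarrow> \<bar>f x\<bar> \<le> B"
    unfolding bounded_iff by (metis imageI mem_cball_0 real_norm_def)
  have "\<bar>f x\<bar> \<le> max B 0" for x
    using B[of x] assms(2)[of x] by (cases "norm x \<le> R") auto
  then show ?thesis using that[of "max B 0"] by auto
qed

lemma integral_translate:
  fixes f :: "'a::euclidean_space \<Rightarrow> real"
  assumes "f \<in> borel_measurable borel"
  shows "(\<integral>x. f (c + x) \<partial>lborel) = (\<integral>x. f x \<partial>lborel)"
    and "integrable lborel (\<lambda>x. f (c + x)) \<longleftrightarrow> integrable lborel f"
  using integral_distr[of "(+) c" lborel borel f] integrable_distr_eq[of "(+) c" lborel borel f] assms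
  by (simp_all add: lborel_distr_plus)

text \<open>Translation invariance gives each difference quotient the integral 0, and the mean value
  theorem bounds the quotients uniformly, so dominated convergence passes to the derivative.\<close>

lemma integral_pd_zero:
  fixes F :: "real^'n::finite \<Rightarrow> real"
  assumes d: "\<And>x. has_pd i F (F' x) x" and c: "continuous_on UNIV F" and c': "continuous_on UNIV F'"
    and R: "\<And>x. R < norm x \<Longrightarrow> F x = 0"
  shows "(\<integral>x. F' x \<partial>lborel) = 0"
proof -
  let ?e = "axis i 1 :: real^'n"
  have R': "F' x = 0" if "R < norm x" for x
    by (rule has_pd_locally_zero[OF d, of "{x. R < norm x}"])
      (use that R in \<open>auto intro!: open_Collect_less continuous_intros\<close>)
  obtain B where B: "\<And>x. \<bar>F' x\<bar> \<le> B" "B \<ge> 0"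
    using bounded_continuous_compact_support[OF c' R'] by blast
  have [measurable]: "F \<in> borel_measurable borel" "F' \<in> borel_measurable borel"
    using c c' by (auto intro: borel_measurable_continuous_onI)
  have F: "integrable lborel F" by (rule integrable_continuous_compact_support[OF c R])
  define s where "s k = inverse (real (Suc k))" for k
  have s: "0 < s k" "s k \<le> 1" for k by (auto simp: s_def field_simps)
  define h where "h k x = (F (s k *\<^sub>R ?e + x) - F x) / s k" for k x
  have "(\<lambda>k. \<integral>x. h k x \<partial>lborel) \<longlonglongrightarrow> (\<integral>x. F' x \<partial>lborel)"
  \<comment> \<open>The increments are at most 1, so enlarging the radius by 1 contains the supports
    of all difference quotients.\<close>
  proof (rule integral_dominated_convergence[where w = "\<lambda>x. B * indicator (cball 0 (R + 1)) x"])
    show "AE x in lborel. (\<lambda>k. h k x) \<longlonglongrightarrow> F' x"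
    proof (rule AE_I2)
      fix x
      have "((\<lambda>t. (F (x + t *\<^sub>R ?e) - F x) / t) \<longlongrightarrow> F' x) (at 0)"
        using d[of x] unfolding has_pd_def has_field_derivative_iff by simp
      moreover have "filterlim s (at 0) sequentially"
        unfolding filterlim_at using s LIMSEQ_inverse_real_of_nat
        by (auto simp: s_def[abs_def] less_le)
      ultimately have "(\<lambda>k. (F (x + s k *\<^sub>R ?e) - F x) / s k) \<longlonglongrightarrow> F' x"
        by (rule filterlim_compose)
      then show "(\<lambda>k. h k x) \<longlonglongrightarrow> F' x" by (simp add: h_def add.commute)
    qed
    show "AE x in lborel. norm (h k x) \<le> B * indicator (cball 0 (R + 1)) x" for k
    proof (rule AE_I2)
      fix x
      show "norm (h k x) \<le> B * indicator (cball 0 (R + 1)) x"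
      proof (cases "norm x \<le> R + 1")
        case True
        obtain z where "F (x + s k *\<^sub>R ?e) - F (x + 0 *\<^sub>R ?e) = (s k - 0) * F' (x + z *\<^sub>R ?e)"
          using MVT2[of 0 "s k" "\<lambda>t. F (x + t *\<^sub>R ?e)" "\<lambda>t. F' (x + t *\<^sub>R ?e)"] s(1)[of k]
            has_pd_along_line[OF d] by metis
        then have "h k x = F' (x + z *\<^sub>R ?e)" using s(1)[of k] by (simp add: h_def add.commute)
        then show ?thesis using B(1) True by simp
      next
        case False
        have "norm (x + s k *\<^sub>R ?e) \<ge> norm x - norm (s k *\<^sub>R ?e)" by (rule norm_diff_ineq)
        moreover have "norm (s k *\<^sub>R ?e) \<le> 1" using s[of k] by simp
        ultimately have "R < norm (s k *\<^sub>R ?e + x)" using False by (simp add: add.commute)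
        then show ?thesis using R R[of x] False by (simp add: h_def)
      qed
    qed
    show "integrable lborel (\<lambda>x. B * indicator (cball (0::real^'n) (R + 1)) x)"
      by (intro integrable_mult_right integrable_real_indicator emeasure_lborel_cball_finite) auto
  qed (auto simp: h_def[abs_def])
  moreover have "(\<integral>x. h k x \<partial>lborel) = 0" for k
    using F integral_translate[of F "s k *\<^sub>R ?e"] by (simp add: h_def)
  ultimately show ?thesis by (simp add: LIMSEQ_const_iff)
qed

lemma continuous_on_mult_vanishing_near_0:
  fixes f \<phi> :: "real^'n::finite \<Rightarrow> real"
  assumes "continuous_on (- {0}) f" "continuous_on UNIV \<phi>" "0 < r" "\<And>x. norm x < r \<Longrightarrow> \<phi> x = 0"
  shows "continuous_on UNIV (\<lambda>x. f x * \<phi> x)"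
proof -
  have "continuous_on (- {0}) (\<lambda>x. f x * \<phi> x)"
    by (intro continuous_intros assms(1) continuous_on_subset[OF assms(2)]) auto
  then show ?thesis by (rule continuous_on_vanishing_near_0[OF _ assms(3)]) (simp add: assms(4))
qed

text \<open>Because \<phi> vanishes near the origin, the singularity of \<open>f\<close> is
  invisible and \<open>integral_pd_zero\<close> applies to the product. The singular version is
  obtained from this one by approximation.\<close>

lemma integral_by_parts_annular:
  fixes f f' \<phi> \<phi>' :: "real^'n::finite \<Rightarrow> real"
  assumes f: "\<And>x. x \<noteq> 0 \<Longrightarrow> has_pd i f (f' x) x" "continuous_on (- {0}) f" "continuous_on (- {0}) f'"
    and \<phi>: "\<And>x. has_pd i \<phi> (\<phi>' x) x" "continuous_on UNIV \<phi>" "continuous_on UNIV \<phi>'"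
    and an: "annular \<phi>"
  shows "integrable lborel (\<lambda>x. f x * \<phi>' x)" and "integrable lborel (\<lambda>x. f' x * \<phi> x)"
    and "(\<integral>x. f x * \<phi>' x \<partial>lborel) = - (\<integral>x. f' x * \<phi> x \<partial>lborel)"
proof -
  obtain r R where r: "0 < r" "\<And>x. norm x < r \<Longrightarrow> \<phi> x = 0" and R: "\<And>x. R < norm x \<Longrightarrow> \<phi> x = 0"
    using an unfolding annular_def by blast
  have r': "\<phi>' x = 0" if "norm x < r" for x
    by (rule has_pd_locally_zero[OF \<phi>(1), of "ball 0 r"]) (use that r in auto)
  have R': "\<phi>' x = 0" if "R < norm x" for x
    by (rule has_pd_locally_zero[OF \<phi>(1), of "{x. R < norm x}"])
      (use that R in \<open>auto intro!: open_Collect_less continuous_intros\<close>)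
  have c1: "continuous_on UNIV (\<lambda>x. f x * \<phi>' x)"
    by (rule continuous_on_mult_vanishing_near_0[OF f(2) \<phi>(3) r(1) r'])
  have c2: "continuous_on UNIV (\<lambda>x. f' x * \<phi> x)"
    by (rule continuous_on_mult_vanishing_near_0[OF f(3) \<phi>(2) r])
  have c0: "continuous_on UNIV (\<lambda>x. f x * \<phi> x)"
    by (rule continuous_on_mult_vanishing_near_0[OF f(2) \<phi>(2) r])
  show i1: "integrable lborel (\<lambda>x. f x * \<phi>' x)"
    by (rule integrable_continuous_compact_support[OF c1, of R]) (simp add: R')
  show i2: "integrable lborel (\<lambda>x. f' x * \<phi> x)"
    by (rule integrable_continuous_compact_support[OF c2, of R]) (simp add: R)
  have "has_pd i (\<lambda>x. f x * \<phi> x) (f' x * \<phi> x + f x * \<phi>' x) x" for x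
  proof (cases "x = 0")
    case False
    then show ?thesis by (intro has_pd_mult f \<phi>)
  next
    case True
    have "has_pd i (\<lambda>x. f x * \<phi> x) 0 x"
      by (rule has_pd_transform[OF has_pd_const[of i 0], of "ball 0 r"]) (use True r in auto)
    then show ?thesis using True r r' by simp
  qed
  then have "(\<integral>x. f' x * \<phi> x + f x * \<phi>' x \<partial>lborel) = 0"
    by (rule integral_pd_zero[OF _ c0, of _ _ R]) (auto intro!: continuous_intros c1 c2 simp: R)
  then show "(\<integral>x. f x * \<phi>' x \<partial>lborel) = - (\<integral>x. f' x * \<phi> x \<partial>lborel)"
    using i1 i2 by simp
qed

lemma borel_measurable_continuous_punctured:
  fixes f :: "real^'n::finite \<Rightarrow> real"
  assumes "continuous_on (- {0}) f"
  shows "f \<in> borel_measurable borel"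
proof -
  have "(\<lambda>x. if x \<in> - {0} then f x else f 0) \<in> borel_measurable borel"
    by (rule borel_measurable_continuous_on_if) (use assms in auto)
  moreover have "(\<lambda>x. if x \<in> - {0} then f x else f 0) = f" by auto
  ultimately show ?thesis by simp
qed

lemma AE_nonzero: "AE x in lborel. x \<noteq> (0::'a::euclidean_space)"
  by (rule AE_lborel_singleton)

lemma integrable_norm_powr_local:
  assumes "m < real CARD('n::finite)"
  shows "integrable lborel (\<lambda>x::real^'n. indicator (cball 0 R) x * norm x powr (- m))"
proof -
  \<comment> \<open>Taking the maximum with 1 only enlarges the ball and keeps the logarithm of its
    radius meaningful when \<open>R\<close> is not positive.\<close>
  let ?R = "max R 1"
  have "integrable lborel (\<lambda>t. indicator {..ln ?R} t * exp ((real CARD('n) - m) * t))"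
    using has_bochner_integral_exp_atMost[of "real CARD('n) - m" "ln ?R"] assms
    by (simp add: has_bochner_integral_iff)
  then have "integrable lborel (\<lambda>t. exp (real CARD('n) * t) * (indicator {..ln ?R} t * exp (- m * t)))"
    by (rule Bochner_Integration.integrable_cong[THEN iffD1, rotated -1])
      (auto simp: indicator_def exp_add[symmetric] algebra_simps)
  then have i: "integrable lborel (\<lambda>x::real^'n. indicator {..ln ?R} (ln (norm x)) * exp (- m * ln (norm x)))"
    by (subst integrable_radial_iff) auto
  show ?thesis
  proof (rule Bochner_Integration.integrable_bound[OF i])
    show "AE x in lborel. norm (indicator (cball 0 R) x * norm x powr (- m))
        \<le> norm (indicator {..ln ?R} (ln (norm x)) * exp (- m * ln (norm x)))" 
      using AE_nonzero
    proof eventually_elim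
      case (elim x)
      have "ln (norm x) \<le> ln ?R" if "norm x \<le> R" using elim that by (subst ln_le_cancel_iff) auto
      then show ?case using elim by (auto simp: indicator_def powr_def)
    qed
    have [measurable]: "cball (0::real^'n) R \<in> sets borel" by simp
    show "(\<lambda>x::real^'n. indicator (cball 0 R) x * norm x powr (- m)) \<in> borel_measurable lborel"
      by measurable
  qed
qed

lemma test_real_deriv_smooth_step: "test_real (deriv smooth_step)"
proof -
  have "deriv smooth_step t = 0" if "2 \<le> \<bar>t\<bar>" for t
  proof (rule DERIV_imp_deriv)
    have "((\<lambda>_. smooth_step t) has_real_derivative 0) (at t)" by simp
    moreover have "eventually (\<lambda>y. smooth_step t = smooth_step y) (nhds t)"
      by (rule eventually_mono[OF eventually_nhds_in_open[of "ball t 1"]])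
        (use that in \<open>auto simp: dist_real_def smooth_step_eq_0 smooth_step_eq_1 abs_if split: if_splits\<close>)
    ultimately show "(smooth_step has_real_derivative 0) (at t)" by (rule DERIV_transform_nhds)
  qed
  then show ?thesis unfolding test_real_def using smooth_real_deriv(2)[OF smooth_smooth_step] by blast
qed

text \<open>The cutoffs are functions of ln |x| translated by k, so their gradients are bounded by B
  / |x| with \<open>B\<close> independent of k. Against f = O(|x|^(1 - m)) this gives O(|x|^(-m)),
  integrable near 0; as the gradients tend to 0 pointwise, the error vanishes by dominated
  convergence.\<close>

lemma integral_by_parts_singular:
  fixes f f' \<phi> \<phi>' :: "real^'n::finite \<Rightarrow> real"
  assumes f: "\<And>x. x \<noteq> 0 \<Longrightarrow> has_pd i f (f' x) x" "continuous_on (- {0}) f" "continuous_on (- {0}) f'"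
    and m: "m < real CARD('n)" and C: "\<And>x. x \<noteq> 0 \<Longrightarrow> \<bar>f x\<bar> \<le> C * norm x powr (1 - m)"
      "\<And>x. x \<noteq> 0 \<Longrightarrow> \<bar>f' x\<bar> \<le> C * norm x powr (- m)"
    and \<phi>: "\<And>x. has_pd i \<phi> (\<phi>' x) x" "continuous_on UNIV \<phi>" "continuous_on UNIV \<phi>'"
    and R: "\<And>x. R < norm x \<Longrightarrow> \<phi> x = 0"
  shows "integrable lborel (\<lambda>x. f x * \<phi>' x)" and "integrable lborel (\<lambda>x. f' x * \<phi> x)"
    and "(\<integral>x. f x * \<phi>' x \<partial>lborel) = - (\<integral>x. f' x * \<phi> x \<partial>lborel)"
proof -
  have R': "\<phi>' x = 0" if "R < norm x" for x
    by (rule has_pd_locally_zero[OF \<phi>(1), of "{x. R < norm x}"])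
      (use that R in \<open>auto intro!: open_Collect_less continuous_intros\<close>)
  obtain M1 where M1: "\<And>x. \<bar>\<phi> x\<bar> \<le> M1" "M1 \<ge> 0"
    using bounded_continuous_compact_support[OF \<phi>(2) R] by blast
  obtain M2 where M2: "\<And>x. \<bar>\<phi>' x\<bar> \<le> M2" "M2 \<ge> 0"
    using bounded_continuous_compact_support[OF \<phi>(3) R'] by blast
  obtain B where B: "\<And>t. \<bar>deriv smooth_step t\<bar> \<le> B" "B \<ge> 0"
    using test_real_bounded[OF test_real_deriv_smooth_step] by blast
  have [measurable]: "f \<in> borel_measurable borel" "f' \<in> borel_measurable borel"
    "\<phi> \<in> borel_measurable borel" "\<phi>' \<in> borel_measurable borel" "smooth_step \<in> borel_measurable borel"
    "deriv smooth_step \<in> borel_measurable borel"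
    using f \<phi> smooth_smooth_step test_real_smooth[OF test_real_deriv_smooth_step]
    by (auto intro: borel_measurable_continuous_onI borel_measurable_continuous_punctured smooth_real_borel)
  \<comment> \<open>One majorant for all terms: the summands of its constant belong to f \<phi>', to
    f \<phi> times the gradient of the cutoff, and to f' \<phi>.\<close>
  define w where "w x = (\<bar>C\<bar> * (\<bar>R\<bar> * M2 + B * M1 + M1)) * (indicator (cball 0 R) x * norm x powr (- m))"
    for x :: "real^'n"
  have w: "integrable lborel w"
    unfolding w_def[abs_def] by (intro integrable_mult_right integrable_norm_powr_local m)
  have powr1: "norm x powr (1 - m) = norm x * norm x powr (- m)" if "x \<noteq> 0" for x :: "real^'n"
    using that by (simp add: powr_diff powr_minus divide_inverse)
  have b1: "\<bar>f x\<bar> * \<bar>\<phi>' x\<bar> + B / norm x * (\<bar>f x\<bar> * \<bar>\<phi> x\<bar>) + \<bar>f' x\<bar> * \<bar>\<phi> x\<bar> \<le> w x" if "x \<noteq> 0" for x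
  proof (cases "norm x \<le> R")
    case False
    then show ?thesis using R R' by (simp add: w_def)
  next
    case True
    let ?p = "norm x powr (- m)"
    have C1: "\<bar>f x\<bar> \<le> \<bar>C\<bar> * (norm x * ?p)" "\<bar>f' x\<bar> \<le> \<bar>C\<bar> * ?p"
      using C[OF that] powr1[OF that]
      by (auto intro: order_trans[OF _ mult_right_mono[OF abs_ge_self[of C]]])
    have "\<bar>f x\<bar> * \<bar>\<phi>' x\<bar> \<le> (\<bar>C\<bar> * (\<bar>R\<bar> * ?p)) * M2"
      using C1(1) True M2(1)[of x]
      by (intro mult_mono order_trans[OF C1(1)] mult_left_mono mult_right_mono) auto
    moreover have "B / norm x * (\<bar>f x\<bar> * \<bar>\<phi> x\<bar>) \<le> B / norm x * ((\<bar>C\<bar> * (norm x * ?p)) * M1)"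
      using C1(1) M1(1)[of x] M1(2) B(2) by (intro mult_left_mono mult_mono) auto
    moreover have "B / norm x * ((\<bar>C\<bar> * (norm x * ?p)) * M1) = B * (\<bar>C\<bar> * ?p * M1)"
      using that by simp
    moreover have "\<bar>f' x\<bar> * \<bar>\<phi> x\<bar> \<le> (\<bar>C\<bar> * ?p) * M1"
      using C1(2) M1(1)[of x] M1(2) by (intro mult_mono) auto
    moreover have "w x = (\<bar>C\<bar> * (\<bar>R\<bar> * ?p)) * M2 + B * (\<bar>C\<bar> * ?p * M1) + (\<bar>C\<bar> * ?p) * M1"
      using True by (simp add: w_def algebra_simps)
    ultimately show ?thesis by linarith
  qed
  have nn: "0 \<le> \<bar>f x\<bar> * \<bar>\<phi>' x\<bar>" "0 \<le> B / norm x * (\<bar>f x\<bar> * \<bar>\<phi> x\<bar>)" "0 \<le> \<bar>f' x\<bar> * \<bar>\<phi> x\<bar>" for x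
    using B(2) by auto
  have wn: "\<bar>w x\<bar> = w x" for x unfolding w_def using M1(2) M2(2) B(2) by (intro abs_of_nonneg) auto
  show i1: "integrable lborel (\<lambda>x. f x * \<phi>' x)"
  proof (rule Bochner_Integration.integrable_bound[OF w])
    show "AE x in lborel. norm (f x * \<phi>' x) \<le> norm (w x)"
      using AE_nonzero
    proof eventually_elim
      case (elim x)
      show ?case unfolding real_norm_def abs_mult wn using b1[OF elim] nn[of x] by linarith
    qed
  qed auto
  show i2: "integrable lborel (\<lambda>x. f' x * \<phi> x)"
  proof (rule Bochner_Integration.integrable_bound[OF w])
    show "AE x in lborel. norm (f' x * \<phi> x) \<le> norm (w x)"
      using AE_nonzero
    proof eventually_elim
      case (elim x)
      show ?case unfolding real_norm_def abs_mult wn using b1[OF elim] nn[of x] by linarith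
    qed
  qed auto
  \<comment> \<open>The cutoff vanishes for |x| < exp (- k) and equals 1 for |x| >= exp (1 -
    k).\<close>
  define X where "X k x = (if x = 0 then 0 else smooth_step (ln (norm x) + real k))"
    for k and x :: "real^'n"
  define X' where "X' k x = x $ i * (exp (- 2 * ln (norm x)) * deriv smooth_step (ln (norm x) + real k))"
    for k and x :: "real^'n"
  have X0: "X k x = 0" if "norm x < exp (- real k)" for k x
  proof (cases "x = 0")
    case False
    then have "ln (norm x) < - real k" using that
      by (metis exp_less_cancel_iff exp_ln zero_less_norm_iff)
    then show ?thesis by (simp add: X_def smooth_step_eq_0)
  qed (simp add: X_def)
  have Xd: "has_pd i (X k) (X' k x) x" for k x
  proof (cases "x = 0")
    case False
    have "((\<lambda>t. smooth_step (t + real k)) has_real_derivative deriv smooth_step (ln (norm x) + real k))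
        (at (ln (norm x)))"
      using smooth_real_deriv(1)[OF smooth_smooth_step] by (simp add: DERIV_shift[symmetric])
    from has_pd_ln_norm[OF False this, of i] show ?thesis
      unfolding X'_def
      by (rule has_pd_transform[where A = "- {0}"]) (use False in \<open>auto simp: X_def\<close>)
  next
    case True
    have "has_pd i (X k) 0 x"
      by (rule has_pd_transform[OF has_pd_const[of i 0], of "ball 0 (exp (- real k))"])
        (use True X0 in auto)
    then show ?thesis using True by (simp add: X'_def)
  qed
  have cX: "continuous_on (- {0}) (X k)" for k
  proof -
    have "continuous_on (- {0}) (\<lambda>x::real^'n. smooth_step (ln (norm x) + real k))"
      by (rule continuous_on_compose2[OF smooth_real_continuous[OF smooth_smooth_step, of UNIV]])
        (auto intro!: continuous_intros)
    then show ?thesis by (rule continuous_on_eq) (auto simp: X_def)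
  qed
  have cX': "continuous_on (- {0}) (X' k)" for k
  proof -
    have "continuous_on (- {0}) (\<lambda>x::real^'n. deriv smooth_step (ln (norm x) + real k))"
      by (rule continuous_on_compose2[OF smooth_real_continuous[OF
            test_real_smooth[OF test_real_deriv_smooth_step], of UNIV]])
        (auto intro!: continuous_intros)
    then show ?thesis unfolding X'_def by (auto intro!: continuous_intros)
  qed
  have X'0: "X' k x = 0" if "norm x < exp (- real k)" for k x
    by (rule has_pd_locally_zero[OF Xd, of "ball 0 (exp (- real k))"]) (use that X0 in auto)
  have cXU: "continuous_on UNIV (X k)" "continuous_on UNIV (X' k)" for k
    using continuous_on_vanishing_near_0[OF cX exp_gt_zero X0] continuous_on_vanishing_near_0[OF cX' exp_gt_zero X'0]
    by blast+
  have [measurable]: "X k \<in> borel_measurable borel" "X' k \<in> borel_measurable borel" for k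
    using cXU by (auto intro: borel_measurable_continuous_onI)
  have Xb: "\<bar>X k x\<bar> \<le> 1" "\<bar>X' k x\<bar> \<le> B / norm x" if "x \<noteq> 0" for k x
  proof -
    show "\<bar>X k x\<bar> \<le> 1" using smooth_step_bounds by (simp add: X_def)
    have "\<bar>X' k x\<bar> = \<bar>x $ i\<bar> * ((1 / (norm x)\<^sup>2) * \<bar>deriv smooth_step (ln (norm x) + real k)\<bar>)"
      using exp_minus2_ln[of "norm x"] that by (simp add: X'_def abs_mult)
    also have "\<dots> \<le> norm x * ((1 / (norm x)\<^sup>2) * B)"
      using B component_le_norm_cart[of x i] by (intro mult_mono) auto
    also have "\<dots> = B / norm x" using that by (simp add: power2_eq_square)
    finally show "\<bar>X' k x\<bar> \<le> B / norm x" .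
  qed
  have ev: "eventually (\<lambda>k. X k x = 1 \<and> X' k x = 0) sequentially" if "x \<noteq> 0" for x
    using eventually_ge_at_top[of "nat \<lceil>2 - ln (norm x)\<rceil>"]
  proof eventually_elim
    case (elim k)
    then have "2 - ln (norm x) \<le> real k" by linarith
    \<comment> \<open>The margin 2 rather than 1 leaves an open neighbourhood on which the step is
      constant, so that its derivative vanishes as well.\<close>
    then have *: "2 \<le> ln (norm x) + real k" by simp
    have "deriv smooth_step (ln (norm x) + real k) = 0"
    proof (rule DERIV_imp_deriv)
      have "((\<lambda>_. 1) has_real_derivative 0) (at (ln (norm x) + real k))" by simp
      moreover have "eventually (\<lambda>y. 1 = smooth_step y) (nhds (ln (norm x) + real k))"
        by (rule eventually_mono[OF eventually_nhds_in_open[of "{1<..}"]])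
          (use * in \<open>auto simp: smooth_step_eq_1\<close>)
      ultimately show "(smooth_step has_real_derivative 0) (at (ln (norm x) + real k))"
        by (rule DERIV_transform_nhds)
    qed
    then show ?case using * that by (simp add: X_def X'_def smooth_step_eq_1)
  qed
  have eq: "(\<integral>x. f x * (X' k x * \<phi> x + X k x * \<phi>' x) \<partial>lborel) = - (\<integral>x. f' x * (X k x * \<phi> x) \<partial>lborel)" for k
  proof (rule integral_by_parts_annular(3)[OF f])
    show "has_pd i (\<lambda>x. X k x * \<phi> x) (X' k x * \<phi> x + X k x * \<phi>' x) x" for x
      by (intro has_pd_mult Xd \<phi>)
    show "annular (\<lambda>x. X k x * \<phi> x)"
      unfolding annular_def by (intro exI[of _ "exp (- real k)"] exI[of _ R]) (auto simp: X0 R)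
  qed (auto intro!: continuous_intros cXU \<phi>)
  have l1: "(\<lambda>k. \<integral>x. f x * (X' k x * \<phi> x + X k x * \<phi>' x) \<partial>lborel) \<longlonglongrightarrow> (\<integral>x. f x * \<phi>' x \<partial>lborel)"
  proof (rule integral_dominated_convergence[OF _ _ w])
    show "AE x in lborel. (\<lambda>k. f x * (X' k x * \<phi> x + X k x * \<phi>' x)) \<longlonglongrightarrow> f x * \<phi>' x"
      using AE_nonzero
    proof eventually_elim
      case (elim x)
      show ?case by (rule tendsto_eventually, rule eventually_mono[OF ev[OF elim]]) auto
    qed
    show "AE x in lborel. norm (f x * (X' k x * \<phi> x + X k x * \<phi>' x)) \<le> w x" for k
      using AE_nonzero
    proof eventually_elim
      case (elim x)
      have "norm (f x * (X' k x * \<phi> x + X k x * \<phi>' x)) \<le> \<bar>f x\<bar> * (\<bar>X' k x\<bar> * \<bar>\<phi> x\<bar> + \<bar>X k x\<bar> * \<bar>\<phi>' x\<bar>)"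
        unfolding real_norm_def abs_mult[of "f x"]
        by (intro mult_left_mono order_trans[OF abs_triangle_ineq]) (auto simp: abs_mult)
      also have "\<dots> \<le> \<bar>f x\<bar> * (B / norm x * \<bar>\<phi> x\<bar> + 1 * \<bar>\<phi>' x\<bar>)"
        using Xb[OF elim, of k] by (intro mult_left_mono add_mono mult_right_mono) auto
      also have "\<dots> = \<bar>f x\<bar> * \<bar>\<phi>' x\<bar> + B / norm x * (\<bar>f x\<bar> * \<bar>\<phi> x\<bar>)" by (simp add: algebra_simps)
      finally show ?case using b1[OF elim] nn[of x] by linarith
    qed
  qed auto
  have l2: "(\<lambda>k. \<integral>x. f' x * (X k x * \<phi> x) \<partial>lborel) \<longlonglongrightarrow> (\<integral>x. f' x * \<phi> x \<partial>lborel)"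
  proof (rule integral_dominated_convergence[OF _ _ w])
    show "AE x in lborel. (\<lambda>k. f' x * (X k x * \<phi> x)) \<longlonglongrightarrow> f' x * \<phi> x"
      using AE_nonzero
    proof eventually_elim
      case (elim x)
      show ?case by (rule tendsto_eventually, rule eventually_mono[OF ev[OF elim]]) auto
    qed
    show "AE x in lborel. norm (f' x * (X k x * \<phi> x)) \<le> w x" for k
      using AE_nonzero
    proof eventually_elim
      case (elim x)
      have "norm (f' x * (X k x * \<phi> x)) \<le> \<bar>f' x\<bar> * (1 * \<bar>\<phi> x\<bar>)"
        unfolding real_norm_def abs_mult
        using Xb[OF elim, of k] by (intro mult_left_mono mult_right_mono) auto
      then show ?case using b1[OF elim] nn[of x] by linarith
    qed
  qed auto
  show "(\<integral>x. f x * \<phi>' x \<partial>lborel) = - (\<integral>x. f' x * \<phi> x \<partial>lborel)"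
    using LIMSEQ_unique[OF l1 tendsto_minus[OF l2, folded eq]] .
qed


section \<open>Weak derivatives of radial functions\<close>

lemma mem_tsupport: "f x \<noteq> 0 \<Longrightarrow> x \<in> tsupport f"
  unfolding tsupport_def by (rule closure_subset[THEN subsetD]) simp

lemma test_fun_pd:
  assumes "test_fun UNIV \<phi>"
  shows "test_fun UNIV (pd i \<phi>)"
proof -
  have c: "Ck (Suc k) \<phi>" for k using assms by (auto simp: test_fun_def)
  have "{x. pd i \<phi> x \<noteq> 0} \<subseteq> tsupport \<phi>"
  proof
    fix x assume x: "x \<in> {x. pd i \<phi> x \<noteq> 0}"
    have "pd i \<phi> x = 0" if "x \<notin> tsupport \<phi>"
      by (rule has_pd_locally_zero[OF Ck_has_pd[OF c[of 0]], of "- tsupport \<phi>"])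
        (use that mem_tsupport in \<open>auto simp: tsupport_def[of \<phi>, symmetric] intro: closed_closure[of "{x. \<phi> x \<noteq> 0}", folded tsupport_def]\<close>)
    then show "x \<in> tsupport \<phi>" using x by auto
  qed
  then have "tsupport (pd i \<phi>) \<subseteq> tsupport \<phi>"
    unfolding tsupport_def[of "pd i \<phi>"]
    by (rule closure_minimal) (simp add: tsupport_def)
  moreover have "closed (tsupport (pd i \<phi>))" by (simp add: tsupport_def)
  moreover have "compact (tsupport \<phi>)" using assms by (simp add: test_fun_def)
  ultimately have "compact (tsupport (pd i \<phi>))"
    using compact_Int_closed[of "tsupport \<phi>"] by (metis inf.absorb_iff2)
  moreover have "Ck k (pd i \<phi>)" for k using c[of k] by simp
  ultimately show ?thesis by (simp add: test_fun_def)
qed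

lemma test_fun_facts:
  assumes "test_fun UNIV \<phi>"
  shows "has_pd i \<phi> (pd i \<phi> x) x" "continuous_on UNIV \<phi>" "continuous_on UNIV (pd i \<phi>)"
    and "\<exists>R. \<forall>x. R < norm x \<longrightarrow> \<phi> x = 0"
proof -
  have c: "Ck k \<phi>" for k using assms by (auto simp: test_fun_def)
  show "has_pd i \<phi> (pd i \<phi> x) x" using Ck_has_pd c by blast
  show "continuous_on UNIV \<phi>" using c[of 0] by simp
  show "continuous_on UNIV (pd i \<phi>)" using c[of "Suc 0"] by simp
  have "bounded (tsupport \<phi>)" using assms compact_imp_bounded by (auto simp: test_fun_def)
  then obtain R where "\<And>x. x \<in> tsupport \<phi> \<Longrightarrow> norm x \<le> R" by (auto simp: bounded_iff)
  then show "\<exists>R. \<forall>x. R < norm x \<longrightarrow> \<phi> x = 0" by (meson not_le mem_tsupport)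
qed

lemma test_fun_mono: "test_fun A \<phi> \<Longrightarrow> A \<subseteq> B \<Longrightarrow> test_fun B \<phi>"
  by (auto simp: test_fun_def)

lemma continuous_on_radial_lift_punctured:
  assumes "continuous_on UNIV \<psi>"
  shows "continuous_on (- {0}) (radial_lift \<psi> :: real^'n::finite \<Rightarrow> real)"
proof -
  have "continuous_on (- {0}) (\<lambda>x::real^'n. \<psi> (ln (norm x)))"
    by (rule continuous_on_compose2[OF assms]) (auto intro!: continuous_intros)
  then show ?thesis by (rule continuous_on_eq) (auto simp: radial_lift_def)
qed

lemma radial_lift_borel:
  assumes [measurable]: "\<psi> \<in> borel_measurable borel"
  shows "(radial_lift \<psi> :: real^'n::finite \<Rightarrow> real) \<in> borel_measurable borel"
  unfolding radial_lift_def[abs_def] by measurable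

lemma radial_lift_AE: "AE x in lborel. radial_lift \<psi> (x::real^'n::finite) = \<psi> (ln (norm x))"
  using AE_nonzero by eventually_elim (simp add: radial_lift_def)

lemma integrable_radial_lift_iff:
  assumes [measurable]: "\<psi> \<in> borel_measurable borel"
  shows "integrable lborel (radial_lift \<psi> :: real^'n::finite \<Rightarrow> real) \<longleftrightarrow>
    integrable lborel (\<lambda>t. exp (real CARD('n) * t) * \<psi> t)"
proof -
  have "integrable lborel (radial_lift \<psi> :: real^'n \<Rightarrow> real) \<longleftrightarrow>
      integrable lborel (\<lambda>x::real^'n. \<psi> (ln (norm x)))"
    using radial_lift_borel[OF assms] by (intro integrable_cong_AE radial_lift_AE) auto
  then show ?thesis by (simp add: integrable_radial_iff[OF assms])
qed

lemma exp_ln_norm_powr: "x \<noteq> 0 \<Longrightarrow> exp (c * ln (norm x)) = norm x powr c"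
  for x :: "'a::real_normed_vector"
  by (simp add: powr_def)

lemma has_pd_radial_lift_punctured:
  assumes "x \<noteq> 0" "\<And>t. (\<psi> has_real_derivative \<psi>' t) (at t)"
  shows "has_pd i (radial_lift \<psi>) (x $ i * radial_lift (\<lambda>t. exp (- 2 * t) * \<psi>' t) x) x"
proof -
  have "has_pd i (\<lambda>x. \<psi> (ln (norm x))) (x $ i * (exp (- 2 * ln (norm x)) * \<psi>' (ln (norm x)))) x"
    by (intro has_pd_ln_norm assms)
  then have "has_pd i (radial_lift \<psi>) (x $ i * (exp (- 2 * ln (norm x)) * \<psi>' (ln (norm x)))) x"
    by (rule has_pd_transform[where A = "- {0}"]) (use assms(1) in \<open>auto simp: radial_lift_def\<close>)
  then show ?thesis using assms(1) by (simp add: radial_lift_def)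
qed

text \<open>In terms of x the bounds read O(|x|^(-m)) for the function and O(|x|^(-m-1)) for its
  gradient; the condition on \<open>m\<close> makes the latter locally integrable, as
  \<open>integral_by_parts_singular\<close> demands.\<close>

lemma radial_weak_grad:
  fixes \<phi> :: "real^'n::finite \<Rightarrow> real"
  assumes d: "\<And>t. (\<psi> has_real_derivative \<psi>' t) (at t)" and c: "continuous_on UNIV \<psi>'"
    and C: "\<And>t. \<bar>\<psi> t\<bar> \<le> C * exp (- m * t)" "\<And>t. \<bar>\<psi>' t\<bar> \<le> C * exp (- m * t)"
    and m: "m + 1 < real CARD('n)" and \<phi>: "test_fun UNIV \<phi>"
  shows "integrable lborel (\<lambda>x. radial_lift \<psi> x * pd i \<phi> x)"
    and "integrable lborel (\<lambda>x. (x $ i * radial_lift (\<lambda>t. exp (- 2 * t) * \<psi>' t) x) * \<phi> x)"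
    and "(\<integral>x. radial_lift \<psi> x * pd i \<phi> x \<partial>lborel) =
      - (\<integral>x. (x $ i * radial_lift (\<lambda>t. exp (- 2 * t) * \<psi>' t) x) * \<phi> x \<partial>lborel)"
proof -
  obtain R where R: "\<And>x. R < norm x \<Longrightarrow> \<phi> x = 0" using test_fun_facts(4)[OF \<phi>] by blast
  have c0: "continuous_on UNIV \<psi>"
    using d by (auto intro!: continuous_at_imp_continuous_on intro: DERIV_isCont)
  have b1: "\<bar>radial_lift \<psi> x\<bar> \<le> C * norm x powr (1 - (m + 1))" if "x \<noteq> 0" for x :: "real^'n"
    using C(1)[of "ln (norm x)"] that exp_ln_norm_powr[OF that, of "- m"] by (simp add: radial_lift_def)
  have b2: "\<bar>x $ i * radial_lift (\<lambda>t. exp (- 2 * t) * \<psi>' t) x\<bar> \<le> C * norm x powr (- (m + 1))"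
    if "x \<noteq> 0" for x :: "real^'n"
  proof -
    have "\<bar>x $ i * radial_lift (\<lambda>t. exp (- 2 * t) * \<psi>' t) x\<bar> =
        \<bar>x $ i\<bar> * (norm x powr (-2) * \<bar>\<psi>' (ln (norm x))\<bar>)"
      using that exp_ln_norm_powr[OF that, of "- 2"] by (simp add: radial_lift_def abs_mult)
    also have "\<dots> \<le> norm x * (norm x powr (-2) * (C * norm x powr (- m)))"
      using component_le_norm_cart[of x i] C(2)[of "ln (norm x)"] exp_ln_norm_powr[OF that, of "- m"]
      by (intro mult_mono) auto
    also have "norm x * (norm x powr (-2) * (C * norm x powr (- m))) =
        C * (norm x powr 1 * norm x powr (-2) * norm x powr (- m))"
      using that by simp
    also have "norm x powr 1 * norm x powr (-2) * norm x powr (- m) = norm x powr (- (m + 1))"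
      unfolding powr_add[symmetric] by (simp add: algebra_simps)
    finally show ?thesis .
  qed
  have c2: "continuous_on (- {0}) (\<lambda>x::real^'n. x $ i * radial_lift (\<lambda>t. exp (- 2 * t) * \<psi>' t) x)"
    by (intro continuous_intros continuous_on_radial_lift_punctured c)
  note ibp = integral_by_parts_singular[OF has_pd_radial_lift_punctured[OF _ d]
      continuous_on_radial_lift_punctured[OF c0] c2 m b1 b2 test_fun_facts(1-3)[OF \<phi>] R]
  show "integrable lborel (\<lambda>x. radial_lift \<psi> x * pd i \<phi> x)"
    "integrable lborel (\<lambda>x. (x $ i * radial_lift (\<lambda>t. exp (- 2 * t) * \<psi>' t) x) * \<phi> x)"
    "(\<integral>x. radial_lift \<psi> x * pd i \<phi> x \<partial>lborel) =
      - (\<integral>x. (x $ i * radial_lift (\<lambda>t. exp (- 2 * t) * \<psi>' t) x) * \<phi> x \<partial>lborel)"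
    using ibp by blast+
qed

text \<open>Here \<open>m\<close> measures the singularity of \<open>\<zeta>\<close>; the field x
  zeta is one order better and its divergence has the order of zeta itself, so \<open>m\<close>
  below the dimension suffices. Only the sum over \<open>i\<close> is radial, hence the identity for
  the sum.\<close>

lemma radial_weak_div:
  fixes \<phi> :: "real^'n::finite \<Rightarrow> real"
  assumes d: "\<And>t. (\<zeta> has_real_derivative \<zeta>' t) (at t)" and c: "continuous_on UNIV \<zeta>'"
    and C: "\<And>t. \<bar>\<zeta> t\<bar> \<le> C * exp (- m * t)" "\<And>t. \<bar>\<zeta>' t\<bar> \<le> C * exp (- m * t)"
    and m: "m < real CARD('n)" and \<phi>: "test_fun UNIV \<phi>"
  shows "integrable lborel (\<lambda>x. (x $ i * radial_lift \<zeta> x) * pd i \<phi> x)"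
    and "integrable lborel (\<lambda>x. radial_lift (\<lambda>t. real CARD('n) * \<zeta> t + \<zeta>' t) x * \<phi> x)"
    and "(\<Sum>i\<in>UNIV. \<integral>x. (x $ i * radial_lift \<zeta> x) * pd i \<phi> x \<partial>lborel) =
      - (\<integral>x. radial_lift (\<lambda>t. real CARD('n) * \<zeta> t + \<zeta>' t) x * \<phi> x \<partial>lborel)"
proof -
  obtain R where R: "\<And>x. R < norm x \<Longrightarrow> \<phi> x = 0" using test_fun_facts(4)[OF \<phi>] by blast
  have c0: "continuous_on UNIV \<zeta>"
    using d by (auto intro!: continuous_at_imp_continuous_on intro: DERIV_isCont)
  have C0: "C \<ge> 0" using C(1)[of 0] by simp
  let ?f' = "\<lambda>i x::real^'n. radial_lift \<zeta> x + x $ i * (x $ i * radial_lift (\<lambda>t. exp (- 2 * t) * \<zeta>' t) x)"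
  have d2: "has_pd i (\<lambda>x. x $ i * radial_lift \<zeta> x) (?f' i x) x" if "x \<noteq> 0" for i and x :: "real^'n"
    using has_pd_mult[OF has_pd_coord[of i i x] has_pd_radial_lift_punctured[OF that d]] by simp
  have e: "\<bar>radial_lift \<zeta> x\<bar> \<le> C * norm x powr (- m)" if "x \<noteq> 0" for x :: "real^'n"
    using C(1)[of "ln (norm x)"] that exp_ln_norm_powr[OF that, of "- m"] by (simp add: radial_lift_def)
  have b1: "\<bar>x $ i * radial_lift \<zeta> x\<bar> \<le> (2 * C) * norm x powr (1 - m)" if "x \<noteq> 0" for i and x :: "real^'n"
  proof -
    have "\<bar>x $ i * radial_lift \<zeta> x\<bar> \<le> norm x * (C * norm x powr (- m))"
      unfolding abs_mult using component_le_norm_cart[of x i] e[OF that] by (intro mult_mono) auto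
    also have "\<dots> = C * norm x powr (1 - m)"
      using that by (simp add: powr_diff powr_minus divide_inverse)
    finally show ?thesis using C0 by (simp add: order_trans[OF _ mult_right_mono[of C "2 * C"]])
  qed
  have b2: "\<bar>?f' i x\<bar> \<le> (2 * C) * norm x powr (- m)" if "x \<noteq> 0" for i and x :: "real^'n"
  proof -
    have "\<bar>x $ i * (x $ i * radial_lift (\<lambda>t. exp (- 2 * t) * \<zeta>' t) x)\<bar> =
        \<bar>x $ i\<bar> * (\<bar>x $ i\<bar> * (1 / (norm x)\<^sup>2 * \<bar>\<zeta>' (ln (norm x))\<bar>))"
      using that exp_minus2_ln[of "norm x"] by (simp add: radial_lift_def abs_mult)
    also have "\<dots> \<le> norm x * (norm x * (1 / (norm x)\<^sup>2 * (C * norm x powr (- m))))"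
      using component_le_norm_cart[of x i] C(2)[of "ln (norm x)"] exp_ln_norm_powr[OF that, of "- m"]
      by (intro mult_mono) auto
    also have "\<dots> = C * norm x powr (- m)" using that by (simp add: power2_eq_square)
    finally have "\<bar>x $ i * (x $ i * radial_lift (\<lambda>t. exp (- 2 * t) * \<zeta>' t) x)\<bar> \<le> C * norm x powr (- m)" .
    then show ?thesis using e[OF that]
        abs_triangle_ineq[of "radial_lift \<zeta> x" "x $ i * (x $ i * radial_lift (\<lambda>t. exp (- 2 * t) * \<zeta>' t) x)"]
      by linarith
  qed
  have c1: "continuous_on (- {0}) (\<lambda>x::real^'n. x $ i * radial_lift \<zeta> x)" for i
    by (intro continuous_intros continuous_on_radial_lift_punctured c0)
  have c2: "continuous_on (- {0}) (?f' i)" for i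
    by (intro continuous_intros continuous_on_radial_lift_punctured c c0)
  note ibp = integral_by_parts_singular[OF d2 c1 c2 m b1 b2 test_fun_facts(1-3)[OF \<phi>] R]
  show "integrable lborel (\<lambda>x. (x $ i * radial_lift \<zeta> x) * pd i \<phi> x)" using ibp(1) by blast
  have s: "(\<Sum>i\<in>UNIV. ?f' i x) = radial_lift (\<lambda>t. real CARD('n) * \<zeta> t + \<zeta>' t) x" for x
  proof -
    have "(\<Sum>i\<in>UNIV. ?f' i x) = real CARD('n) * radial_lift \<zeta> x
        + (norm x)\<^sup>2 * radial_lift (\<lambda>t. exp (- 2 * t) * \<zeta>' t) x"
      by (simp add: sum.distrib sum_square_norm)
    then show ?thesis by (simp add: radial_lift_def exp_minus2_ln_norm[simplified])
  qed
  have "integrable lborel (\<lambda>x. \<Sum>i\<in>UNIV. ?f' i x * \<phi> x)"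
    using ibp(2) by (intro Bochner_Integration.integrable_sum)
  then show "integrable lborel (\<lambda>x. radial_lift (\<lambda>t. real CARD('n) * \<zeta> t + \<zeta>' t) x * \<phi> x)"
    by (simp only: sum_distrib_right[symmetric] s)
  have "(\<Sum>i\<in>UNIV. \<integral>x. (x $ i * radial_lift \<zeta> x) * pd i \<phi> x \<partial>lborel) =
      (\<Sum>i\<in>UNIV. - (\<integral>x. ?f' i x * \<phi> x \<partial>lborel))"
    by (intro sum.cong refl ibp(3))
  also have "\<dots> = - (\<integral>x. (\<Sum>i\<in>UNIV. ?f' i x * \<phi> x) \<partial>lborel)"
    using ibp(2) by (subst Bochner_Integration.integral_sum) (auto simp: sum_negf)
  finally show "(\<Sum>i\<in>UNIV. \<integral>x. (x $ i * radial_lift \<zeta> x) * pd i \<phi> x \<partial>lborel) =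
      - (\<integral>x. radial_lift (\<lambda>t. real CARD('n) * \<zeta> t + \<zeta>' t) x * \<phi> x \<partial>lborel)"
    by (simp only: sum_distrib_right[symmetric] s)
qed

text \<open>The gradient formula is applied with the test function \<open>pd i \<phi>\<close>, and
  the field x times the lift of \<open>exp (- 2 * t) * \<psi>' t\<close> is then handled by the
  divergence formula; the weight costs two powers of |x|, hence the condition on
  \<open>m + 2\<close>.\<close>

lemma radial_weak_lap:
  fixes \<phi> :: "real^'n::finite \<Rightarrow> real"
  assumes d: "\<And>t. (\<psi> has_real_derivative \<psi>' t) (at t)" "\<And>t. (\<psi>' has_real_derivative \<psi>'' t) (at t)"
    and c: "continuous_on UNIV \<psi>''"
    and C: "\<And>t. \<bar>\<psi> t\<bar> \<le> C * exp (- m * t)" "\<And>t. \<bar>\<psi>' t\<bar> \<le> C * exp (- m * t)"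
      "\<And>t. \<bar>\<psi>'' t\<bar> \<le> C * exp (- m * t)"
    and m: "m + 2 < real CARD('n)" and \<phi>: "test_fun UNIV \<phi>"
  shows "integrable lborel (\<lambda>x. radial_lift \<psi> x * lap \<phi> x)"
    and "integrable lborel (\<lambda>x. radial_lift (\<lambda>t. exp (- 2 * t) *
       (\<psi>'' t + (real CARD('n) - 2) * \<psi>' t)) x * \<phi> x)"
    and "(\<integral>x. radial_lift \<psi> x * lap \<phi> x \<partial>lborel) =
      (\<integral>x. radial_lift (\<lambda>t. exp (- 2 * t) * (\<psi>'' t + (real CARD('n) - 2) * \<psi>' t)) x * \<phi> x \<partial>lborel)"
proof -
  have c': "continuous_on UNIV \<psi>'"
    using d by (auto intro!: continuous_at_imp_continuous_on intro: DERIV_isCont)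
  have C0: "C \<ge> 0" using C(1)[of 0] by simp
  let ?z = "\<lambda>t. exp (- 2 * t) * \<psi>' t" and ?z' = "\<lambda>t. exp (- 2 * t) * (\<psi>'' t - 2 * \<psi>' t)"
  have dz: "(?z has_real_derivative ?z' t) (at t)" for t
    using d(2)[of t] by (auto intro!: derivative_eq_intros simp: algebra_simps)
  have e: "exp (- 2 * t) * exp (- m * t) = exp (- (m + 2) * t)" for t
    by (simp add: exp_add[symmetric] algebra_simps)
  \<comment> \<open>The constant 3 C is dictated by \<open>?z'\<close>, where psi'' - 2 psi' is
    bounded by C + 2 C; it is used here too because \<open>radial_weak_div\<close> expects one
    constant for both bounds.\<close>
  have z1: "\<bar>?z t\<bar> \<le> (3 * C) * exp (- (m + 2) * t)" for t
  proof -
    have "\<bar>?z t\<bar> \<le> exp (- 2 * t) * ((3 * C) * exp (- m * t))"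
      unfolding abs_mult abs_exp_cancel
      using order_trans[OF C(2)[of t] mult_right_mono[of C "3 * C" "exp (- m * t)"]] C0
      by (intro mult_left_mono) auto
    then show ?thesis unfolding e[symmetric] by (simp only: mult_ac)
  qed
  have z2: "\<bar>?z' t\<bar> \<le> (3 * C) * exp (- (m + 2) * t)" for t
  proof -
    have "\<bar>?z' t\<bar> \<le> exp (- 2 * t) * ((3 * C) * exp (- m * t))"
      unfolding abs_mult abs_exp_cancel
      using C(2)[of t] C(3)[of t] by (intro mult_left_mono) auto
    then show ?thesis unfolding e[symmetric] by (simp only: mult_ac)
  qed
  have m1: "m + 1 < real CARD('n)" using m by simp
  note g = radial_weak_grad[OF d(1) c' C(1,2) m1 test_fun_pd[OF \<phi>]]
  note dv = radial_weak_div[OF dz _ z1 z2 m \<phi>]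
  have cz: "continuous_on UNIV ?z'" by (intro continuous_intros c c')
  have eq: "(\<lambda>t. real CARD('n) * ?z t + ?z' t) = (\<lambda>t. exp (- 2 * t) * (\<psi>'' t + (real CARD('n) - 2) * \<psi>' t))"
    by (auto simp: algebra_simps)
  have l: "radial_lift \<psi> x * lap \<phi> x = (\<Sum>i\<in>UNIV. radial_lift \<psi> x * pd i (pd i \<phi>) x)" for x
    by (simp add: lap_def sum_distrib_left)
  show "integrable lborel (\<lambda>x. radial_lift \<psi> x * lap \<phi> x)"
    unfolding l by (intro Bochner_Integration.integrable_sum g(1))
  show "integrable lborel (\<lambda>x. radial_lift (\<lambda>t. exp (- 2 * t) *
       (\<psi>'' t + (real CARD('n) - 2) * \<psi>' t)) x * \<phi> x)"
    using dv(2)[OF cz] unfolding eq .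
  have "(\<integral>x. radial_lift \<psi> x * lap \<phi> x \<partial>lborel) = (\<Sum>i\<in>UNIV. \<integral>x. radial_lift \<psi> x * pd i (pd i \<phi>) x \<partial>lborel)"
    unfolding l by (intro Bochner_Integration.integral_sum g(1))
  also have "\<dots> = - (\<Sum>i\<in>UNIV. \<integral>x. (x $ i * radial_lift ?z x) * pd i \<phi> x \<partial>lborel)"
    by (simp only: g(3) sum_negf)
  also have "\<dots> = (\<integral>x. radial_lift (\<lambda>t. exp (- 2 * t) * (\<psi>'' t + (real CARD('n) - 2) * \<psi>' t)) x * \<phi> x \<partial>lborel)"
    using dv(3)[OF cz] unfolding eq by simp
  finally show "(\<integral>x. radial_lift \<psi> x * lap \<phi> x \<partial>lborel) =
      (\<integral>x. radial_lift (\<lambda>t. exp (- 2 * t) * (\<psi>'' t + (real CARD('n) - 2) * \<psi>' t)) x * \<phi> x \<partial>lborel)" .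
qed


section \<open>The explicit solutions\<close>

definition cosh_pow :: "real \<Rightarrow> real \<Rightarrow> real \<Rightarrow> real \<Rightarrow> real" where
  "cosh_pow k \<tau> c t = cosh (k * t + \<tau>) powr (- c)"

lemma cosh_pow_pos: "cosh_pow k \<tau> c t > 0"
  by (simp add: cosh_pow_def less_le)

lemma cosh_pow_tanh2:
  "tanh (k * t + \<tau>) ^ 2 * cosh_pow k \<tau> c t = cosh_pow k \<tau> c t - cosh_pow k \<tau> (c + 2) t"
proof -
  let ?c = "cosh (k * t + \<tau>)"
  have c: "?c > 0" by simp
  have "cosh_pow k \<tau> (c + 2) t = cosh_pow k \<tau> c t * ?c powr (- 2)"
    by (simp add: cosh_pow_def powr_add[symmetric])
  also have "?c powr (- 2) = 1 / ?c\<^sup>2" using c powr_minus[of ?c 2] by (simp add: divide_inverse)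
  finally have e: "cosh_pow k \<tau> (c + 2) t = cosh_pow k \<tau> c t / ?c\<^sup>2" by simp
  have "tanh (k * t + \<tau>) ^ 2 = 1 - 1 / ?c\<^sup>2"
  proof -
    have "(sinh (k * t + \<tau>))\<^sup>2 = ?c\<^sup>2 - 1" using cosh_square_eq[of "k * t + \<tau>"] by simp
    then show ?thesis using c by (simp add: tanh_def power_divide diff_divide_distrib)
  qed
  then show ?thesis by (simp add: e left_diff_distrib)
qed

lemma cosh_pow_deriv:
  "(cosh_pow k \<tau> c has_real_derivative - c * k * (tanh (k * t + \<tau>) * cosh_pow k \<tau> c t)) (at t)"
proof -
  have "cosh (k * t + \<tau>) > 0" by simp
  then show ?thesis unfolding cosh_pow_def[abs_def]
    by (auto intro!: derivative_eq_intros simp: tanh_def powr_diff field_simps less_le)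
qed

text \<open>Replacing tanh^2 by 1 - cosh^(-2) keeps the second derivative of
  \<open>cosh_pow k \<tau> c\<close> in the span of the exponents c and c + 2.\<close>

lemma tanh_cosh_pow_deriv:
  "((\<lambda>t. tanh (k * t + \<tau>) * cosh_pow k \<tau> c t) has_real_derivative
     k * ((c + 1) * cosh_pow k \<tau> (c + 2) t - c * cosh_pow k \<tau> c t)) (at t)"
proof -
  let ?T = "tanh (k * t + \<tau>)"
  have "((\<lambda>t. tanh (k * t + \<tau>)) has_real_derivative (1 - ?T\<^sup>2) * k) (at t)"
    by (auto intro!: derivative_eq_intros)
  from DERIV_mult[OF this cosh_pow_deriv[of k \<tau> c t]]
  have "((\<lambda>t. tanh (k * t + \<tau>) * cosh_pow k \<tau> c t) has_real_derivative
     (1 - ?T\<^sup>2) * k * cosh_pow k \<tau> c t + - c * k * (?T * cosh_pow k \<tau> c t) * ?T) (at t)" .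
  moreover have "(1 - ?T\<^sup>2) * k * cosh_pow k \<tau> c t + - c * k * (?T * cosh_pow k \<tau> c t) * ?T =
     k * (cosh_pow k \<tau> c t - (c + 1) * (?T\<^sup>2 * cosh_pow k \<tau> c t))"
    by (simp add: algebra_simps power2_eq_square)
  moreover have "k * (cosh_pow k \<tau> c t - (c + 1) * (?T\<^sup>2 * cosh_pow k \<tau> c t)) =
     k * ((c + 1) * cosh_pow k \<tau> (c + 2) t - c * cosh_pow k \<tau> c t)"
    unfolding cosh_pow_tanh2 by (simp add: algebra_simps)
  ultimately show ?thesis by simp
qed

lemma cosh_pow_le: "c \<le> d \<Longrightarrow> cosh_pow k \<tau> d t \<le> cosh_pow k \<tau> c t"
  unfolding cosh_pow_def by (intro powr_mono) (auto simp: cosh_real_ge_1)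

lemma cosh_pow_exp_bound:
  assumes "k > 0" "c > 0"
  shows "cosh_pow k \<tau> c t \<le> 2 powr c * exp (c * \<bar>\<tau>\<bar>) * exp (- (c * k) * \<bar>t\<bar>)"
proof -
  have "exp \<bar>k * t + \<tau>\<bar> / 2 \<le> cosh (k * t + \<tau>)"
    by (auto simp: cosh_def abs_if)
  moreover have "k * \<bar>t\<bar> - \<bar>\<tau>\<bar> \<le> \<bar>k * t + \<tau>\<bar>"
    using abs_triangle_ineq4[of "k * t + \<tau>" \<tau>] assms by (simp add: abs_mult)
  ultimately have "exp (k * \<bar>t\<bar> - \<bar>\<tau>\<bar>) / 2 \<le> cosh (k * t + \<tau>)"
    using exp_le_cancel_iff[of "k * \<bar>t\<bar> - \<bar>\<tau>\<bar>" "\<bar>k * t + \<tau>\<bar>"] by linarith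
  then have "cosh_pow k \<tau> c t \<le> (exp (k * \<bar>t\<bar> - \<bar>\<tau>\<bar>) / 2) powr (- c)"
    unfolding cosh_pow_def using assms by (intro powr_mono2') auto
  also have "\<dots> = 2 powr c * exp (c * \<bar>\<tau>\<bar>) * exp (- (c * k) * \<bar>t\<bar>)"
  proof -
    have "(exp (k * \<bar>t\<bar> - \<bar>\<tau>\<bar>) / 2) powr (- c) = 2 powr c * exp ((k * \<bar>t\<bar> - \<bar>\<tau>\<bar>) * (- c))"
    proof -
      have "(exp (k * \<bar>t\<bar> - \<bar>\<tau>\<bar>) / 2) powr (- c) = exp (k * \<bar>t\<bar> - \<bar>\<tau>\<bar>) powr (- c) / 2 powr (- c)"
        by (rule powr_divide)
      then show ?thesis
        by (simp only: exp_powr_real powr_minus[of 2 c] divide_inverse inverse_inverse_eq mult.commute)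
    qed
    also have "exp ((k * \<bar>t\<bar> - \<bar>\<tau>\<bar>) * (- c)) = exp (c * \<bar>\<tau>\<bar>) * exp (- (c * k) * \<bar>t\<bar>)"
      unfolding exp_add[symmetric] by (rule arg_cong[of _ _ exp]) (simp add: algebra_simps)
    finally show ?thesis by simp
  qed
  finally show ?thesis .
qed

lemma integrable_cosh_pow:
  assumes "k > 0" "c > 0"
  shows "integrable lborel (cosh_pow k \<tau> c)"
proof (rule Bochner_Integration.integrable_bound)
  show "integrable lborel (\<lambda>t. 2 powr c * exp (c * \<bar>\<tau>\<bar>) * exp (- (c * k) * \<bar>t\<bar>))"
    using assms by (intro integrable_mult_right integrable_exp_abs) auto
  show "cosh_pow k \<tau> c \<in> borel_measurable lborel"
    unfolding cosh_pow_def[abs_def] by (auto intro!: borel_measurable_continuous_onI continuous_intros)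
  show "AE t in lborel. norm (cosh_pow k \<tau> c t) \<le> norm (2 powr c * exp (c * \<bar>\<tau>\<bar>) * exp (- (c * k) * \<bar>t\<bar>))"
    using cosh_pow_exp_bound[OF assms] cosh_pow_pos by (intro AE_I2) (auto simp: less_imp_le abs_of_pos)
qed

lemma abs_tanh_le: "\<bar>tanh x\<bar> \<le> 1" for x :: real
  using tanh_real_bounds[of x] by auto

text \<open>The factor A with A^(p - 1) = k^4 b (b + 1) (b + 2) (b + 3), where p - 1 = 4 / b; the
  right side is the constant that the differential operator produces on
  \<open>cosh_pow k \<tau> b\<close>.\<close>

definition amplitude :: "real \<Rightarrow> real \<Rightarrow> real" where
  "amplitude b k = (k ^ 4 * (b * (b + 1) * (b + 2) * (b + 3))) powr (b / 4)"

lemma amplitude_pos: "b > 0 \<Longrightarrow> k > 0 \<Longrightarrow> amplitude b k > 0"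
  by (simp add: amplitude_def)

lemma amplitude_powr:
  assumes "b > 0" "k > 0"
  shows "amplitude b k powr ((b + 4) / b) = k ^ 4 * (b * (b + 1) * (b + 2) * (b + 3)) * amplitude b k"
proof -
  let ?X = "k ^ 4 * (b * (b + 1) * (b + 2) * (b + 3))"
  have X: "?X > 0" using assms by simp
  have "amplitude b k powr ((b + 4) / b) = ?X powr (1 + b / 4)"
  proof -
    have "b / 4 * ((b + 4) / b) = 1 + b / 4" using assms by (simp add: field_simps)
    then show ?thesis by (simp only: amplitude_def powr_powr)
  qed
  also have "\<dots> = ?X * amplitude b k"
    using X assms by (simp add: powr_add amplitude_def)
  finally show ?thesis .
qed

definition profile :: "real \<Rightarrow> real \<Rightarrow> real \<Rightarrow> real \<Rightarrow> real" where
  "profile b k \<tau> t = amplitude b k * cosh_pow k \<tau> b t"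

lemma profile_shift: "profile b k (k * s) t = profile b k 0 (t + s)"
  by (simp add: profile_def cosh_pow_def algebra_simps)

text \<open>With s = ln (lam |x|), the factor 1 + exp (2 k s) is exp (k s) times 2 cosh (k s); the
  exponents - mu / 2 = - b (1 - k) and - b k then add up to the Emden-Fowler weight - b. Dilation
  becomes the phase \<open>k * ln lam\<close>.\<close>

lemma U_scaled_eq_radial_lift:
  fixes \<mu> :: real
  assumes N: "CARD('n::finite) \<ge> 5" and "0 < \<mu>" "\<mu> < real CARD('n) - 4" and lam: "lam > 0"
    and b: "b = (real CARD('n) - 4) / 2" and k: "k = 1 - \<mu> / (real CARD('n) - 4)"
  shows "(U_scaled \<mu> lam :: real^'n \<Rightarrow> real) =
    radial_lift (\<lambda>t. exp (- b * t) * profile b k (k * ln lam) t)"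
proof
  fix x :: "real^'n"
  show "U_scaled \<mu> lam x = radial_lift (\<lambda>t. exp (- b * t) * profile b k (k * ln lam) t) x"
  proof (cases "x = 0")
    case True
    then show ?thesis by (simp add: U_scaled_def U_mu_def radial_lift_def)
  next
    case False
    define r where "r = norm x"
    define s where "s = ln r + ln lam"
    have r: "r > 0" using False by (simp add: r_def)
    have b0: "b > 0" using N b by simp
    have k0: "k > 0" using assms by (simp add: k)
    have lr: "norm (lam *\<^sub>R x) = exp s" using lam r by (simp add: s_def exp_add r_def)
    have N': "real CARD('n) = 2 * b + 4" using b by (simp add: field_simps)
    have mu: "\<mu> / 2 = b * (1 - k)" using b0 by (simp add: k N')
    \<comment> \<open>With N = 2 b + 4 the product (N - 4) (N - 2) N (N + 2) is 16 b (b + 1) (b + 2)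
      (b + 3), and \<open>16 powr (b / 4) = 2 powr b\<close> cancels the power of 2 in front of the
      hyperbolic cosine.\<close>
    have K: "K_const CARD('n) \<mu> = 2 powr b * amplitude b k"
    proof -
      have "K_const CARD('n) \<mu> = (16 * (k ^ 4 * (b * (b + 1) * (b + 2) * (b + 3)))) powr (b / 4)"
        unfolding K_const_def k[symmetric] unfolding N' by (simp add: algebra_simps)
      also have "\<dots> = 16 powr (b / 4) * amplitude b k"
        using b0 k0 by (simp add: powr_mult amplitude_def)
      also have "16 powr (b / 4) = (2 powr 4) powr (b / 4)" by simp
      also have "\<dots> = 2 powr b" by (subst powr_powr) simp
      finally show ?thesis .
    qed
    have ch: "1 + exp s powr (2 * k) = exp (k * s) * (2 * cosh (k * s))"
      by (simp add: cosh_def exp_powr_real exp_add[symmetric] algebra_simps)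
    have "U_mu \<mu> (lam *\<^sub>R x) = K_const CARD('n) \<mu> * exp s powr (- \<mu> / 2) * (1 + exp s powr (2 * k)) powr (- b)"
    proof -
      have "- (real CARD('n) - 4) / 2 = - b" by (simp add: N')
      then show ?thesis by (simp only: U_mu_def Let_def lr k[symmetric])
    qed
    also have "\<dots> = (2 powr b * amplitude b k) * exp (- (b * (1 - k)) * s)
        * (exp (- b * (k * s)) * (2 powr (- b) * cosh (k * s) powr (- b)))"
    proof -
      have "exp s powr (- \<mu> / 2) = exp (- (b * (1 - k)) * s)"
      proof -
        have "- \<mu> / 2 = - (b * (1 - k))" using mu by simp
        then show ?thesis by (simp only: exp_powr_real mult.commute)
      qed
      moreover have "(exp (k * s) * (2 * cosh (k * s))) powr (- b) =
          exp (- b * (k * s)) * (2 powr (- b) * cosh (k * s) powr (- b))"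
      proof -
        have "(exp (k * s) * (2 * cosh (k * s))) powr (- b) = exp (k * s) powr (- b) * (2 powr (- b) * cosh (k * s) powr (- b))"
          by (simp only: powr_mult)
        then show ?thesis by (simp only: exp_powr_real mult.commute)
      qed
      ultimately show ?thesis unfolding ch K by simp
    qed
    also have "\<dots> = (2 powr b * 2 powr (- b)) * (exp (- (b * (1 - k)) * s) * exp (- b * (k * s)))
        * (amplitude b k * cosh (k * s) powr (- b))"
      by (simp add: mult_ac)
    also have "exp (- (b * (1 - k)) * s) * exp (- b * (k * s)) = exp (- b * s)"
      by (simp add: exp_add[symmetric] algebra_simps)
    also have "2 powr b * 2 powr (- b) = (1::real)" by (simp add: powr_minus)
    also have "amplitude b k * cosh (k * s) powr (- b) = profile b k (k * ln lam) (ln r)"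
      by (simp add: profile_def cosh_pow_def s_def algebra_simps)
    finally have U: "U_mu \<mu> (lam *\<^sub>R x) = exp (- b * s) * profile b k (k * ln lam) (ln r)" by simp
    have "lam powr b * exp (- b * s) = exp (- b * ln r)"
      using lam by (simp add: powr_def s_def exp_add[symmetric] algebra_simps)
    then show ?thesis using False U
      by (simp add: U_scaled_def b[symmetric] radial_lift_def r_def[symmetric])
  qed
qed


section \<open>Exponential bounds, the constants of the equation and Emden-Fowler
  coordinates\<close>

definition dominated :: "(real \<Rightarrow> real) \<Rightarrow> (real \<Rightarrow> real) \<Rightarrow> bool" where
  "dominated y f \<longleftrightarrow> (\<exists>C. \<forall>t. \<bar>f t\<bar> \<le> C * y t)"

lemma dominated_add: "dominated y f \<Longrightarrow> dominated y g \<Longrightarrow> dominated y (\<lambda>t. f t + g t)"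
  unfolding dominated_def
proof (elim exE)
  fix C D assume "\<forall>t. \<bar>f t\<bar> \<le> C * y t" "\<forall>t. \<bar>g t\<bar> \<le> D * y t"
  then have "\<bar>f t + g t\<bar> \<le> (C + D) * y t" for t
    using abs_triangle_ineq[of "f t" "g t"] by (simp add: distrib_right) (meson add_mono order_trans)
  then show "\<exists>C. \<forall>t. \<bar>f t + g t\<bar> \<le> C * y t" by blast
qed

lemma dominated_cmult: "dominated y f \<Longrightarrow> dominated y (\<lambda>t. c * f t)"
  unfolding dominated_def
proof (elim exE)
  fix C assume "\<forall>t. \<bar>f t\<bar> \<le> C * y t"
  then have "\<bar>c * f t\<bar> \<le> \<bar>c\<bar> * (C * y t)" for t by (simp add: abs_mult mult_left_mono)
  then show "\<exists>C. \<forall>t. \<bar>c * f t\<bar> \<le> C * y t" by (intro exI[of _ "\<bar>c\<bar> * C"]) (simp add: mult.assoc)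
qed

lemma dominated_diff: "dominated y f \<Longrightarrow> dominated y g \<Longrightarrow> dominated y (\<lambda>t. f t - g t)"
  using dominated_add[of y f "\<lambda>t. (- 1) * g t"] dominated_cmult[of y g "- 1"] by simp

lemmas dominated_intros = dominated_add dominated_cmult dominated_diff

lemma dominated_exp_mult:
  assumes "dominated y f" "\<And>t. y t \<le> 1" "\<And>t. 0 \<le> y t"
  shows "dominated (\<lambda>t. exp (- m * t)) (\<lambda>t. exp (- m * t) * f t)"
proof -
  obtain C where C: "\<And>t. \<bar>f t\<bar> \<le> C * y t" using assms(1) by (auto simp: dominated_def)
  have "\<bar>exp (- m * t) * f t\<bar> \<le> \<bar>C\<bar> * exp (- m * t)" for t
  proof -
    have "\<bar>f t\<bar> \<le> \<bar>C\<bar> * y t"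
      by (rule order_trans[OF C mult_right_mono]) (use assms in auto)
    also have "\<dots> \<le> \<bar>C\<bar> * 1" using assms(2) by (intro mult_left_mono) auto
    finally show ?thesis by (simp add: abs_mult)
  qed
  then show ?thesis unfolding dominated_def by blast
qed

lemma dominated_common:
  assumes "dominated y f" "dominated y g" "dominated y h" "\<And>t. 0 \<le> y t"
  obtains C where "\<And>t. \<bar>f t\<bar> \<le> C * y t" "\<And>t. \<bar>g t\<bar> \<le> C * y t" "\<And>t. \<bar>h t\<bar> \<le> C * y t"
proof -
  obtain A B C where *: "\<And>t. \<bar>f t\<bar> \<le> A * y t" "\<And>t. \<bar>g t\<bar> \<le> B * y t" "\<And>t. \<bar>h t\<bar> \<le> C * y t"
    using assms(1-3) unfolding dominated_def by blast
  let ?M = "max A (max B C)"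
  have "A * y t \<le> ?M * y t" "B * y t \<le> ?M * y t" "C * y t \<le> ?M * y t" for t
    using assms(4)[of t] by (auto intro: mult_right_mono)
  then show ?thesis using * that[of ?M] by (meson order_trans)
qed

lemma test_fun_annular:
  fixes \<phi> :: "real^'n::finite \<Rightarrow> real"
  assumes "test_fun (- {0}) \<phi>"
  shows "annular \<phi>"
proof -
  have "0 \<in> - tsupport \<phi>" "open (- tsupport \<phi>)" using assms by (auto simp: test_fun_def tsupport_def)
  then obtain r where r: "r > 0" "ball 0 r \<subseteq> - tsupport \<phi>"
    unfolding open_contains_ball by blast
  obtain R where "\<forall>x. R < norm x \<longrightarrow> \<phi> x = 0"
    using test_fun_facts(4)[OF test_fun_mono[OF assms]] by auto
  moreover have "\<phi> x = 0" if "norm x < r" for x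
    using r(2) mem_tsupport[of \<phi> x] that by (auto simp: subset_iff)
  ultimately show ?thesis using r(1) unfolding annular_def by blast
qed

lemma integrable_radial_lift_test:
  fixes \<phi> :: "real^'n::finite \<Rightarrow> real"
  assumes "continuous_on UNIV \<psi>" "test_fun (- {0}) \<phi>"
  shows "integrable lborel (\<lambda>x. radial_lift \<psi> x * \<phi> x)"
proof -
  obtain r R where r: "0 < r" "\<And>x. norm x < r \<Longrightarrow> \<phi> x = 0" and R: "\<And>x. R < norm x \<Longrightarrow> \<phi> x = 0"
    using test_fun_annular[OF assms(2)] unfolding annular_def by blast
  have "continuous_on UNIV (\<lambda>x. radial_lift \<psi> x * \<phi> x)"
    using test_fun_facts(2)[OF test_fun_mono[OF assms(2)]]
    by (intro continuous_on_mult_vanishing_near_0[OF continuous_on_radial_lift_punctured[OF assms(1)] _ r]) auto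
  then show ?thesis by (rule integrable_continuous_compact_support[of _ R]) (simp add: R)
qed

text \<open>Since mu = 2 b (1 - k), the expression \<open>\<mu> * (2 * (real N - 4) - \<mu>)\<close>
  is 4 b^2 (1 - k^2), and N^2 - 4 N + 8 is 2 ((b + 2)^2 + b^2). In this form the constant turns the
  coefficient of D^2 into k^2 times its value for mu = 0.\<close>

lemma C1_eq:
  assumes "N \<ge> 5" "b = (real N - 4) / 2" "k = 1 - \<mu> / (real N - 4)"
  shows "C1 N \<mu> = (1 - k\<^sup>2) * ((b + 2)\<^sup>2 + b\<^sup>2)"
proof -
  have N: "real N = 2 * b + 4" using assms(2) by (simp add: field_simps)
  have b: "b > 0" using assms(1,2) by simp
  have mu: "\<mu> = 2 * b * (1 - k)" using b assms(3) by (simp add: N)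
  have "(real N ^ 2 - 4 * real N + 8) / (2 * (real N - 4)\<^sup>2) = ((b + 2)\<^sup>2 + b\<^sup>2) / (4 * b\<^sup>2)"
    unfolding N using b by (simp add: field_simps power2_eq_square)
  moreover have "\<mu> * (2 * (real N - 4) - \<mu>) = (1 - k\<^sup>2) * (4 * b\<^sup>2)"
    unfolding N mu by (simp add: algebra_simps power2_eq_square)
  ultimately show ?thesis unfolding C1_def mult.assoc using b by simp
qed

text \<open>The last term completes a square: the gradient term contributes - b^2 \<open>C1\<close>,
  and (b + 2)^2 + b^2 + 4 b + 4 = 2 (b + 2)^2, so both together give - 2 (1 - k^2) b^2 (b + 2)^2 and
  the constant coefficient of the operator becomes k^4 b^2 (b + 2)^2.\<close>

lemma C2_eq:
  assumes "N \<ge> 5" "b = (real N - 4) / 2" "k = 1 - \<mu> / (real N - 4)"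
  shows "C2 N \<mu> = (1 - k\<^sup>2)\<^sup>2 * ((b + 2)\<^sup>2 * b\<^sup>2) - (1 - k\<^sup>2) * (b\<^sup>2 * (4 * b + 4))"
proof -
  have N: "real N = 2 * b + 4" using assms(2) by (simp add: field_simps)
  have b: "b > 0" using assms(1,2) by simp
  have mu: "\<mu> = 2 * b * (1 - k)" using b assms(3) by (simp add: N)
  have m: "\<mu> * (2 * (real N - 4) - \<mu>) = (1 - k\<^sup>2) * (4 * b\<^sup>2)"
    unfolding N mu by (simp add: algebra_simps power2_eq_square)
  have "C2 N \<mu> = real N ^ 2 / (16 * (real N - 4)\<^sup>2) * (\<mu> * (2 * (real N - 4) - \<mu>))\<^sup>2
      - (real N - 2) / 2 * (\<mu> * (2 * (real N - 4) - \<mu>))"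
    by (simp add: C2_def power_mult_distrib)
  also have "\<dots> = (1 - k\<^sup>2)\<^sup>2 * ((b + 2)\<^sup>2 * b\<^sup>2) - (1 - k\<^sup>2) * (b\<^sup>2 * (4 * b + 4))"
  proof -
    have "real N ^ 2 / (16 * (real N - 4)\<^sup>2) = (b + 2)\<^sup>2 / (16 * b\<^sup>2)"
      unfolding N using b by (simp add: field_simps power2_eq_square)
    moreover have "(b + 2)\<^sup>2 / (16 * b\<^sup>2) * ((1 - k\<^sup>2) * (4 * b\<^sup>2))\<^sup>2 = (1 - k\<^sup>2)\<^sup>2 * ((b + 2)\<^sup>2 * b\<^sup>2)"
    proof -
      have "((1 - k\<^sup>2) * (4 * b\<^sup>2))\<^sup>2 = (16 * b\<^sup>2) * ((1 - k\<^sup>2)\<^sup>2 * b\<^sup>2)"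
        by (simp add: power2_eq_square)
      then show ?thesis using b by simp
    qed
    moreover have "(real N - 2) / 2 * ((1 - k\<^sup>2) * (4 * b\<^sup>2)) = (1 - k\<^sup>2) * (b\<^sup>2 * (4 * b + 4))"
      unfolding N by (simp add: field_simps)
    ultimately show ?thesis unfolding m by simp
  qed
  finally show ?thesis .
qed

text \<open>Here \<open>v\<^sub>i = (D - b)\<^sup>i w\<close>, so \<open>exp (- b t) v\<^sub>i\<close> is the \<open>i\<close>-th derivative of
  \<open>exp (- b t) w\<close>, and \<open>H\<close> is the Laplacian of the radial function \<open>exp (- b t) w\<close> of \<open>t = ln |x|\<close>
  in dimension \<open>2 b + 4\<close>.\<close>

lemma emden_fowler_chain:
  fixes w0 w1 w2 w3 w4 v1 v2 v3 v4 :: "real \<Rightarrow> real" and b :: real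
  assumes dw0: "\<And>t. (w0 has_real_derivative w1 t) (at t)" and dw1: "\<And>t. (w1 has_real_derivative w2 t) (at t)"
    and dw2: "\<And>t. (w2 has_real_derivative w3 t) (at t)" and dw3: "\<And>t. (w3 has_real_derivative w4 t) (at t)"
    and v1_def: "v1 = (\<lambda>t. w1 t - b * w0 t)"
    and v2_def: "v2 = (\<lambda>t. w2 t - 2 * b * w1 t + b ^ 2 * w0 t)"
    and v3_def: "v3 = (\<lambda>t. w3 t - 3 * b * w2 t + 3 * b ^ 2 * w1 t - b ^ 3 * w0 t)"
    and v4_def: "v4 = (\<lambda>t. w4 t - 4 * b * w3 t + 6 * b ^ 2 * w2 t - 4 * b ^ 3 * w1 t + b ^ 4 * w0 t)"
  defines "H \<equiv> \<lambda>t. exp (- (b + 2) * t) * (v2 t + (2 * b + 2) * v1 t)"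
    and "H1 \<equiv> \<lambda>t. exp (- (b + 2) * t) * ((v3 t - 2 * v2 t) + (2 * b + 2) * (v2 t - 2 * v1 t))"
    and "H2 \<equiv> \<lambda>t. exp (- (b + 2) * t) * ((v4 t - 4 * v3 t + 4 * v2 t) + (2 * b + 2) * (v3 t - 4 * v2 t + 4 * v1 t))"
    and "z \<equiv> \<lambda>t. exp (- (b + 4) * t) * v1 t"
    and "z' \<equiv> \<lambda>t. exp (- (b + 4) * t) * (v2 t - 4 * v1 t)"
  shows "((\<lambda>t. exp (- b * t) * w0 t) has_real_derivative exp (- b * t) * v1 t) (at t)"
    and "((\<lambda>t. exp (- b * t) * v1 t) has_real_derivative exp (- b * t) * v2 t) (at t)"
    and "(H has_real_derivative H1 t) (at t)" and "(H1 has_real_derivative H2 t) (at t)"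
    and "(z has_real_derivative z' t) (at t)"
    and "exp (- 2 * t) * (H2 t + (2 * b + 2) * H1 t) =
      exp (- (b + 4) * t) * (w4 t - ((b + 2)\<^sup>2 + b\<^sup>2) * w2 t + (b + 2)\<^sup>2 * b\<^sup>2 * w0 t)"
    and "(2 * b + 4) * z t + z' t = exp (- (b + 4) * t) * (w2 t - b\<^sup>2 * w0 t)"
proof -
  let ?n = "2 * b + 2"
  \<comment> \<open>The weight \<open>c\<close> is left general because \<open>b\<close>,
    \<open>b + 2\<close> and \<open>b + 4\<close> all occur, each Laplacian or division by |x|^2
    adding 2.\<close>
  have dd0: "((\<lambda>t. exp (- c * t) * w0 t) has_real_derivative exp (- c * t) * (v1 t + (b - c) * w0 t)) (at t)" for c t
    using dw0[of t] by (auto intro!: derivative_eq_intros simp: v1_def algebra_simps)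
  have dd1: "((\<lambda>t. exp (- c * t) * v1 t) has_real_derivative exp (- c * t) * (v2 t + (b - c) * v1 t)) (at t)" for c t
    unfolding v1_def v2_def using dw0[of t] dw1[of t]
    by (auto intro!: derivative_eq_intros simp: algebra_simps power2_eq_square)
  have dd2: "((\<lambda>t. exp (- c * t) * v2 t) has_real_derivative exp (- c * t) * (v3 t + (b - c) * v2 t)) (at t)" for c t
    unfolding v2_def v3_def using dw0[of t] dw1[of t] dw2[of t]
    by (auto intro!: derivative_eq_intros simp: algebra_simps power2_eq_square power3_eq_cube)
  have dd3: "((\<lambda>t. exp (- c * t) * v3 t) has_real_derivative exp (- c * t) * (v4 t + (b - c) * v3 t)) (at t)" for c t
    unfolding v3_def v4_def using dw0[of t] dw1[of t] dw2[of t] dw3[of t]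
    by (auto intro!: derivative_eq_intros simp: algebra_simps power2_eq_square power3_eq_cube power4_eq_xxxx)
  show "((\<lambda>t. exp (- b * t) * w0 t) has_real_derivative exp (- b * t) * v1 t) (at t)"
    using dd0[of b t] by simp
  show "((\<lambda>t. exp (- b * t) * v1 t) has_real_derivative exp (- b * t) * v2 t) (at t)"
    using dd1[of b t] by simp
  show "(H has_real_derivative H1 t) (at t)"
    unfolding H_def H1_def
    using DERIV_add[OF dd2[of "b + 2" t] DERIV_cmult[OF dd1[of "b + 2" t], of ?n]]
    by (simp add: algebra_simps)
  show "(H1 has_real_derivative H2 t) (at t)"
    unfolding H1_def H2_def
    using DERIV_add[OF DERIV_diff[OF dd3[of "b + 2" t] DERIV_cmult[OF dd2[of "b + 2" t], of 2]]
        DERIV_cmult[OF DERIV_diff[OF dd2[of "b + 2" t] DERIV_cmult[OF dd1[of "b + 2" t], of 2]], of ?n]]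
    by (simp add: algebra_simps)
  show "(z has_real_derivative z' t) (at t)"
    unfolding z_def z'_def using dd1[of "b + 4" t] by simp
  have e: "exp (- (b + 4) * t) = exp (- 2 * t) * exp (- (b + 2) * t)"
    unfolding exp_add[symmetric] by (simp add: algebra_simps)
  \<comment> \<open>As operators on w the two successive Laplacians are (D - b) (D + b + 2) and (D -
    b - 2) (D + b), so their product is (D^2 - b^2) (D^2 - (b + 2)^2).\<close>
  have "((v4 t - 4 * v3 t + 4 * v2 t) + ?n * (v3 t - 4 * v2 t + 4 * v1 t)
       + ?n * ((v3 t - 2 * v2 t) + ?n * (v2 t - 2 * v1 t))) =
       w4 t - ((b + 2)\<^sup>2 + b\<^sup>2) * w2 t + (b + 2)\<^sup>2 * b\<^sup>2 * w0 t"
    unfolding v1_def v2_def v3_def v4_def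
    by (simp add: algebra_simps power2_eq_square power3_eq_cube power4_eq_xxxx)
  moreover have "H2 t + ?n * H1 t = exp (- (b + 2) * t) *
      ((v4 t - 4 * v3 t + 4 * v2 t) + ?n * (v3 t - 4 * v2 t + 4 * v1 t)
       + ?n * ((v3 t - 2 * v2 t) + ?n * (v2 t - 2 * v1 t)))"
    unfolding H1_def H2_def by (simp only: distrib_left mult.left_commute)
  ultimately show "exp (- 2 * t) * (H2 t + ?n * H1 t) =
      exp (- (b + 4) * t) * (w4 t - ((b + 2)\<^sup>2 + b\<^sup>2) * w2 t + (b + 2)\<^sup>2 * b\<^sup>2 * w0 t)"
    unfolding e by (simp only: mult.assoc)
  have "(2 * b + 4) * v1 t + (v2 t - 4 * v1 t) = w2 t - b\<^sup>2 * w0 t"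
    unfolding v1_def v2_def by (simp add: algebra_simps power2_eq_square)
  then show "(2 * b + 4) * z t + z' t = exp (- (b + 4) * t) * (w2 t - b\<^sup>2 * w0 t)"
    unfolding z_def z'_def by (metis distrib_left mult.left_commute)
qed


lemma exp_cancel: "exp (a * t) * (exp (- a * t) * y) = y" for a t y :: real
  by (simp add: exp_add[symmetric] flip: mult.assoc)

lemma continuous_on_of_DERIV:
  "(\<And>t. (f has_real_derivative f' t) (at t)) \<Longrightarrow> continuous_on UNIV f"
  by (meson DERIV_isCont continuous_at_imp_continuous_on)

lemma cosh_pow_le_1: "c \<ge> 0 \<Longrightarrow> cosh_pow k \<tau> c t \<le> 1"
  using cosh_pow_le[of 0 c k \<tau> t] by (simp add: cosh_pow_def)

lemma dominated_cosh_pow: "b \<le> c \<Longrightarrow> dominated (cosh_pow k \<tau> b) (cosh_pow k \<tau> c)"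
  unfolding dominated_def using cosh_pow_le cosh_pow_pos
  by (intro exI[of _ 1]) (auto simp: abs_of_pos)

lemma dominated_tanh_cosh_pow:
  assumes "b \<le> c"
  shows "dominated (cosh_pow k \<tau> b) (\<lambda>t. tanh (k * t + \<tau>) * cosh_pow k \<tau> c t)"
proof -
  have "\<bar>tanh (k * t + \<tau>) * cosh_pow k \<tau> c t\<bar> \<le> 1 * cosh_pow k \<tau> b t" for t
    unfolding abs_mult using cosh_pow_le[OF assms, of k \<tau> t] cosh_pow_pos[of k \<tau> c t]
    by (intro mult_mono abs_tanh_le) auto
  then show ?thesis unfolding dominated_def by blast
qed

text \<open>The weight \<open>exp (- real CARD('n) * t)\<close> cancels the Jacobian of polar
  coordinates, and \<open>cosh_pow\<close>, being at most 1, bounds its own square. The three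
  quadratic integrals of the energy space all have this form.\<close>

lemma integrable_radial_lift_square:
  assumes f: "dominated (cosh_pow k \<tau> b) f" "continuous_on UNIV f" and "k > 0" "b > 0"
  shows "integrable lborel (radial_lift (\<lambda>t. exp (- real CARD('n) * t) * (f t)\<^sup>2) :: real^'n::finite \<Rightarrow> real)"
proof -
  have [measurable]: "f \<in> borel_measurable borel" using f(2) by (rule borel_measurable_continuous_onI)
  obtain C where C: "\<And>t. \<bar>f t\<bar> \<le> C * cosh_pow k \<tau> b t" using f(1) by (auto simp: dominated_def)
  have "integrable lborel (\<lambda>t. (f t)\<^sup>2)"
  proof (rule Bochner_Integration.integrable_bound)
    show "integrable lborel (\<lambda>t. C\<^sup>2 * cosh_pow k \<tau> b t)"
      using assms by (intro integrable_mult_right integrable_cosh_pow)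
    show "AE t in lborel. norm ((f t)\<^sup>2) \<le> norm (C\<^sup>2 * cosh_pow k \<tau> b t)"
    proof (rule AE_I2)
      fix t
      have q: "0 < cosh_pow k \<tau> b t" "cosh_pow k \<tau> b t \<le> 1"
        using cosh_pow_pos cosh_pow_le_1 assms by auto
      have "(f t)\<^sup>2 \<le> (C * cosh_pow k \<tau> b t)\<^sup>2"
        using C[of t] by (metis abs_ge_zero power2_abs power_mono)
      also have "\<dots> = C\<^sup>2 * (cosh_pow k \<tau> b t * cosh_pow k \<tau> b t)" by (simp add: power2_eq_square)
      also have "\<dots> \<le> C\<^sup>2 * (cosh_pow k \<tau> b t * 1)"
        using q by (intro mult_left_mono) auto
      finally show "norm ((f t)\<^sup>2) \<le> norm (C\<^sup>2 * cosh_pow k \<tau> b t)" using q by simp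
    qed
  qed measurable
  then show ?thesis by (subst integrable_radial_lift_iff) (measurable, simp only: exp_cancel)
qed

text \<open>With \<open>N = 2 b + 4\<close> the substitution \<open>u = |x| powr - b * w (ln |x|)\<close> turns the operator into
  \<open>(D\<^sup>2 - k\<^sup>2 (b + 2)\<^sup>2) (D\<^sup>2 - k\<^sup>2 b\<^sup>2)\<close> acting on \<open>w\<close>; each factor sends
  \<open>cosh (k t) powr - c\<close> with the matching \<open>c\<close> to a multiple of \<open>cosh (k t) powr - (c + 2)\<close>.\<close>

lemma weak_solution_profile:
  fixes \<mu> :: real
  assumes N5: "CARD('n::finite) \<ge> 5" and mu: "0 < \<mu>" "\<mu> < real CARD('n) - 4"
    and b: "b = (real CARD('n) - 4) / 2" and k: "k = 1 - \<mu> / (real CARD('n) - 4)"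
  shows "weak_solution \<mu> (radial_lift (\<lambda>t. exp (- b * t) * profile b k \<tau> t) :: real^'n \<Rightarrow> real)"
proof -
  have N: "real CARD('n) = 2 * b + 4" using b by (simp add: field_simps)
  have b0: "b > 0" using N5 b by simp
  have k0: "k > 0" using mu by (simp add: k)
  define A where "A = amplitude b k"
  define q where "q c = cosh_pow k \<tau> c" for c
  define T where "T c t = tanh (k * t + \<tau>) * q c t" for c t
  have dq: "(q c has_real_derivative - c * k * T c t) (at t)" for c t
    unfolding q_def T_def by (rule cosh_pow_deriv)
  have dT: "(T c has_real_derivative k * ((c + 1) * q (c + 2) t - c * q c t)) (at t)" for c t
    unfolding T_def[abs_def] q_def by (rule tanh_cosh_pow_deriv)
  have cq: "continuous_on UNIV (q c)" "continuous_on UNIV (T c)" for c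
    by (rule continuous_on_of_DERIV[OF dq], rule continuous_on_of_DERIV[OF dT])
  have qpos: "q c t > 0" for c t unfolding q_def by (rule cosh_pow_pos)
  have q1: "q b t \<le> 1" for t using b0 by (simp add: q_def cosh_pow_le_1)
  have domq: "dominated (q b) (q c)" "dominated (q b) (T c)" if "b \<le> c" for c
    using that unfolding q_def T_def[abs_def]
    by (auto intro: dominated_cosh_pow dominated_tanh_cosh_pow)
  define w0 where "w0 = (\<lambda>t. A * q b t)"
  define w1 where "w1 = (\<lambda>t. A * (- b * k) * T b t)"
  define w2 where "w2 = (\<lambda>t. A * (- b * k * k) * ((b + 1) * q (b + 2) t - b * q b t))"
  define w3 where "w3 = (\<lambda>t. A * (- b * k * k) * ((b + 1) * (- (b + 2) * k * T (b + 2) t) - b * (- b * k * T b t)))"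
  define w4 where "w4 = (\<lambda>t. A * (- b * k * k) * ((b + 1) * (- (b + 2) * k * (k * ((b + 3) * q (b + 4) t - (b + 2) * q (b + 2) t)))
      - b * (- b * k * (k * ((b + 1) * q (b + 2) t - b * q b t)))))"
  have dw0: "(w0 has_real_derivative w1 t) (at t)" for t
    unfolding w0_def w1_def using DERIV_cmult[OF dq[of b t], of A] by (simp add: mult_ac)
  have dw1: "(w1 has_real_derivative w2 t) (at t)" for t
    unfolding w1_def w2_def using DERIV_cmult[OF dT[of b t], of "A * (- b * k)"] by (simp add: mult_ac)
  have dw2: "(w2 has_real_derivative w3 t) (at t)" for t
    unfolding w2_def w3_def
    by (intro DERIV_cmult DERIV_diff dq)
  have dw3: "(w3 has_real_derivative w4 t) (at t)" for t
    unfolding w3_def w4_def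
    using dT[of "b + 2" t] dT[of b t]
    by (intro DERIV_cmult DERIV_diff) (simp_all add: add.commute add.left_commute)
  have dom: "dominated (q b) w0" "dominated (q b) w1" "dominated (q b) w2" "dominated (q b) w3" "dominated (q b) w4"
    unfolding w0_def w1_def w2_def w3_def w4_def
    by (intro dominated_intros domq; simp)+
  have cw4: "continuous_on UNIV w4" unfolding w4_def by (intro continuous_intros cq)
  have cw: "continuous_on UNIV w0" "continuous_on UNIV w1" "continuous_on UNIV w2" "continuous_on UNIV w3"
    by (rule continuous_on_of_DERIV[OF dw0], rule continuous_on_of_DERIV[OF dw1],
        rule continuous_on_of_DERIV[OF dw2], rule continuous_on_of_DERIV[OF dw3])
  define v1 where "v1 = (\<lambda>t. w1 t - b * w0 t)"
  define v2 where "v2 = (\<lambda>t. w2 t - 2 * b * w1 t + b ^ 2 * w0 t)"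
  define v3 where "v3 = (\<lambda>t. w3 t - 3 * b * w2 t + 3 * b ^ 2 * w1 t - b ^ 3 * w0 t)"
  define v4 where "v4 = (\<lambda>t. w4 t - 4 * b * w3 t + 6 * b ^ 2 * w2 t - 4 * b ^ 3 * w1 t + b ^ 4 * w0 t)"
  have dv: "dominated (q b) v1" "dominated (q b) v2" "dominated (q b) v3" "dominated (q b) v4"
    unfolding v1_def v2_def v3_def v4_def by (intro dominated_intros dom)+
  have cv: "continuous_on UNIV v1" "continuous_on UNIV v2" "continuous_on UNIV v3" "continuous_on UNIV v4"
    unfolding v1_def v2_def v3_def v4_def by (intro continuous_intros cw cw4)+
  note ef = emden_fowler_chain[OF dw0 dw1 dw2 dw3 v1_def v2_def v3_def v4_def]
  have domexp: "dominated (\<lambda>t. exp (- m * t)) (\<lambda>t. exp (- m * t) * f t)" if "dominated (q b) f" for m f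
    using dominated_exp_mult[OF that] q1 qpos by (simp add: less_imp_le)
  let ?n = "2 * b + 2"
  let ?pp = "\<lambda>t. exp (- b * t) * w0 t"
  let ?p1 = "\<lambda>t. exp (- b * t) * v1 t"
  let ?p2 = "\<lambda>t. exp (- b * t) * v2 t"
  let ?H = "\<lambda>t. exp (- (b + 2) * t) * (v2 t + ?n * v1 t)"
  let ?H1 = "\<lambda>t. exp (- (b + 2) * t) * ((v3 t - 2 * v2 t) + ?n * (v2 t - 2 * v1 t))"
  let ?H2 = "\<lambda>t. exp (- (b + 2) * t) * ((v4 t - 4 * v3 t + 4 * v2 t) + ?n * (v3 t - 4 * v2 t + 4 * v1 t))"
  let ?z = "\<lambda>t. exp (- (b + 4) * t) * v1 t"
  let ?z' = "\<lambda>t. exp (- (b + 4) * t) * (v2 t - 4 * v1 t)"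
  note dp0 = ef(1) and dp1 = ef(2) and dH = ef(3) and dH1 = ef(4) and dz = ef(5)
  have ee: "exp (- 2 * t) * (exp (- c * t) * f) = exp (- (c + 2) * t) * f" for c t f :: real
    by (simp add: exp_add[symmetric] algebra_simps flip: mult.assoc)
  let ?u = "radial_lift ?pp :: real^'n \<Rightarrow> real"
  let ?h = "radial_lift ?H :: real^'n \<Rightarrow> real"
  let ?gr = "radial_lift (\<lambda>t. exp (- (b + 2) * t) * v1 t) :: real^'n \<Rightarrow> real"
  \<comment> \<open>The gradient of a radial lift is x times the lift of
    \<open>exp (- 2 * t)\<close> times the derivative, which gives this witness for the weak
    gradient; \<open>?h\<close> is the radial Laplacian.\<close>
  let ?g = "\<lambda>x::real^'n. ?gr x *\<^sub>R x"
  obtain C0 where C0: "\<And>t. \<bar>?pp t\<bar> \<le> C0 * exp (- b * t)" "\<And>t. \<bar>?p1 t\<bar> \<le> C0 * exp (- b * t)"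
      "\<And>t. \<bar>?p2 t\<bar> \<le> C0 * exp (- b * t)"
    by (rule dominated_common[OF domexp[OF dom(1)] domexp[OF dv(1)] domexp[OF dv(2)]]) auto
  obtain CH where CH: "\<And>t. \<bar>?H t\<bar> \<le> CH * exp (- (b + 2) * t)" "\<And>t. \<bar>?H1 t\<bar> \<le> CH * exp (- (b + 2) * t)"
      "\<And>t. \<bar>?H2 t\<bar> \<le> CH * exp (- (b + 2) * t)"
    by (rule dominated_common[OF domexp[of "\<lambda>t. v2 t + ?n * v1 t" "b + 2"]
          domexp[of "\<lambda>t. (v3 t - 2 * v2 t) + ?n * (v2 t - 2 * v1 t)" "b + 2"]
          domexp[of "\<lambda>t. (v4 t - 4 * v3 t + 4 * v2 t) + ?n * (v3 t - 4 * v2 t + 4 * v1 t)" "b + 2"]])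
      (use dv in \<open>auto intro!: dominated_intros\<close>)
  obtain Cz where Cz: "\<And>t. \<bar>?z t\<bar> \<le> Cz * exp (- (b + 4) * t)" "\<And>t. \<bar>?z' t\<bar> \<le> Cz * exp (- (b + 4) * t)"
      "\<And>t. \<bar>?z t\<bar> \<le> Cz * exp (- (b + 4) * t)"
    by (rule dominated_common[OF domexp[of v1 "b + 4"] domexp[of "\<lambda>t. v2 t - 4 * v1 t" "b + 4"] domexp[of v1 "b + 4"]])
      (use dv in \<open>auto intro!: dominated_intros\<close>)
  have cH2: "continuous_on UNIV ?H2" by (intro continuous_intros cv)
  have cz': "continuous_on UNIV ?z'" by (intro continuous_intros cv)
  have cp2: "continuous_on UNIV ?p2" and cp1: "continuous_on UNIV ?p1" and cp0: "continuous_on UNIV ?pp"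
    by (intro continuous_intros cv cw)+
  have Heq: "(\<lambda>t. exp (- 2 * t) * (?p2 t + (real CARD('n) - 2) * ?p1 t)) = ?H"
  proof
    fix t
    have "?p2 t + (real CARD('n) - 2) * ?p1 t = exp (- b * t) * (v2 t + ?n * v1 t)"
      by (simp add: N algebra_simps)
    then show "exp (- 2 * t) * (?p2 t + (real CARD('n) - 2) * ?p1 t) = ?H t" by (simp only: ee)
  qed
  have geq: "(\<lambda>t. exp (- 2 * t) * ?p1 t) = (\<lambda>t. exp (- (b + 2) * t) * v1 t)"
    by (simp only: ee)
  have wlap: "weak_lap ?u ?h"
    unfolding weak_lap_def
    using radial_weak_lap[OF dp0 dp1 cp2 C0, where 'n = 'n, unfolded Heq] b0 by (auto simp: N)
  have wgrad: "weak_grad ?u ?g"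
    unfolding weak_grad_def
    using radial_weak_grad[OF dp0 cp1 C0(1,2), where 'n = 'n, unfolded geq] b0 by (auto simp: N mult.commute)
  have ub: "?u \<in> borel_measurable borel" and hb: "?h \<in> borel_measurable borel" and grb: "?gr \<in> borel_measurable borel"
    by (intro radial_lift_borel borel_measurable_continuous_onI continuous_intros cv cw)+
  have sq: "(exp (- (b + 2) * t) * y)\<^sup>2 = exp (- real CARD('n) * t) * y\<^sup>2" for t y
  proof -
    have "exp (- real CARD('n) * t) = exp (- (b + 2) * t) * exp (- (b + 2) * t)"
      by (simp add: N exp_add[symmetric] algebra_simps)
    then show ?thesis unfolding power2_eq_square by (simp only: mult_ac)
  qed
  have sq4: "exp (- 4 * t) * (exp (- b * t) * y)\<^sup>2 = exp (- real CARD('n) * t) * y\<^sup>2" for t y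
  proof -
    have "exp (- real CARD('n) * t) = exp (- 4 * t) * (exp (- b * t) * exp (- b * t))"
      by (simp add: N exp_add[symmetric] algebra_simps)
    then show ?thesis unfolding power2_eq_square by (simp only: mult_ac)
  qed
  have i_h: "integrable lborel (\<lambda>x. (?h x)\<^sup>2)"
  proof -
    have "(\<lambda>x. (?h x)\<^sup>2) = radial_lift (\<lambda>t. exp (- real CARD('n) * t) * (v2 t + ?n * v1 t)\<^sup>2)"
    proof
      fix x :: "real^'n"
      show "(?h x)\<^sup>2 = radial_lift (\<lambda>t. exp (- real CARD('n) * t) * (v2 t + ?n * v1 t)\<^sup>2) x"
        by (cases "x = 0") (simp add: radial_lift_def, simp only: radial_lift_def if_False sq)
    qed
    moreover have "integrable lborel (radial_lift (\<lambda>t. exp (- real CARD('n) * t) * (v2 t + ?n * v1 t)\<^sup>2) :: real^'n \<Rightarrow> real)"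
      by (rule integrable_radial_lift_square[of k \<tau> b])
        (use dv k0 b0 in \<open>auto intro!: dominated_intros continuous_intros cv simp: q_def\<close>)
    ultimately show ?thesis by simp
  qed
  have i_g: "integrable lborel (\<lambda>x. (norm (?g x))\<^sup>2 / (norm x)\<^sup>2)"
  proof -
    have "(\<lambda>x. (norm (?g x))\<^sup>2 / (norm x)\<^sup>2) = radial_lift (\<lambda>t. exp (- real CARD('n) * t) * (v1 t)\<^sup>2)"
    proof
      fix x :: "real^'n"
      show "(norm (?g x))\<^sup>2 / (norm x)\<^sup>2 = radial_lift (\<lambda>t. exp (- real CARD('n) * t) * (v1 t)\<^sup>2) x"
      proof (cases "x = 0")
        case False
        then have "(norm (?g x))\<^sup>2 / (norm x)\<^sup>2 = (?gr x)\<^sup>2" by (simp add: power_mult_distrib)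
        then show ?thesis using False by (simp only: radial_lift_def if_False sq)
      qed (simp add: radial_lift_def)
    qed
    moreover have "integrable lborel (radial_lift (\<lambda>t. exp (- real CARD('n) * t) * (v1 t)\<^sup>2) :: real^'n \<Rightarrow> real)"
      by (rule integrable_radial_lift_square[of k \<tau> b])
        (use dv k0 b0 in \<open>auto intro!: dominated_intros continuous_intros cv simp: q_def\<close>)
    ultimately show ?thesis by simp
  qed
  have n4: "exp (- 4 * ln (norm x)) = 1 / norm x ^ 4" if "x \<noteq> 0" for x :: "real^'n"
    using exp_ln_norm_powr[OF that, of "- 4"] that powr_minus[of "norm x" 4] by (simp add: divide_inverse)
  have i_u: "integrable lborel (\<lambda>x. (?u x)\<^sup>2 / norm x ^ 4)"
  proof -
    have "(?u x)\<^sup>2 / norm x ^ 4 = radial_lift (\<lambda>t. exp (- real CARD('n) * t) * (w0 t)\<^sup>2) x" for x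
    proof (cases "x = 0")
      case False
      have "(?u x)\<^sup>2 / norm x ^ 4 = exp (- 4 * ln (norm x)) * (?u x)\<^sup>2" using n4[OF False] by simp
      then show ?thesis using False by (simp only: radial_lift_def if_False sq4)
    qed (simp add: radial_lift_def)
    moreover have "integrable lborel (radial_lift (\<lambda>t. exp (- real CARD('n) * t) * (w0 t)\<^sup>2) :: real^'n \<Rightarrow> real)"
      by (rule integrable_radial_lift_square[of k \<tau> b])
        (use dom k0 b0 in \<open>auto intro!: dominated_intros continuous_intros cw simp: q_def\<close>)
    ultimately show ?thesis by simp
  qed
  have A0: "A > 0" unfolding A_def using amplitude_pos b0 k0 by blast
  have powq: "(exp (- b * t) * w0 t) powr s = exp (- (b * s) * t) * (A powr s * q (b * s) t)" for s t
    using A0 by (simp add: w0_def q_def cosh_pow_def powr_mult powr_powr exp_powr_real)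
  have i_p: "integrable lborel (\<lambda>x. \<bar>?u x\<bar> powr crit_exp CARD('n))"
  proof -
    have c: "b * crit_exp CARD('n) = real CARD('n)" using b0 by (simp add: crit_exp_def N)
    have "\<bar>?u x\<bar> powr crit_exp CARD('n) =
        radial_lift (\<lambda>t. exp (- real CARD('n) * t) * (A powr crit_exp CARD('n) * q (real CARD('n)) t)) x" for x
      using powq[of "ln (norm x)" "crit_exp CARD('n)", unfolded c] A0 qpos
      by (simp add: radial_lift_def w0_def abs_mult abs_of_pos)
    moreover have "integrable lborel (radial_lift (\<lambda>t. exp (- real CARD('n) * t) *
        (A powr crit_exp CARD('n) * q (real CARD('n)) t)) :: real^'n \<Rightarrow> real)"
    proof (subst integrable_radial_lift_iff)
      show "(\<lambda>t. exp (- real CARD('n) * t) * (A powr crit_exp CARD('n) * q (real CARD('n)) t)) \<in> borel_measurable borel"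
        by (intro borel_measurable_continuous_onI continuous_intros cq)
      have "integrable lborel (\<lambda>t. A powr crit_exp CARD('n) * q (real CARD('n)) t)"
        unfolding q_def using k0 by (intro integrable_mult_right integrable_cosh_pow) auto
      then show "integrable lborel (\<lambda>t. exp (real CARD('n) * t) * (exp (- real CARD('n) * t) *
          (A powr crit_exp CARD('n) * q (real CARD('n)) t)))"
        by (simp only: exp_cancel)
    qed
    ultimately show ?thesis by simp
  qed
  have E: "E_mu_wit \<mu> ?u ?g ?h"
    unfolding E_mu_wit_def using ub hb grb wlap wgrad i_h i_g i_u i_p by auto
  let ?R1 = "\<lambda>t. exp (- 2 * t) * (?H2 t + (real CARD('n) - 2) * ?H1 t)"
  let ?R2 = "\<lambda>t. real CARD('n) * ?z t + ?z' t"
  let ?R3 = "\<lambda>t. exp (- 4 * t) * ?pp t"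
  let ?c1 = "C1 CARD('n) \<mu>" and ?c2 = "C2 CARD('n) \<mu>" and ?ex = "crit_exp CARD('n) - 1"
  have p: "?ex = (b + 4) / b" using b0 by (simp add: crit_exp_def N field_simps)
  \<comment> \<open>The equation pointwise in t. Every term carries exp (- (b + 4) t): on the left
    through the weights, on the right because b times \<open>?ex\<close> is b + 4. The plus sign of
    \<open>?c1\<close> anticipates the minus sign from integrating the gradient term by
    parts.\<close>
  have ode: "?R1 t + ?c1 * ?R2 t + ?c2 * ?R3 t = ?pp t powr ?ex" for t
  proof -
    let ?e = "exp (- (b + 4) * t)"
    have R1: "?R1 t = ?e * (w4 t - ((b + 2)\<^sup>2 + b\<^sup>2) * w2 t + (b + 2)\<^sup>2 * b\<^sup>2 * w0 t)"
    proof -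
      have "real CARD('n) - 2 = 2 * b + 2" by (simp add: N)
      then show ?thesis using ef(6)[of t] by (simp only:)
    qed
    have R2: "?R2 t = ?e * (w2 t - b\<^sup>2 * w0 t)"
      using ef(7)[of t] by (simp only: N)
    have R3: "?R3 t = ?e * w0 t" by (simp add: exp_add[symmetric] algebra_simps flip: mult.assoc)
    have "b * ?ex = b + 4" using b0 by (simp add: p)
    then have R4: "?pp t powr ?ex = ?e * (A powr ((b + 4) / b) * q (b + 4) t)"
      using powq[of t ?ex] by (simp add: p)
    have "w4 t - ((b + 2)\<^sup>2 + b\<^sup>2) * w2 t + (b + 2)\<^sup>2 * b\<^sup>2 * w0 t
        + ?c1 * (w2 t - b\<^sup>2 * w0 t) + ?c2 * w0 t =
        w4 t - k\<^sup>2 * ((b + 2)\<^sup>2 + b\<^sup>2) * w2 t + k ^ 4 * ((b + 2)\<^sup>2 * b\<^sup>2) * w0 t"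
      unfolding C1_eq[OF N5 b k] C2_eq[OF N5 b k]
      by (simp add: algebra_simps power2_eq_square power4_eq_xxxx)
    \<comment> \<open>The two factors of the operator contribute - k^2 b (b + 1) and - k^2 (b + 2)
      (b + 3); all terms with the exponents b and b + 2 cancel.\<close>
    moreover have "w4 t - k\<^sup>2 * ((b + 2)\<^sup>2 + b\<^sup>2) * w2 t + k ^ 4 * ((b + 2)\<^sup>2 * b\<^sup>2) * w0 t =
        (k ^ 4 * (b * (b + 1) * (b + 2) * (b + 3)) * A) * q (b + 4) t"
      unfolding w4_def w2_def w0_def
      by (simp add: algebra_simps power2_eq_square power4_eq_xxxx)
    moreover have "k ^ 4 * (b * (b + 1) * (b + 2) * (b + 3)) * A = A powr ((b + 4) / b)"
      using amplitude_powr[OF b0 k0] by (simp add: A_def)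
    ultimately have "w4 t - ((b + 2)\<^sup>2 + b\<^sup>2) * w2 t + (b + 2)\<^sup>2 * b\<^sup>2 * w0 t
        + ?c1 * (w2 t - b\<^sup>2 * w0 t) + ?c2 * w0 t = A powr ((b + 4) / b) * q (b + 4) t" by simp
    then have "?e * (w4 t - ((b + 2)\<^sup>2 + b\<^sup>2) * w2 t + (b + 2)\<^sup>2 * b\<^sup>2 * w0 t
        + ?c1 * (w2 t - b\<^sup>2 * w0 t) + ?c2 * w0 t) = ?e * (A powr ((b + 4) / b) * q (b + 4) t)" by (simp only:)
    then show ?thesis unfolding R1 R2 R3 R4 by (simp only: distrib_left[of ?e] mult.left_commute)
  qed
  have "integrable lborel (\<lambda>x. ?u x powr ?ex * \<phi> x) \<and>
      (\<integral>x. ?h x * lap \<phi> x \<partial>lborel) - ?c1 * (\<integral>x. (?g x \<bullet> grad \<phi> x) / (norm x)\<^sup>2 \<partial>lborel)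
          + ?c2 * (\<integral>x. ?u x * \<phi> x / norm x ^ 4 \<partial>lborel) = (\<integral>x. ?u x powr ?ex * \<phi> x \<partial>lborel)"
    if \<phi>: "test_fun (- {0}) \<phi>" for \<phi>
  proof -
    have \<phi>U: "test_fun UNIV \<phi>" using test_fun_mono[OF \<phi>] by simp
    have i1: "integrable lborel (\<lambda>x. radial_lift ?R1 x * \<phi> x)"
      and i2: "integrable lborel (\<lambda>x. radial_lift ?R2 x * \<phi> x)"
      and i3: "integrable lborel (\<lambda>x. radial_lift ?R3 x * \<phi> x)"
      by (intro integrable_radial_lift_test \<phi> continuous_intros cv cw)+
    \<comment> \<open>\<open>?H\<close> is O(|x|^(-b-2)); its Laplacian and the divergence of the
      field x \<open>?z\<close> both have the exponent b + 4, which is below N = 2 b + 4 because b >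
      0.\<close>
    have m2: "b + 2 + 2 < real CARD('n)" "b + 4 < real CARD('n)" using b0 by (auto simp: N)
    have t1: "(\<integral>x. ?h x * lap \<phi> x \<partial>lborel) = (\<integral>x. radial_lift ?R1 x * \<phi> x \<partial>lborel)"
      by (rule radial_weak_lap(3)[OF dH dH1 cH2 CH m2(1) \<phi>U])
    have "(?g x \<bullet> grad \<phi> x) / (norm x)\<^sup>2 = (\<Sum>i\<in>UNIV. (x $ i * radial_lift ?z x) * pd i \<phi> x)" for x
    proof (cases "x = 0")
      case False
      have "radial_lift ?z x = ?gr x / (norm x)\<^sup>2"
        using False exp_minus2_ln[of "norm x"] ee[of "ln (norm x)" "b + 2" "v1 (ln (norm x))"]
        by (simp add: radial_lift_def add.commute)
      then show ?thesis
        by (simp add: inner_vec_def grad_def sum_divide_distrib mult_ac)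
    qed simp
    then have t2: "(\<integral>x. (?g x \<bullet> grad \<phi> x) / (norm x)\<^sup>2 \<partial>lborel) = - (\<integral>x. radial_lift ?R2 x * \<phi> x \<partial>lborel)"
      using radial_weak_div(1,3)[OF dz cz' Cz(1,2) m2(2) \<phi>U]
      by (simp only:) (subst Bochner_Integration.integral_sum, auto)
    have "?u x * \<phi> x / norm x ^ 4 = radial_lift ?R3 x * \<phi> x" for x
    proof (cases "x = 0")
      case False
      then show ?thesis using n4[OF False] by (simp add: radial_lift_def)
    qed (simp add: radial_lift_def)
    then have t3: "(\<integral>x. ?u x * \<phi> x / norm x ^ 4 \<partial>lborel) = (\<integral>x. radial_lift ?R3 x * \<phi> x \<partial>lborel)" by simp
    have eq: "radial_lift ?R1 x * \<phi> x + ?c1 * (radial_lift ?R2 x * \<phi> x) + ?c2 * (radial_lift ?R3 x * \<phi> x)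
        = ?u x powr ?ex * \<phi> x" for x
    proof (cases "x = 0")
      case False
      have "(?R1 (ln (norm x)) + ?c1 * ?R2 (ln (norm x)) + ?c2 * ?R3 (ln (norm x))) * \<phi> x
         = ?pp (ln (norm x)) powr ?ex * \<phi> x" by (simp only: ode)
      then show ?thesis using False by (simp only: radial_lift_def if_False) (simp add: algebra_simps)
    qed (simp add: radial_lift_def)
    have "integrable lborel (\<lambda>x. radial_lift ?R1 x * \<phi> x + ?c1 * (radial_lift ?R2 x * \<phi> x) + ?c2 * (radial_lift ?R3 x * \<phi> x))"
      by (intro Bochner_Integration.integrable_add integrable_mult_right i1 i2 i3)
    moreover have "(\<integral>x. ?u x powr ?ex * \<phi> x \<partial>lborel) = (\<integral>x. radial_lift ?R1 x * \<phi> x \<partial>lborel)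
       + ?c1 * (\<integral>x. radial_lift ?R2 x * \<phi> x \<partial>lborel) + ?c2 * (\<integral>x. radial_lift ?R3 x * \<phi> x \<partial>lborel)"
      unfolding eq[symmetric] using i1 i2 i3 by simp
    ultimately show ?thesis unfolding t1 t2 t3 eq by simp
  qed
  then have "weak_solution \<mu> ?u" unfolding weak_solution_def using E by blast
  moreover have "(\<lambda>t. exp (- b * t) * profile b k \<tau> t) = ?pp"
    by (simp add: profile_def w0_def A_def q_def)
  ultimately show ?thesis by simp
qed

lemma pos_radial_solution_U_scaled:
  fixes \<mu> :: real
  assumes "CARD('n::finite) \<ge> 5" "0 < \<mu>" "\<mu> < real CARD('n) - 4" "lam > 0"
  shows "pos_radial_solution \<mu> (U_scaled \<mu> lam :: real^'n \<Rightarrow> real)"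
proof -
  let ?b = "(real CARD('n) - 4) / 2" and ?k = "1 - \<mu> / (real CARD('n) - 4)"
  note eq = U_scaled_eq_radial_lift[OF assms refl refl]
  have b: "?b > 0" and k: "?k > 0" using assms by auto
  have "AE x in lborel. U_scaled \<mu> lam (x::real^'n) > 0"
    unfolding eq using radial_lift_AE[of "\<lambda>t. exp (- ?b * t) * profile ?b ?k (?k * ln lam) t", where 'n = 'n]
    by eventually_elim (use amplitude_pos[OF b k] cosh_pow_pos in \<open>simp add: profile_def\<close>)
  moreover have "radial (U_scaled \<mu> lam :: real^'n \<Rightarrow> real)"
    unfolding eq radial_def by (auto simp: radial_lift_def)
  moreover have "weak_solution \<mu> (U_scaled \<mu> lam :: real^'n \<Rightarrow> real)"
    unfolding eq by (rule weak_solution_profile[OF assms(1-3) refl refl])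
  ultimately show ?thesis unfolding pos_radial_solution_def by blast
qed


section \<open>Exponential kernels\<close>

text \<open>Partial fractions of 1 / ((xi^2 + \<alpha>^2) (xi^2 + \<beta>^2)): each exponential over
  twice its rate is the fundamental solution of one factor c^2 - D^2, and the combination is the
  bounded even fundamental solution of (D^2 - \<alpha>^2) (D^2 - \<beta>^2).\<close>

definition green :: "real \<Rightarrow> real \<Rightarrow> real \<Rightarrow> real" where
  "green \<alpha> \<beta> r = (exp (- \<beta> * \<bar>r\<bar>) / (2 * \<beta>) - exp (- \<alpha> * \<bar>r\<bar>) / (2 * \<alpha>)) / (\<alpha>\<^sup>2 - \<beta>\<^sup>2)"

text \<open>The kernel of the initial value problem for the same operator: a homogeneous solution
  whose value and first two derivatives vanish at 0, with third derivative 1 there.\<close>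

definition volterra :: "real \<Rightarrow> real \<Rightarrow> real \<Rightarrow> real" where
  "volterra \<alpha> \<beta> r = (sinh (\<alpha> * r) / \<alpha> - sinh (\<beta> * r) / \<beta>) / (\<alpha>\<^sup>2 - \<beta>\<^sup>2)"

lemma sq_diff_pos: "0 < \<beta> \<Longrightarrow> \<beta> < \<alpha> \<Longrightarrow> 0 < \<alpha>\<^sup>2 - (\<beta>::real)\<^sup>2"
  by (simp add: power_strict_mono)

lemma green_borel [measurable]: "green \<alpha> \<beta> \<in> borel_measurable borel"
  unfolding green_def[abs_def] by measurable

lemma volterra_borel [measurable]: "volterra \<alpha> \<beta> \<in> borel_measurable borel"
proof -
  have [measurable]: "(\<lambda>r. sinh (c * r)) \<in> borel_measurable borel" for c :: real
    by (intro borel_measurable_continuous_onI continuous_intros)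
  show ?thesis unfolding volterra_def[abs_def] by measurable
qed

lemma green_nonneg:
  assumes "0 < \<beta>" "\<beta> < \<alpha>"
  shows "0 \<le> green \<alpha> \<beta> r"
proof -
  have "exp (- \<alpha> * \<bar>r\<bar>) / (2 * \<alpha>) \<le> exp (- \<beta> * \<bar>r\<bar>) / (2 * \<beta>)"
    using assms by (intro frac_le) (auto intro!: mult_right_mono)
  then show ?thesis unfolding green_def using sq_diff_pos[OF assms] by simp
qed

lemma green_le:
  assumes "0 < \<beta>" "\<beta> < \<alpha>"
  shows "green \<alpha> \<beta> r \<le> 1 / (2 * \<beta> * (\<alpha>\<^sup>2 - \<beta>\<^sup>2)) * exp (- \<beta> * \<bar>r\<bar>)"
proof -
  have "green \<alpha> \<beta> r \<le> (exp (- \<beta> * \<bar>r\<bar>) / (2 * \<beta>)) / (\<alpha>\<^sup>2 - \<beta>\<^sup>2)"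
    unfolding green_def using sq_diff_pos[OF assms] assms by (intro divide_right_mono) auto
  then show ?thesis by simp
qed

text \<open>The bracket vanishes at 0 and has the derivative cosh (\<alpha> r) - cosh (\<beta> r),
  which is nonnegative for r >= 0.\<close>

lemma volterra_nonneg:
  assumes "0 < \<beta>" "\<beta> < \<alpha>" "0 \<le> r"
  shows "0 \<le> volterra \<alpha> \<beta> r"
proof -
  have "(\<lambda>r. sinh (\<alpha> * r) / \<alpha> - sinh (\<beta> * r) / \<beta>) 0 \<le> (\<lambda>r. sinh (\<alpha> * r) / \<alpha> - sinh (\<beta> * r) / \<beta>) r"
  proof (rule DERIV_nonneg_imp_nondecreasing[OF assms(3)])
    fix x :: real assume x: "0 \<le> x" "x \<le> r"
    have "((\<lambda>r. sinh (\<alpha> * r) / \<alpha> - sinh (\<beta> * r) / \<beta>) has_real_derivative cosh (\<alpha> * x) - cosh (\<beta> * x)) (at x)"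
      using assms by (auto intro!: derivative_eq_intros)
    moreover have "cosh (\<beta> * x) \<le> cosh (\<alpha> * x)"
      using assms x by (intro cosh_real_nonneg_le_iff[THEN iffD2]) (auto intro: mult_right_mono)
    ultimately show "\<exists>y. ((\<lambda>r. sinh (\<alpha> * r) / \<alpha> - sinh (\<beta> * r) / \<beta>) has_real_derivative y) (at x) \<and> 0 \<le> y"
      by auto
  qed
  then show ?thesis unfolding volterra_def using sq_diff_pos[OF assms(1,2)] by simp
qed

lemma volterra_le:
  assumes "0 < \<beta>" "\<beta> < \<alpha>" "0 \<le> r"
  shows "volterra \<alpha> \<beta> r \<le> 1 / (2 * \<alpha> * (\<alpha>\<^sup>2 - \<beta>\<^sup>2)) * exp (\<alpha> * r)"
proof -
  have "sinh (\<alpha> * r) / \<alpha> - sinh (\<beta> * r) / \<beta> \<le> sinh (\<alpha> * r) / \<alpha>" using assms by simp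
  also have "\<dots> \<le> exp (\<alpha> * r) / (2 * \<alpha>)"
    using assms by (simp add: sinh_def field_simps)
  finally have "volterra \<alpha> \<beta> r \<le> (exp (\<alpha> * r) / (2 * \<alpha>)) / (\<alpha>\<^sup>2 - \<beta>\<^sup>2)"
    unfolding volterra_def using sq_diff_pos[OF assms(1,2)] by (intro divide_right_mono) auto
  then show ?thesis by simp
qed

text \<open>For s > t the Green function already is the combination of the two exponentials growing
  in t; continuing it to s <= t leaves the Volterra kernel as the defect. The first two terms
  separate t from s, which later yields the constants \<open>P\<close> and \<open>Q\<close>.\<close>

lemma green_eq_volterra:
  assumes "0 < \<beta>" "\<beta> < \<alpha>"
  shows "green \<alpha> \<beta> (t - s) = 1 / (2 * \<beta> * (\<alpha>\<^sup>2 - \<beta>\<^sup>2)) * exp (\<beta> * t) * exp (- \<beta> * s)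
     - 1 / (2 * \<alpha> * (\<alpha>\<^sup>2 - \<beta>\<^sup>2)) * exp (\<alpha> * t) * exp (- \<alpha> * s)
     + indicator {..t} s * volterra \<alpha> \<beta> (t - s)"
proof -
  define D where "D = \<alpha>\<^sup>2 - \<beta>\<^sup>2"
  have D: "D > 0" using sq_diff_pos[OF assms] by (simp add: D_def)
  have e: "exp (c * t) * exp (- c * s) = exp (c * (t - s))" for c
    by (simp add: exp_add[symmetric] algebra_simps)
  have "green \<alpha> \<beta> (t - s) = exp (\<beta> * (t - s)) / (2 * \<beta> * D) - exp (\<alpha> * (t - s)) / (2 * \<alpha> * D)
     + indicator {..t} s * volterra \<alpha> \<beta> (t - s)"
  proof (cases "s \<le> t")
    case True
    then show ?thesis using D assms unfolding green_def volterra_def D_def[symmetric]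
      by (simp add: sinh_def diff_divide_distrib)
  next
    case False
    have a: "- c * \<bar>t - s\<bar> = c * (t - s)" for c using False by (simp add: algebra_simps)
    show ?thesis unfolding green_def D_def[symmetric] a using False D assms
      by (simp add: diff_divide_distrib)
  qed
  then show ?thesis unfolding mult.assoc e D_def by simp
qed

lemma has_bochner_integral_exp_abs:
  fixes c :: real
  assumes "c > 0"
  shows "has_bochner_integral lborel (\<lambda>s. exp (- c * \<bar>t - s\<bar>)) (2 / c)"
proof -
  have "has_bochner_integral lborel (\<lambda>s. exp (c * t) * (indicator {t..} s * exp (- c * s)) +
      exp (- c * t) * (indicator {..t} s * exp (c * s))) (exp (c * t) * (exp (- c * t) / c) + exp (- c * t) * (exp (c * t) / c))"
    by (intro has_bochner_integral_add has_bochner_integral_mult_right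
        has_bochner_integral_exp_atLeast has_bochner_integral_exp_atMost assms)
  moreover have "exp (c * t) * (exp (- c * t) / c) + exp (- c * t) * (exp (c * t) / c) = 2 / c"
    by (simp add: exp_minus)
  moreover have "AE s in lborel. exp (c * t) * (indicator {t..} s * exp (- c * s)) +
      exp (- c * t) * (indicator {..t} s * exp (c * s)) = exp (- c * \<bar>t - s\<bar>)"
    using AE_lborel_singleton[of t]
  proof eventually_elim
    case (elim s)
    then show ?case
      by (cases "s < t") (auto simp: exp_add[symmetric] algebra_simps indicator_def abs_if)
  qed
  ultimately show ?thesis
    by (subst has_bochner_integral_cong_AE[symmetric]) auto
qed

lemma integral_exp_abs:
  fixes c :: real
  assumes "c > 0"
  shows "integrable lborel (\<lambda>s. exp (- c * \<bar>t - s\<bar>))" "(\<integral>s. exp (- c * \<bar>t - s\<bar>) \<partial>lborel) = 2 / c"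
  using has_bochner_integral_exp_abs[OF assms, of t] by (auto simp: has_bochner_integral_iff)

lemma integrable_bounded_mult:
  fixes f g :: "'a \<Rightarrow> real"
  assumes "integrable M f" "g \<in> borel_measurable M" "\<And>x. \<bar>g x\<bar> \<le> B"
  shows "integrable M (\<lambda>x. g x * f x)"
proof (rule Bochner_Integration.integrable_bound[of _ "\<lambda>x. B * f x"])
  show "integrable M (\<lambda>x. B * f x)" using assms(1) by simp
  have [measurable]: "f \<in> borel_measurable M" using assms(1) by simp
  show "(\<lambda>x. g x * f x) \<in> borel_measurable M" using assms(2) by measurable
  show "AE x in M. norm (g x * f x) \<le> norm (B * f x)"
    using assms(3) by (intro AE_I2) (auto simp: abs_mult intro!: mult_right_mono intro: order_trans[OF _ abs_ge_self])
qed

lemma exp_convolution_tendsto_at_bot: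
  fixes g :: "real \<Rightarrow> real"
  assumes "integrable lborel g" "c > 0"
  shows "((\<lambda>t. \<integral>s. exp (- c * \<bar>t - s\<bar>) * g s \<partial>lborel) \<longlongrightarrow> 0) at_bot"
  unfolding filterlim_at_bot_mirror
proof -
  have [measurable]: "g \<in> borel_measurable borel" using assms(1) by auto
  have "((\<lambda>t. \<integral>s. exp (- c * \<bar>- t - s\<bar>) * g s \<partial>lborel) \<longlongrightarrow> (\<integral>s. 0 \<partial>(lborel :: real measure))) at_top"
  proof (rule integral_dominated_convergence_at_top[where w = "\<lambda>s. \<bar>g s\<bar>"])
    show "AE s in lborel. ((\<lambda>t. exp (- c * \<bar>- t - s\<bar>) * g s) \<longlongrightarrow> 0) at_top"
    proof (rule AE_I2)
      fix s
      have "filterlim (\<lambda>t. c * \<bar>- t - s\<bar>) at_top at_top"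
      proof (rule filterlim_tendsto_pos_mult_at_top[OF tendsto_const assms(2)])
        have "filterlim (\<lambda>t::real. s + t) at_top at_top"
          by (intro filterlim_tendsto_add_at_top[OF tendsto_const] filterlim_ident)
        then show "filterlim (\<lambda>t. \<bar>- t - s\<bar>) at_top at_top"
          by (rule filterlim_at_top_mono) (auto intro!: always_eventually)
      qed
      then have "((\<lambda>t. exp (- c * \<bar>- t - s\<bar>)) \<longlongrightarrow> 0) at_top"
        by (intro filterlim_compose[OF exp_at_bot]) (simp add: filterlim_uminus_at_bot)
      from tendsto_mult_left_zero[OF this, of "g s"]
      show "((\<lambda>t. exp (- c * \<bar>- t - s\<bar>) * g s) \<longlongrightarrow> 0) at_top" .
    qed
    show "eventually (\<lambda>t. AE s in lborel. norm (exp (- c * \<bar>- t - s\<bar>) * g s) \<le> \<bar>g s\<bar>) at_top"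
      using assms(2) by (intro always_eventually allI AE_I2) (auto simp: abs_mult intro!: mult_left_le_one_le)
  qed (use assms in auto)
  then show "((\<lambda>t. \<integral>s. exp (- c * \<bar>- t - s\<bar>) * g s \<partial>lborel) \<longlongrightarrow> 0) at_top" by simp
qed

lemma powr_diff_le:
  fixes x y p :: real
  assumes "0 \<le> x" "x \<le> y" "p > 1"
  shows "y powr p - x powr p \<le> p * y powr (p - 1) * (y - x)"
proof (cases "x = 0 \<or> x = y")
  case True
  then show ?thesis
  proof
    assume "x = 0"
    then show ?thesis
      using assms powr_add[of y 1 "p - 1"]
      by (cases "y = 0") (auto simp: mult_le_cancel_right1 mult.commute)
  qed simp
next
  case False
  then have "x > 0" "x < y" using assms by auto
  have "((\<lambda>z. z powr p) has_real_derivative p * z powr (p - 1)) (at z)" if "x \<le> z" for z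
    using that \<open>x > 0\<close> by (intro has_real_derivative_powr) auto
  then obtain z where z: "z > x" "z < y" "y powr p - x powr p = (y - x) * (p * z powr (p - 1))"
    using MVT2[of x y "\<lambda>z. z powr p" "\<lambda>z. p * z powr (p - 1)"] \<open>x < y\<close> by blast
  have "z powr (p - 1) \<le> y powr (p - 1)" using z \<open>x > 0\<close> assms by (intro powr_mono2) auto
  then have "(y - x) * (p * z powr (p - 1)) \<le> (y - x) * (p * y powr (p - 1))"
    using assms by (intro mult_left_mono) auto
  then show ?thesis using z by (simp add: mult_ac)
qed

text \<open>Below the threshold \<open>\<epsilon> powr (1 / p)\<close> the power is at most
  \<epsilon>; above it the square over the squared threshold is at least 1. The additive \<epsilon>
  accommodates p < 2, when no multiple of the square bounds the power near 0.\<close>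

lemma powr_interpolation:
  fixes x M p \<epsilon> :: real
  assumes "0 \<le> x" "x \<le> M" "p > 0" "\<epsilon> > 0"
  shows "x powr p \<le> \<epsilon> + M powr p / (\<epsilon> powr (1 / p))\<^sup>2 * x\<^sup>2"
proof (cases "x \<le> \<epsilon> powr (1 / p)")
  case True
  have "x powr p \<le> (\<epsilon> powr (1 / p)) powr p" using True assms by (intro powr_mono2) auto
  also have "\<dots> = \<epsilon>" using assms by (simp add: powr_powr)
  finally show ?thesis using assms by (simp add: add_increasing2)
next
  case False
  let ?d = "\<epsilon> powr (1 / p)"
  have d: "?d > 0" using assms by simp
  have "x powr p \<le> M powr p * 1" using assms by (simp add: powr_mono2)
  also have "\<dots> \<le> M powr p * (x\<^sup>2 / ?d\<^sup>2)"
    using False d by (intro mult_left_mono) (auto simp: power_mono)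
  finally show ?thesis using assms by (simp add: add_increasing)
qed

text \<open>Iterating the inequality from the bound \<open>B\<close>, the integration of the next
  exponential from minus infinity supplies a factor 1 / ((n + 1) \<gamma>) each time; the resulting
  factorial beats the geometric growth at every fixed t.\<close>

lemma gronwall_exp:
  fixes E :: "real \<Rightarrow> real"
  assumes [measurable]: "E \<in> borel_measurable borel" and E0: "\<And>t. 0 \<le> E t" and EB: "\<And>t. E t \<le> B"
    and \<gamma>: "\<gamma> > 0" and C: "C \<ge> 0"
    and le: "\<And>t. E t \<le> C * (\<integral>s. indicator {..t} s * (exp (\<gamma> * s) * E s) \<partial>lborel)"
  shows "E t = 0"
proof -
  have B: "B \<ge> 0" using E0[of 0] EB[of 0] by linarith
  have bound: "E t \<le> B * (C / \<gamma>) ^ n * exp (real n * \<gamma> * t) / fact n" for n t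
  proof (induction n arbitrary: t)
    case 0
    then show ?case using EB by simp
  next
    case (Suc n)
    let ?K = "B * (C / \<gamma>) ^ n / fact n"
    have K: "?K \<ge> 0" using B C \<gamma> by simp
    have i: "has_bochner_integral lborel (\<lambda>s. indicator {..t} s * exp (real (Suc n) * \<gamma> * s))
        (exp (real (Suc n) * \<gamma> * t) / (real (Suc n) * \<gamma>))"
      by (rule has_bochner_integral_exp_atMost) (use \<gamma> in simp)
    have "(\<integral>s. indicator {..t} s * (exp (\<gamma> * s) * E s) \<partial>lborel) \<le>
        (\<integral>s. ?K * (indicator {..t} s * exp (real (Suc n) * \<gamma> * s)) \<partial>lborel)"
    proof (rule integral_mono_AE')
      show "integrable lborel (\<lambda>s. ?K * (indicator {..t} s * exp (real (Suc n) * \<gamma> * s)))"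
        using i by (intro integrable_mult_right) (simp add: has_bochner_integral_iff)
      show "AE s in lborel. indicator {..t} s * (exp (\<gamma> * s) * E s) \<le> ?K * (indicator {..t} s * exp (real (Suc n) * \<gamma> * s))"
      proof (rule AE_I2)
        fix s
        have "exp (\<gamma> * s) * E s \<le> exp (\<gamma> * s) * (?K * exp (real n * \<gamma> * s))"
          using Suc.IH[of s] by (intro mult_left_mono) auto
        also have "\<dots> = ?K * (exp (\<gamma> * s) * exp (real n * \<gamma> * s))" by (simp add: mult_ac)
        also have "exp (\<gamma> * s) * exp (real n * \<gamma> * s) = exp (real (Suc n) * \<gamma> * s)"
          by (simp add: exp_add[symmetric] algebra_simps)
        finally show "indicator {..t} s * (exp (\<gamma> * s) * E s) \<le> ?K * (indicator {..t} s * exp (real (Suc n) * \<gamma> * s))"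
          by (simp add: indicator_def)
      qed
      show "AE s in lborel. 0 \<le> ?K * (indicator {..t} s * exp (real (Suc n) * \<gamma> * s))"
        by (intro AE_I2 mult_nonneg_nonneg[OF K]) simp
    qed
    also have "\<dots> = ?K * (exp (real (Suc n) * \<gamma> * t) / (real (Suc n) * \<gamma>))"
      using i by (simp add: has_bochner_integral_iff)
    finally have "E t \<le> C * (?K * (exp (real (Suc n) * \<gamma> * t) / (real (Suc n) * \<gamma>)))"
      using le[of t] C by (meson mult_left_mono order_trans)
    also have "\<dots> = B * (C / \<gamma>) ^ Suc n * exp (real (Suc n) * \<gamma> * t) / fact (Suc n)"
      by (simp add: field_simps)
    finally show ?case .
  qed
  have "(\<lambda>n. inverse (fact n) * (C / \<gamma> * exp (\<gamma> * t)) ^ n) \<longlonglongrightarrow> 0"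
    by (rule summable_LIMSEQ_zero[OF summable_exp])
  then have "(\<lambda>n. B * (inverse (fact n) * (C / \<gamma> * exp (\<gamma> * t)) ^ n)) \<longlonglongrightarrow> 0"
    by (rule tendsto_mult_right_zero)
  moreover have "B * (inverse (fact n) * (C / \<gamma> * exp (\<gamma> * t)) ^ n) =
      B * (C / \<gamma>) ^ n * exp (real n * \<gamma> * t) / fact n" for n
    unfolding power_mult_distrib exp_of_nat_mult[symmetric] by (simp only: divide_inverse mult_ac)
  ultimately have "(\<lambda>n. B * (C / \<gamma>) ^ n * exp (real n * \<gamma> * t) / fact n) \<longlonglongrightarrow> 0" by (simp only:)
  then have "E t \<le> 0" by (rule LIMSEQ_le_const) (use bound in auto)
  then show ?thesis using E0[of t] by simp
qed


section \<open>The integral equation\<close>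

text \<open>The midpoint of \<alpha> / p and \<beta>. Below \<beta> the rate survives convolution
  with \<open>exp (- \<beta> * \<bar>r\<bar>)\<close>; above \<alpha> / p it makes
  \<open>exp (- \<alpha> * s) * v s powr p\<close> integrable at minus infinity.\<close>

definition decay_rate :: "real \<Rightarrow> real \<Rightarrow> real \<Rightarrow> real" where
  "decay_rate \<alpha> \<beta> p = (\<alpha> / p + \<beta>) / 2"

text \<open>\<open>v\<close> stands for the representative given by the convolution, so the bounds
  and the integral equation hold at every point rather than almost everywhere. The assumption
  \<open>\<alpha> < p * \<beta>\<close> leaves room for \<open>decay_rate\<close>.\<close>

locale green_solution =
  fixes \<alpha> \<beta> p M :: real and v :: "real \<Rightarrow> real"
  assumes \<beta>: "0 < \<beta>" and \<beta>\<alpha>: "\<beta> < \<alpha>" and p: "1 < p" and p\<alpha>: "\<alpha> < p * \<beta>"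
    and v_borel [measurable]: "v \<in> borel_measurable borel"
    and v_nonneg: "\<And>t. 0 \<le> v t" and v_le: "\<And>t. v t \<le> M"
    and v_sq: "integrable lborel (\<lambda>t. (v t)\<^sup>2)"
    and v_eq: "\<And>t. v t = (\<integral>s. green \<alpha> \<beta> (t - s) * v s powr p \<partial>lborel)"
begin

abbreviation (input) "cb \<equiv> 1 / (2 * \<beta> * (\<alpha>\<^sup>2 - \<beta>\<^sup>2))"
abbreviation (input) "ca \<equiv> 1 / (2 * \<alpha> * (\<alpha>\<^sup>2 - \<beta>\<^sup>2))"

lemma cb_pos: "cb > 0" and ca_pos: "ca > 0"
  using \<beta> \<beta>\<alpha> sq_diff_pos[OF \<beta> \<beta>\<alpha>] by auto

lemma M_nonneg: "0 \<le> M"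
  using v_nonneg[of 0] v_le[of 0] by linarith

lemma v_powr_le: "v t powr p \<le> M powr p"
  using v_nonneg v_le p by (intro powr_mono2) auto

lemma integrable_exp_mult_bounded:
  fixes f :: "real \<Rightarrow> real"
  assumes [measurable]: "f \<in> borel_measurable borel" and f: "\<And>s. \<bar>f s\<bar> \<le> B" and "c > 0"
  shows "integrable lborel (\<lambda>s. exp (- c * \<bar>t - s\<bar>) * f s)"
  using integrable_bounded_mult[OF integral_exp_abs(1)[OF \<open>c > 0\<close>, of t], of f B] f
  by (simp add: mult.commute)

lemma v_le_exp_integral: "v t \<le> cb * (\<integral>s. exp (- \<beta> * \<bar>t - s\<bar>) * v s powr p \<partial>lborel)"
proof -
  have "v t \<le> (\<integral>s. cb * (exp (- \<beta> * \<bar>t - s\<bar>) * v s powr p) \<partial>lborel)"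
    unfolding v_eq[of t]
  proof (rule integral_mono_AE')
    show "integrable lborel (\<lambda>s. cb * (exp (- \<beta> * \<bar>t - s\<bar>) * v s powr p))"
      using v_powr_le \<beta> by (intro integrable_mult_right integrable_exp_mult_bounded[of _ "M powr p"]) auto
    show "AE s in lborel. green \<alpha> \<beta> (t - s) * v s powr p \<le> cb * (exp (- \<beta> * \<bar>t - s\<bar>) * v s powr p)"
    proof (rule AE_I2)
      fix s
      have "green \<alpha> \<beta> (t - s) * v s powr p \<le> (cb * exp (- \<beta> * \<bar>t - s\<bar>)) * v s powr p"
        using green_le[OF \<beta> \<beta>\<alpha>] by (intro mult_right_mono) auto
      then show "green \<alpha> \<beta> (t - s) * v s powr p \<le> cb * (exp (- \<beta> * \<bar>t - s\<bar>) * v s powr p)"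
        by (simp only: mult.assoc)
    qed
    show "AE s in lborel. 0 \<le> cb * (exp (- \<beta> * \<bar>t - s\<bar>) * v s powr p)"
      using cb_pos by (intro AE_I2 mult_nonneg_nonneg) auto
  qed
  then show ?thesis by simp
qed

text \<open>Integrability is available for the square of \<open>v\<close>, so the power is split by
  \<open>powr_interpolation\<close>: the constant part contributes arbitrarily little, and the
  convolution of the square tends to 0 by dominated convergence.\<close>

lemma v_tendsto_0: "(v \<longlongrightarrow> 0) at_bot"
proof (rule tendstoI)
  fix e :: real assume e: "e > 0"
  \<comment> \<open>The kernel \<open>exp (- \<beta> * \<bar>t - s\<bar>)\<close> has mass 2 /
    \<beta>, so this choice contributes exactly e / 2.\<close>
  define \<epsilon> where "\<epsilon> = e / (2 * (cb * (2 / \<beta>)))"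
  have ep: "\<epsilon> > 0" and ep2: "cb * (2 / \<beta>) * \<epsilon> = e / 2"
    using e cb_pos \<beta> sq_diff_pos[OF \<beta> \<beta>\<alpha>] by (auto simp: \<epsilon>_def field_simps)
  let ?C = "M powr p / (\<epsilon> powr (1 / p))\<^sup>2"
  have C: "?C \<ge> 0" by simp
  let ?g = "\<lambda>t. \<integral>s. exp (- \<beta> * \<bar>t - s\<bar>) * (v s)\<^sup>2 \<partial>lborel"
  have ig: "integrable lborel (\<lambda>s. exp (- \<beta> * \<bar>t - s\<bar>) * (v s)\<^sup>2)" for t
    using \<beta> by (intro integrable_bounded_mult[OF v_sq, of _ 1]) auto
  have bound: "v t \<le> e / 2 + cb * ?C * ?g t" for t
  proof -
    have "(\<integral>s. exp (- \<beta> * \<bar>t - s\<bar>) * v s powr p \<partial>lborel) \<le>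
        (\<integral>s. \<epsilon> * exp (- \<beta> * \<bar>t - s\<bar>) + ?C * (exp (- \<beta> * \<bar>t - s\<bar>) * (v s)\<^sup>2) \<partial>lborel)"
    proof (rule integral_mono)
      show "integrable lborel (\<lambda>s. exp (- \<beta> * \<bar>t - s\<bar>) * v s powr p)"
        using v_powr_le \<beta> by (intro integrable_exp_mult_bounded[of _ "M powr p"]) auto
      show "integrable lborel (\<lambda>s. \<epsilon> * exp (- \<beta> * \<bar>t - s\<bar>) + ?C * (exp (- \<beta> * \<bar>t - s\<bar>) * (v s)\<^sup>2))"
        using integral_exp_abs(1)[OF \<beta>] ig by (intro Bochner_Integration.integrable_add integrable_mult_right)
      fix s
      have "v s powr p \<le> \<epsilon> + ?C * (v s)\<^sup>2"
        using powr_interpolation[OF v_nonneg v_le _ ep, of p s] p by simp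
      then have "exp (- \<beta> * \<bar>t - s\<bar>) * v s powr p \<le> exp (- \<beta> * \<bar>t - s\<bar>) * (\<epsilon> + ?C * (v s)\<^sup>2)"
        by (intro mult_left_mono) auto
      also have "\<dots> = \<epsilon> * exp (- \<beta> * \<bar>t - s\<bar>) + ?C * (exp (- \<beta> * \<bar>t - s\<bar>) * (v s)\<^sup>2)"
        by (simp only: distrib_left mult_ac)
      finally show "exp (- \<beta> * \<bar>t - s\<bar>) * v s powr p \<le>
         \<epsilon> * exp (- \<beta> * \<bar>t - s\<bar>) + ?C * (exp (- \<beta> * \<bar>t - s\<bar>) * (v s)\<^sup>2)" .
    qed
    also have "\<dots> = \<epsilon> * (2 / \<beta>) + ?C * ?g t"
      using integral_exp_abs[OF \<beta>, of t] ig[of t] by (subst Bochner_Integration.integral_add) auto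
    finally have "cb * (\<integral>s. exp (- \<beta> * \<bar>t - s\<bar>) * v s powr p \<partial>lborel) \<le> cb * (\<epsilon> * (2 / \<beta>) + ?C * ?g t)"
      using cb_pos by (intro mult_left_mono) auto
    also have "\<dots> = cb * (2 / \<beta>) * \<epsilon> + cb * ?C * ?g t" by (simp only: distrib_left mult_ac)
    finally show ?thesis using v_le_exp_integral[of t] unfolding ep2 by linarith
  qed
  have "((\<lambda>t. e / 2 + cb * ?C * ?g t) \<longlongrightarrow> e / 2 + cb * ?C * 0) at_bot"
    by (intro tendsto_intros exp_convolution_tendsto_at_bot v_sq \<beta>)
  then have "eventually (\<lambda>t. e / 2 + cb * ?C * ?g t < e) at_bot"
    by (rule order_tendstoD(2)) (use e in simp)
  then show "eventually (\<lambda>t. dist (v t) 0 < e) at_bot"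
  proof eventually_elim
    case (elim t)
    then show ?case using bound[of t] v_nonneg[of t] by (simp add: dist_real_def)
  qed
qed

lemma decay_rate_facts:
  "0 < decay_rate \<alpha> \<beta> p" "decay_rate \<alpha> \<beta> p < \<beta>" "\<alpha> < p * decay_rate \<alpha> \<beta> p"
  using \<beta> \<beta>\<alpha> p p\<alpha> by (auto simp: decay_rate_def field_simps add_pos_pos)

text \<open>Far to the left \<open>v t powr (p - 1)\<close> is small, so the integral inequality is
  linear there with a small coefficient. Starting from \<open>v t \<le> M\<close>, each iteration
  halves the constant excess over an exponential bound, and the part of the integral right of
  \<open>T\<close> supplies the exponential term.\<close>

lemma v_exp_decay: "\<exists>C\<ge>0. \<forall>t. v t \<le> C * exp (decay_rate \<alpha> \<beta> p * t)"
proof -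
  define \<theta> where "\<theta> = decay_rate \<alpha> \<beta> p"
  have \<theta>: "0 < \<theta>" "\<theta> < \<beta>" using decay_rate_facts by (auto simp: \<theta>_def)
  \<comment> \<open>\<open>K\<close> is the mass of the kernel with the reduced rate \<beta> -
    \<theta>; the next choice makes \<open>cb * \<epsilon> * K\<close> equal to 1/2.\<close>
  define K where "K = 2 / (\<beta> - \<theta>)"
  have K: "K > 0" using \<theta> by (simp add: K_def)
  define \<epsilon> where "\<epsilon> = 1 / (2 * K * cb)"
  have ep: "\<epsilon> > 0" "cb * \<epsilon> * K = 1 / 2"
    using K cb_pos sq_diff_pos[OF \<beta> \<beta>\<alpha>] \<beta> by (auto simp: \<epsilon>_def)
  have "((\<lambda>t. v t powr (p - 1)) \<longlongrightarrow> 0) at_bot"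
  proof -
    have "((\<lambda>t. v t powr (p - 1)) \<longlongrightarrow> 0 powr (p - 1)) at_bot"
      using p v_nonneg by (intro tendsto_powr' v_tendsto_0 tendsto_const) (auto intro: always_eventually)
    then show ?thesis by simp
  qed
  then have "eventually (\<lambda>t. v t powr (p - 1) < \<epsilon>) at_bot" using ep by (intro order_tendstoD(2)) auto
  then obtain T where T: "\<And>t. t \<le> T \<Longrightarrow> v t powr (p - 1) < \<epsilon>"
    unfolding eventually_at_bot_linorder by blast
  \<comment> \<open>\<open>D * exp (\<theta> * t)\<close> will bound what the region s >= T
    contributes at t <= T, where \<open>v s powr p\<close> is estimated by
    \<open>M powr p\<close>.\<close>
  define D where "D = cb * M powr p * exp (- \<theta> * T) / \<beta>"
  have D: "D \<ge> 0" using cb_pos \<beta> by (simp add: D_def less_imp_le)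
  have ikt: "integrable lborel (\<lambda>s. exp (- (\<beta> - \<theta>) * \<bar>t - s\<bar>))"
     "(\<integral>s. exp (- (\<beta> - \<theta>) * \<bar>t - s\<bar>) \<partial>lborel) = K" for t
    using integral_exp_abs[of "\<beta> - \<theta>" t] \<theta> by (auto simp: K_def)
  have ind: "v t \<le> 2 * D * exp (\<theta> * t) + M / 2 ^ n" if "t \<le> T" for n t
    using that
  proof (induction n arbitrary: t)
    case 0
    then show ?case using v_le[of t] D by (simp add: add_increasing)
  next
    case (Suc n)
    let ?A = "2 * D * exp (\<theta> * t) + M / 2 ^ n"
    have A: "?A \<ge> 0" using D M_nonneg by simp
    have ia: "has_bochner_integral lborel (\<lambda>s. indicator {T..} s * exp (- \<beta> * s)) (exp (- \<beta> * T) / \<beta>)"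
      by (rule has_bochner_integral_exp_atLeast[OF \<beta>])
    have "(\<integral>s. exp (- \<beta> * \<bar>t - s\<bar>) * v s powr p \<partial>lborel) \<le>
       (\<integral>s. (\<epsilon> * ?A) * exp (- (\<beta> - \<theta>) * \<bar>t - s\<bar>) +
          (M powr p * exp (\<beta> * t)) * (indicator {T..} s * exp (- \<beta> * s)) \<partial>lborel)"
    proof (rule integral_mono)
      show "integrable lborel (\<lambda>s. exp (- \<beta> * \<bar>t - s\<bar>) * v s powr p)"
        using v_powr_le \<beta> by (intro integrable_exp_mult_bounded[of _ "M powr p"]) auto
      show "integrable lborel (\<lambda>s. (\<epsilon> * ?A) * exp (- (\<beta> - \<theta>) * \<bar>t - s\<bar>) +
          (M powr p * exp (\<beta> * t)) * (indicator {T..} s * exp (- \<beta> * s)))"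
        using ikt(1) ia by (intro Bochner_Integration.integrable_add integrable_mult_right)
          (auto simp: has_bochner_integral_iff)
      fix s
      show "exp (- \<beta> * \<bar>t - s\<bar>) * v s powr p \<le> (\<epsilon> * ?A) * exp (- (\<beta> - \<theta>) * \<bar>t - s\<bar>) +
          (M powr p * exp (\<beta> * t)) * (indicator {T..} s * exp (- \<beta> * s))"
      proof (cases "s \<le> T")
        case True
        \<comment> \<open>Moving the exponential from s to t costs
          \<open>exp (\<theta> * \<bar>t - s\<bar>)\<close>, which the kernel absorbs while its rate
          drops from \<beta> to \<beta> - \<theta>.\<close>
        have e1: "exp (\<theta> * s) \<le> exp (\<theta> * t) * exp (\<theta> * \<bar>t - s\<bar>)"
          unfolding exp_add[symmetric] using \<theta>
          by (simp add: distrib_left[symmetric] del: distrib_left_numeral)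
        have e2: "1 \<le> exp (\<theta> * \<bar>t - s\<bar>)" using \<theta> by simp
        have "v s powr p = v s powr (p - 1) * v s"
          using powr_add[of "v s" "p - 1" 1] v_nonneg[of s] by simp
        also have "\<dots> \<le> \<epsilon> * (2 * D * exp (\<theta> * s) + M / 2 ^ n)"
          using T[OF True] Suc.IH[OF True] v_nonneg ep by (intro mult_mono) auto
        also have "\<dots> \<le> \<epsilon> * (2 * D * (exp (\<theta> * t) * exp (\<theta> * \<bar>t - s\<bar>)) + M / 2 ^ n * exp (\<theta> * \<bar>t - s\<bar>))"
        proof (intro mult_left_mono add_mono e1)
          show "M / 2 ^ n \<le> M / 2 ^ n * exp (\<theta> * \<bar>t - s\<bar>)"
            using mult_left_mono[OF e2, of "M / 2 ^ n"] M_nonneg by simp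
        qed (use D ep in auto)
        also have "\<dots> = (\<epsilon> * ?A) * exp (\<theta> * \<bar>t - s\<bar>)" by (simp add: algebra_simps)
        finally have "exp (- \<beta> * \<bar>t - s\<bar>) * v s powr p \<le>
            exp (- \<beta> * \<bar>t - s\<bar>) * ((\<epsilon> * ?A) * exp (\<theta> * \<bar>t - s\<bar>))"
          by (intro mult_left_mono) auto
        also have "\<dots> = (\<epsilon> * ?A) * (exp (- \<beta> * \<bar>t - s\<bar>) * exp (\<theta> * \<bar>t - s\<bar>))" by (simp only: mult_ac)
        also have "exp (- \<beta> * \<bar>t - s\<bar>) * exp (\<theta> * \<bar>t - s\<bar>) = exp (- (\<beta> - \<theta>) * \<bar>t - s\<bar>)"
          unfolding exp_add[symmetric] by (simp add: algebra_simps)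
        finally show ?thesis by (simp add: add_increasing2)
      next
        case False
        then have "t < s" using Suc.prems by simp
        then have "exp (- \<beta> * \<bar>t - s\<bar>) = exp (\<beta> * t) * exp (- \<beta> * s)"
          unfolding exp_add[symmetric] by (simp add: algebra_simps)
        then have "exp (- \<beta> * \<bar>t - s\<bar>) * v s powr p \<le> exp (\<beta> * t) * exp (- \<beta> * s) * M powr p"
          using v_powr_le[of s] by (simp add: mult_left_mono)
        moreover have "0 \<le> (\<epsilon> * ?A) * exp (- (\<beta> - \<theta>) * \<bar>t - s\<bar>)" using ep A by simp
        ultimately show ?thesis using False by (simp add: mult_ac)
      qed
    qed
    also have "\<dots> = (\<epsilon> * ?A) * K + (M powr p * exp (\<beta> * t)) * (exp (- \<beta> * T) / \<beta>)"
      using ikt[of t] ia by (subst Bochner_Integration.integral_add) (auto simp: has_bochner_integral_iff)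
    finally have "v t \<le> cb * ((\<epsilon> * ?A) * K + (M powr p * exp (\<beta> * t)) * (exp (- \<beta> * T) / \<beta>))"
      using v_le_exp_integral[of t] cb_pos by (meson mult_left_mono less_imp_le order_trans)
    also have "\<dots> = (cb * \<epsilon> * K) * ?A + cb * M powr p * (exp (\<beta> * t) * exp (- \<beta> * T)) / \<beta>"
    proof -
      have "c * ((\<epsilon> * A) * K + (m * x) * (y / \<beta>)) = (c * \<epsilon> * K) * A + c * m * (x * y) / \<beta>"
        for c A m x y by (simp add: algebra_simps)
      then show ?thesis .
    qed
    \<comment> \<open>Because t <= T, the rate \<beta> may be weakened to \<theta>. The sum is then
      D exp (\<theta> t) plus half of the previous bound, which reproduces the bound for n + 1; this
      is the origin of the factor 2 in front of \<open>D\<close>.\<close>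
    also have "\<dots> \<le> 1 / 2 * ?A + cb * M powr p * (exp (\<theta> * t) * exp (- \<theta> * T)) / \<beta>"
    proof -
      have "\<beta> * (t - T) \<le> \<theta> * (t - T)" using \<theta> Suc.prems by (intro mult_right_mono_neg) auto
      then have "exp (\<beta> * t) * exp (- \<beta> * T) \<le> exp (\<theta> * t) * exp (- \<theta> * T)"
        unfolding exp_add[symmetric] by (simp add: algebra_simps)
      then show ?thesis unfolding ep(2) using cb_pos \<beta>
        by (intro add_left_mono divide_right_mono mult_left_mono mult_nonneg_nonneg) auto
    qed
    also have "\<dots> = 2 * D * exp (\<theta> * t) + M / 2 ^ Suc n" by (simp add: D_def algebra_simps)
    finally show ?case .
  qed
  have lt: "v t \<le> 2 * D * exp (\<theta> * t)" if "t \<le> T" for t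
  proof -
    have "(\<lambda>n. 2 * D * exp (\<theta> * t) + M * (1 / 2) ^ n) \<longlonglongrightarrow> 2 * D * exp (\<theta> * t) + M * 0"
      by (intro tendsto_intros LIMSEQ_realpow_zero) auto
    then have "(\<lambda>n. 2 * D * exp (\<theta> * t) + M / 2 ^ n) \<longlonglongrightarrow> 2 * D * exp (\<theta> * t)"
      by (simp add: power_divide)
    then show ?thesis by (rule LIMSEQ_le_const) (use ind[OF that] in auto)
  qed
  \<comment> \<open>For t > T the exponential exp (\<theta> (t - T)) exceeds 1, so this multiple of
    \<open>M\<close> covers the right half-line as well.\<close>
  let ?C = "2 * D + M * exp (- \<theta> * T)"
  have "v t \<le> ?C * exp (\<theta> * t)" for t
  proof (cases "t \<le> T")
    case True
    have "0 \<le> M * exp (- \<theta> * T) * exp (\<theta> * t)" using M_nonneg by simp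
    then show ?thesis using lt[OF True] by (simp add: distrib_right)
  next
    case False
    have "1 \<le> exp (- \<theta> * T) * exp (\<theta> * t)"
      unfolding exp_add[symmetric] using False \<theta> by simp
    then have "M * 1 \<le> M * (exp (- \<theta> * T) * exp (\<theta> * t))" using M_nonneg by (intro mult_left_mono)
    moreover have "0 \<le> 2 * D * exp (\<theta> * t)" using D by simp
    ultimately show ?thesis using v_le[of t] by (simp add: distrib_right mult.assoc)
  qed
  moreover have "?C \<ge> 0" using D M_nonneg by simp
  ultimately show ?thesis unfolding \<theta>_def by blast
qed

text \<open>At minus infinity the integrand is O(exp ((p \<theta> - c) s)) with p \<theta> >
  \<alpha> >= c; at plus infinity boundedness of \<open>v\<close> and c > 0 suffice.\<close>

lemma integrable_exp_v:
  assumes "0 < c" "c \<le> \<alpha>"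
  shows "integrable lborel (\<lambda>s. exp (- c * s) * v s powr p)"
proof -
  define \<theta> where "\<theta> = decay_rate \<alpha> \<beta> p"
  have \<theta>: "0 < \<theta>" "\<alpha> < p * \<theta>" using decay_rate_facts by (auto simp: \<theta>_def)
  obtain C where C: "C \<ge> 0" "\<And>t. v t \<le> C * exp (\<theta> * t)" using v_exp_decay by (auto simp: \<theta>_def)
  have vp: "v s powr p \<le> C powr p * exp (p * \<theta> * s)" for s
  proof -
    have "v s powr p \<le> (C * exp (\<theta> * s)) powr p" using v_nonneg C p by (intro powr_mono2) auto
    also have "\<dots> = C powr p * exp (p * \<theta> * s)" using C by (simp add: powr_mult exp_powr_real mult_ac)
    finally show ?thesis .
  qed
  show ?thesis
  proof (rule Bochner_Integration.integrable_bound)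
    show "integrable lborel (\<lambda>s. C powr p * (indicator {..0} s * exp ((p * \<theta> - c) * s))
        + M powr p * (indicator {0..} s * exp (- c * s)))"
      using has_bochner_integral_exp_atLeast[OF assms(1), of 0]
        has_bochner_integral_exp_atMost[of "p * \<theta> - c" 0] \<theta> assms
      by (intro Bochner_Integration.integrable_add integrable_mult_right) (auto simp: has_bochner_integral_iff)
    show "AE s in lborel. norm (exp (- c * s) * v s powr p) \<le>
      norm (C powr p * (indicator {..0} s * exp ((p * \<theta> - c) * s)) + M powr p * (indicator {0..} s * exp (- c * s)))"
    proof (rule AE_I2)
      fix s
      show "norm (exp (- c * s) * v s powr p) \<le>
      norm (C powr p * (indicator {..0} s * exp ((p * \<theta> - c) * s)) + M powr p * (indicator {0..} s * exp (- c * s)))"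
      proof (cases "s \<le> 0")
        case True
        have "exp (- c * s) * v s powr p \<le> exp (- c * s) * (C powr p * exp (p * \<theta> * s))"
          using vp by (intro mult_left_mono) auto
        also have "\<dots> = C powr p * (exp (- c * s) * exp (p * \<theta> * s))" by (simp only: mult_ac)
        also have "exp (- c * s) * exp (p * \<theta> * s) = exp ((p * \<theta> - c) * s)"
          unfolding exp_add[symmetric] by (simp add: algebra_simps)
        finally show ?thesis using True by (simp add: add_increasing2)
      next
        case False
        have "exp (- c * s) * v s powr p \<le> exp (- c * s) * M powr p"
          using v_powr_le by (intro mult_left_mono) auto
        then show ?thesis using False by (simp add: mult.commute)
      qed
    qed
  qed measurable
qed

definition "P = cb * (\<integral>s. exp (- \<beta> * s) * v s powr p \<partial>lborel)"
definition "Q = ca * (\<integral>s. exp (- \<alpha> * s) * v s powr p \<partial>lborel)"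

lemma volterra_exp_le: "indicator {..t} s * volterra \<alpha> \<beta> (t - s) \<le> ca * exp (\<alpha> * t) * exp (- \<alpha> * s)"
proof (cases "s \<le> t")
  case True
  have "volterra \<alpha> \<beta> (t - s) \<le> ca * exp (\<alpha> * (t - s))"
    using volterra_le[OF \<beta> \<beta>\<alpha>, of "t - s"] True by simp
  also have "exp (\<alpha> * (t - s)) = exp (\<alpha> * t) * exp (- \<alpha> * s)"
    unfolding exp_add[symmetric] by (simp add: algebra_simps)
  finally show ?thesis using True by (simp add: mult.assoc)
next
  case False
  then show ?thesis using ca_pos by simp
qed

lemma volterra_ind_nonneg: "0 \<le> indicator {..t} s * volterra \<alpha> \<beta> (t - s)"
  using volterra_nonneg[OF \<beta> \<beta>\<alpha>, of "t - s"] by (simp add: indicator_def)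

lemma integrable_volterra:
  "integrable lborel (\<lambda>s. indicator {..t} s * volterra \<alpha> \<beta> (t - s) * v s powr p)"
proof (rule Bochner_Integration.integrable_bound)
  show "integrable lborel (\<lambda>s. ca * exp (\<alpha> * t) * (exp (- \<alpha> * s) * v s powr p))"
    using integrable_exp_v[of \<alpha>] \<beta> \<beta>\<alpha> by (intro integrable_mult_right) auto
  show "AE s in lborel. norm (indicator {..t} s * volterra \<alpha> \<beta> (t - s) * v s powr p)
      \<le> norm (ca * exp (\<alpha> * t) * (exp (- \<alpha> * s) * v s powr p))"
  proof (rule AE_I2)
    fix s
    have "indicator {..t} s * volterra \<alpha> \<beta> (t - s) * v s powr p \<le> ca * exp (\<alpha> * t) * exp (- \<alpha> * s) * v s powr p"
      using volterra_exp_le by (intro mult_right_mono) auto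
    moreover have "0 \<le> indicator {..t} s * volterra \<alpha> \<beta> (t - s) * v s powr p"
      by (rule mult_nonneg_nonneg[OF volterra_ind_nonneg]) simp
    ultimately show "norm (indicator {..t} s * volterra \<alpha> \<beta> (t - s) * v s powr p)
      \<le> norm (ca * exp (\<alpha> * t) * (exp (- \<alpha> * s) * v s powr p))"
      unfolding real_norm_def by (simp only: mult.assoc abs_of_nonneg)
  qed
qed measurable

text \<open>\<open>green_eq_volterra\<close> is integrated term by term. The splitting requires the
  three integrals to converge separately, and this is what the decay estimate is for; the \<alpha>
  term is the critical one.\<close>

lemma v_volterra:
  "v t = P * exp (\<beta> * t) - Q * exp (\<alpha> * t)
    + (\<integral>s. indicator {..t} s * volterra \<alpha> \<beta> (t - s) * v s powr p \<partial>lborel)"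
proof -
  let ?b = "\<lambda>s. exp (- \<beta> * s) * v s powr p" and ?a = "\<lambda>s. exp (- \<alpha> * s) * v s powr p"
  let ?k = "\<lambda>s. indicator {..t} s * volterra \<alpha> \<beta> (t - s) * v s powr p"
  have ib: "integrable lborel ?b" and ia: "integrable lborel ?a"
    using integrable_exp_v \<beta> \<beta>\<alpha> by auto
  have "v t = (\<integral>s. (cb * exp (\<beta> * t)) * ?b s - (ca * exp (\<alpha> * t)) * ?a s + ?k s \<partial>lborel)"
    unfolding v_eq[of t]
  proof (rule Bochner_Integration.integral_cong[OF refl])
    fix s
    show "green \<alpha> \<beta> (t - s) * v s powr p = (cb * exp (\<beta> * t)) * ?b s - (ca * exp (\<alpha> * t)) * ?a s + ?k s"
      unfolding green_eq_volterra[OF \<beta> \<beta>\<alpha>] by (simp only: left_diff_distrib distrib_right mult.assoc)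
  qed
  also have "\<dots> = (cb * exp (\<beta> * t)) * (\<integral>s. ?b s \<partial>lborel) - (ca * exp (\<alpha> * t)) * (\<integral>s. ?a s \<partial>lborel) + (\<integral>s. ?k s \<partial>lborel)"
    using ib ia integrable_volterra[of t]
    by (simp only: Bochner_Integration.integral_add Bochner_Integration.integral_diff
        Bochner_Integration.integrable_diff integrable_mult_right integral_mult_right_zero)
  finally show ?thesis unfolding P_def Q_def by (simp only: mult_ac)
qed

end


section \<open>Uniqueness for the integral equation\<close>

text \<open>Matching the coefficient of \<open>exp (\<beta> t)\<close> leaves only \<open>Q\<close> free, and since the
  Volterra kernel is nonnegative the solution is monotone in \<open>- Q\<close>.\<close>

lemma green_solution_comparison:
  assumes v: "green_solution \<alpha> \<beta> p M v" and w: "green_solution \<alpha> \<beta> p M' w"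
    and P: "green_solution.P \<alpha> \<beta> p v = green_solution.P \<alpha> \<beta> p w"
    and Q: "green_solution.Q \<alpha> \<beta> p v \<le> green_solution.Q \<alpha> \<beta> p w"
  shows "w t \<le> v t"
proof -
  interpret v: green_solution \<alpha> \<beta> p M v by (rule v)
  interpret w: green_solution \<alpha> \<beta> p M' w by (rule w)
  define \<theta> where "\<theta> = decay_rate \<alpha> \<beta> p"
  have \<theta>: "0 < \<theta>" using w.decay_rate_facts by (auto simp: \<theta>_def)
  obtain C where C: "C \<ge> 0" "\<And>t. w t \<le> C * exp (\<theta> * t)" using w.v_exp_decay by (auto simp: \<theta>_def)
  define \<gamma> where "\<gamma> = (p - 1) * \<theta>"
  have \<gamma>: "\<gamma> > 0" using \<theta> w.p by (simp add: \<gamma>_def)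
  define c where "c = 1 / (2 * \<alpha> * (\<alpha>\<^sup>2 - \<beta>\<^sup>2))"
  have c: "c > 0" using w.ca_pos by (simp add: c_def)
  \<comment> \<open>The kernel is at most \<open>c * exp (\<alpha> * (t - s))\<close>, and the
    weight \<open>exp (- \<alpha> * t)\<close> turns this growth into a constant. Only the positive
    part of w - v enters because the claim is one-sided.\<close>
  define E where "E t = exp (- \<alpha> * t) * max 0 (w t - v t)" for t
  have E0: "0 \<le> E t" for t by (simp add: E_def)
  have Eexp: "max 0 (w t - v t) = exp (\<alpha> * t) * E t" for t
    by (simp add: E_def exp_add[symmetric] flip: mult.assoc)
  have [measurable]: "E \<in> borel_measurable borel" unfolding E_def by measurable
  let ?k = "\<lambda>t s. indicator {..t} s * volterra \<alpha> \<beta> (t - s)"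
  have k0: "0 \<le> ?k t s" for t s by (rule w.volterra_ind_nonneg)
  have kc: "?k t s \<le> c * exp (\<alpha> * t) * exp (- \<alpha> * s)" for t s
    unfolding c_def by (rule w.volterra_exp_le)
  have diff: "w t - v t = (v.Q - w.Q) * exp (\<alpha> * t)
      + (\<integral>s. ?k t s * w s powr p - ?k t s * v s powr p \<partial>lborel)" for t
    unfolding Bochner_Integration.integral_diff[OF w.integrable_volterra v.integrable_volterra] left_diff_distrib
    using v.v_volterra[of t] w.v_volterra[of t] unfolding P by linarith
  have le0: "w t - v t \<le> (\<integral>s. ?k t s * w s powr p - ?k t s * v s powr p \<partial>lborel)" for t
    unfolding diff[of t] using Q by (simp add: mult_nonpos_nonneg)
  \<comment> \<open>The a priori bound that starts the Gronwall iteration: dropping the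
    \<open>v\<close> term and bounding the kernel by its exponential reproduces the integral that
    defines \<open>w.Q\<close>.\<close>
  have EB: "E t \<le> w.Q" for t
  proof -
    have "w t - v t \<le> (\<integral>s. (c * exp (\<alpha> * t)) * (exp (- \<alpha> * s) * w s powr p) \<partial>lborel)"
    proof (rule order_trans[OF le0 integral_mono_AE'])
      show "integrable lborel (\<lambda>s. (c * exp (\<alpha> * t)) * (exp (- \<alpha> * s) * w s powr p))"
        using w.integrable_exp_v[of \<alpha>] w.\<beta> w.\<beta>\<alpha> by (intro integrable_mult_right) auto
      show "AE s in lborel. ?k t s * w s powr p - ?k t s * v s powr p \<le> (c * exp (\<alpha> * t)) * (exp (- \<alpha> * s) * w s powr p)"
      proof (rule AE_I2)
        fix s
        have "?k t s * w s powr p \<le> (c * exp (\<alpha> * t) * exp (- \<alpha> * s)) * w s powr p"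
          using kc by (intro mult_right_mono) auto
        moreover have "0 \<le> ?k t s * v s powr p" by (rule mult_nonneg_nonneg[OF k0]) simp
        ultimately show "?k t s * w s powr p - ?k t s * v s powr p \<le> (c * exp (\<alpha> * t)) * (exp (- \<alpha> * s) * w s powr p)"
          unfolding mult.assoc by linarith
      qed
      show "AE s in lborel. 0 \<le> (c * exp (\<alpha> * t)) * (exp (- \<alpha> * s) * w s powr p)"
        using c by (intro AE_I2) simp
    qed
    also have "\<dots> = exp (\<alpha> * t) * w.Q" by (simp add: w.Q_def c_def)
    finally have "w t - v t \<le> exp (\<alpha> * t) * w.Q" .
    moreover have "0 \<le> w.Q" unfolding w.Q_def using w.ca_pos
      by (intro mult_nonneg_nonneg integral_nonneg_AE) auto
    ultimately have "max 0 (w t - v t) \<le> exp (\<alpha> * t) * w.Q" by simp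
    then have "exp (\<alpha> * t) * E t \<le> exp (\<alpha> * t) * w.Q" unfolding Eexp .
    then show ?thesis by simp
  qed
  \<comment> \<open>The constant of the linearised inequality: a difference of powers is at most p
    w^(p - 1) (w - v) where w exceeds v, and the decay of \<open>w\<close> contributes C^(p - 1) exp
    (\<gamma> s) with \<gamma> = (p - 1) \<theta>.\<close>
  define D where "D = c * (p * C powr (p - 1))"
  have D: "D \<ge> 0" using c w.p by (simp add: D_def)
  have iE: "integrable lborel (\<lambda>s. indicator {..t} s * (exp (\<gamma> * s) * E s))" for t
  proof -
    have "integrable lborel (\<lambda>s. E s * (indicator {..t} s * exp (\<gamma> * s)))"
      using has_bochner_integral_exp_atMost[OF \<gamma>, of t] EB E0
      by (intro integrable_bounded_mult[where B = w.Q and g = E and f = "\<lambda>s. indicator {..t} s * exp (\<gamma> * s)"])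
        (auto simp: has_bochner_integral_iff abs_of_nonneg)
    then show ?thesis by (simp add: mult_ac)
  qed
  have "E t = 0" for t
  proof (rule gronwall_exp[OF _ E0 EB \<gamma> D])
    fix t
    have "(\<integral>s. ?k t s * w s powr p - ?k t s * v s powr p \<partial>lborel) \<le>
        (\<integral>s. (exp (\<alpha> * t) * D) * (indicator {..t} s * (exp (\<gamma> * s) * E s)) \<partial>lborel)"
    proof (rule integral_mono)
      show "integrable lborel (\<lambda>s. ?k t s * w s powr p - ?k t s * v s powr p)"
        by (intro Bochner_Integration.integrable_diff w.integrable_volterra v.integrable_volterra)
      show "integrable lborel (\<lambda>s. (exp (\<alpha> * t) * D) * (indicator {..t} s * (exp (\<gamma> * s) * E s)))"
        by (intro integrable_mult_right iE)
      fix s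
      have "w s powr p - v s powr p \<le> p * w s powr (p - 1) * max 0 (w s - v s)"
      proof (cases "v s \<le> w s")
        case True
        then show ?thesis using powr_diff_le[OF v.v_nonneg True w.p] by simp
      next
        case False
        then have "w s powr p \<le> v s powr p" using w.v_nonneg w.p by (intro powr_mono2) auto
        then show ?thesis using False by simp
      qed
      also have "\<dots> \<le> p * (C powr (p - 1) * exp (\<gamma> * s)) * max 0 (w s - v s)"
      proof (intro mult_right_mono mult_left_mono)
        have "w s powr (p - 1) \<le> (C * exp (\<theta> * s)) powr (p - 1)"
          using C w.v_nonneg w.p by (intro powr_mono2) auto
        also have "\<dots> = C powr (p - 1) * exp (\<gamma> * s)"
          using C by (simp add: powr_mult exp_powr_real \<gamma>_def mult_ac)
        finally show "w s powr (p - 1) \<le> C powr (p - 1) * exp (\<gamma> * s)" .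
      qed (use w.p in auto)
      finally have f: "w s powr p - v s powr p \<le> p * (C powr (p - 1) * exp (\<gamma> * s)) * (exp (\<alpha> * s) * E s)"
        unfolding Eexp .
      show "?k t s * w s powr p - ?k t s * v s powr p \<le> (exp (\<alpha> * t) * D) * (indicator {..t} s * (exp (\<gamma> * s) * E s))"
      proof (cases "s \<le> t")
        case True
        have "?k t s * (w s powr p - v s powr p) \<le> ?k t s * (p * (C powr (p - 1) * exp (\<gamma> * s)) * (exp (\<alpha> * s) * E s))"
          by (rule mult_left_mono[OF f k0])
        also have "\<dots> \<le> (c * exp (\<alpha> * t) * exp (- \<alpha> * s)) * (p * (C powr (p - 1) * exp (\<gamma> * s)) * (exp (\<alpha> * s) * E s))"
          using E0 w.p by (intro mult_right_mono kc) auto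
        also have "\<dots> = (exp (\<alpha> * t) * D) * (exp (\<gamma> * s) * E s) * (exp (\<alpha> * s) * exp (- \<alpha> * s))"
          unfolding D_def by (simp only: mult_ac)
        also have "exp (\<alpha> * s) * exp (- \<alpha> * s) = 1" by (simp add: exp_add[symmetric])
        finally show ?thesis using True by (simp add: right_diff_distrib)
      qed simp
    qed
    also have "\<dots> = exp (\<alpha> * t) * (D * (\<integral>s. indicator {..t} s * (exp (\<gamma> * s) * E s) \<partial>lborel))"
      by (simp only: integral_mult_right_zero mult.assoc)
    finally have "w t - v t \<le> exp (\<alpha> * t) * (D * (\<integral>s. indicator {..t} s * (exp (\<gamma> * s) * E s) \<partial>lborel))"
      using le0[of t] by linarith
    moreover have "0 \<le> D * (\<integral>s. indicator {..t} s * (exp (\<gamma> * s) * E s) \<partial>lborel)"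
      using D E0 by (intro mult_nonneg_nonneg integral_nonneg_AE) auto
    ultimately have "max 0 (w t - v t) \<le> exp (\<alpha> * t) * (D * (\<integral>s. indicator {..t} s * (exp (\<gamma> * s) * E s) \<partial>lborel))"
      by simp
    then show "E t \<le> D * (\<integral>s. indicator {..t} s * (exp (\<gamma> * s) * E s) \<partial>lborel)"
      unfolding Eexp by simp
  qed measurable
  then have "max 0 (w t - v t) = 0" unfolding Eexp by simp
  then show ?thesis by linarith
qed

lemma green_solution_unique:
  assumes v: "green_solution \<alpha> \<beta> p M v" and w: "green_solution \<alpha> \<beta> p M' w"
    and P: "green_solution.P \<alpha> \<beta> p v = green_solution.P \<alpha> \<beta> p w"
  shows "v = w"
proof -
  \<comment> \<open>Proved for fresh \<open>v\<close> and \<open>w\<close>, so that exchanging them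
    gives equality of the two constants.\<close>
  have Qle: "green_solution.Q \<alpha> \<beta> p w \<le> green_solution.Q \<alpha> \<beta> p v"
    if v: "green_solution \<alpha> \<beta> p M v" and w: "green_solution \<alpha> \<beta> p M' w"
    and P: "green_solution.P \<alpha> \<beta> p v = green_solution.P \<alpha> \<beta> p w" for v w M M'
  proof (rule ccontr)
    interpret v: green_solution \<alpha> \<beta> p M v by (rule v)
    interpret w: green_solution \<alpha> \<beta> p M' w by (rule w)
    assume "\<not> w.Q \<le> v.Q"
    then have Q: "v.Q < w.Q" by simp
    have wv: "w t \<le> v t" for t
      using green_solution_comparison[OF v w P] Q by simp
    have "(w.Q - v.Q) * exp (\<alpha> * t) \<le> M" for t
    proof -
      let ?k = "\<lambda>s. indicator {..t} s * volterra \<alpha> \<beta> (t - s)"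
      have "(\<integral>s. ?k s * w s powr p \<partial>lborel) \<le> (\<integral>s. ?k s * v s powr p \<partial>lborel)"
      proof (rule integral_mono[OF w.integrable_volterra v.integrable_volterra])
        fix s
        have "w s powr p \<le> v s powr p" using wv w.v_nonneg w.p by (intro powr_mono2) auto
        then show "?k s * w s powr p \<le> ?k s * v s powr p"
          by (rule mult_left_mono[OF _ w.volterra_ind_nonneg])
      qed
      then have "(w.Q - v.Q) * exp (\<alpha> * t) \<le> v t - w t"
        using v.v_volterra[of t] w.v_volterra[of t] P by (simp add: algebra_simps)
      then show ?thesis using v.v_le[of t] w.v_nonneg[of t] by linarith
    qed
    \<comment> \<open>At this time the left side equals M + 1.\<close>
    from this[of "ln ((M + 1) / (w.Q - v.Q)) / \<alpha>"]
    show False using Q v.M_nonneg v.\<beta> v.\<beta>\<alpha> by simp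
  qed
  have "green_solution.Q \<alpha> \<beta> p v = green_solution.Q \<alpha> \<beta> p w"
    using Qle[OF v w P] Qle[OF w v P[symmetric]] by simp
  then show ?thesis
    using green_solution_comparison[OF v w P] green_solution_comparison[OF w v P[symmetric]]
    by (intro ext antisym) auto
qed


section \<open>From the weak equation to the integral equation\<close>

lemma DERIV_integral_atMost:
  fixes q :: "real \<Rightarrow> real"
  assumes c: "continuous_on UNIV q" and T: "\<And>s. T \<le> \<bar>s\<bar> \<Longrightarrow> q s = 0"
  shows "((\<lambda>t. \<integral>s. indicator {..t} s * q s \<partial>lborel) has_real_derivative q t) (at t)"
proof -
  \<comment> \<open>Outside [-R, R] the function vanishes and t is interior to this interval, so the
    integral from minus infinity becomes a proper one.\<close>
  define R where "R = \<bar>t\<bar> + \<bar>T\<bar> + 1"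
  have eq: "(\<integral>s. indicator {..x} s * q s \<partial>lborel) = integral {-R..x} q" if "x \<in> {-R<..<R}" for x
  proof -
    have "(\<integral>s. indicator {..x} s * q s \<partial>lborel) = (\<integral>s. indicator {-R..x} s *\<^sub>R q s \<partial>lborel)"
    proof (rule Bochner_Integration.integral_cong[OF refl])
      fix s show "indicator {..x} s * q s = indicator {-R..x} s *\<^sub>R q s"
        using T[of s] by (cases "s < - R") (auto simp: R_def indicator_def)
    qed
    also have "\<dots> = integral {-R..x} q"
      using set_borel_integral_eq_integral(2)[of "{-R..x}" q]
        borel_integrable_atLeastAtMost'[OF continuous_on_subset[OF c], of "-R" x]
      by (simp add: set_lebesgue_integral_def)
    finally show ?thesis .
  qed
  have t: "t \<in> {-R<..<R}" by (auto simp: R_def)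
  have "((\<lambda>x. integral {-R..x} q) has_real_derivative q t) (at t within {-R..R})"
    using t by (intro integral_has_real_derivative continuous_on_subset[OF c]) auto
  then have "((\<lambda>x. integral {-R..x} q) has_real_derivative q t) (at t)"
    using t at_within_interior[of t "{-R..R}"] by simp
  then show ?thesis
    by (rule DERIV_transform_nhds)
      (rule eventually_mono[OF eventually_nhds_in_open[OF _ t]], auto simp: eq)
qed

lemma test_real_support:
  assumes "test_real \<eta>"
  obtains T where "\<And>s. T \<le> \<bar>s\<bar> \<Longrightarrow> \<eta> s = 0"
  using assms by (auto simp: test_real_def)

lemma test_real_borel: "test_real \<eta> \<Longrightarrow> \<eta> \<in> borel_measurable borel"
  by (intro smooth_real_borel test_real_smooth)

lemma test_real_exp_bound:
  assumes "test_real \<eta>"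
  obtains B where "\<And>t. \<bar>\<eta> t\<bar> \<le> B * exp (- c * \<bar>t\<bar>)" "B \<ge> 0"
proof -
  obtain T where T: "\<And>s. T \<le> \<bar>s\<bar> \<Longrightarrow> \<eta> s = 0" using test_real_support[OF assms] by blast
  obtain B where B: "\<And>t. \<bar>\<eta> t\<bar> \<le> B" "B \<ge> 0" using test_real_bounded[OF assms] by blast
  have "\<bar>\<eta> t\<bar> \<le> (B * exp (\<bar>c\<bar> * \<bar>T\<bar>)) * exp (- c * \<bar>t\<bar>)" for t
  proof (cases "T \<le> \<bar>t\<bar>")
    case True
    then show ?thesis using T B by simp
  next
    case False
    have "c * \<bar>t\<bar> \<le> \<bar>c\<bar> * \<bar>T\<bar>" using False by (intro mult_mono) auto
    then have "1 \<le> exp (\<bar>c\<bar> * \<bar>T\<bar>) * exp (- c * \<bar>t\<bar>)" unfolding exp_add[symmetric] by simp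
    then have "B * 1 \<le> B * (exp (\<bar>c\<bar> * \<bar>T\<bar>) * exp (- c * \<bar>t\<bar>))" using B by (intro mult_left_mono)
    then show ?thesis using B(1)[of t] by (simp add: mult.assoc)
  qed
  then show ?thesis using that[of "B * exp (\<bar>c\<bar> * \<bar>T\<bar>)"] B by simp
qed

lemma integrable_test_real_mult:
  assumes "test_real \<eta>" "continuous_on UNIV g"
  shows "integrable lborel (\<lambda>s. g s * \<eta> s)"
proof -
  obtain T where T: "\<And>s. T \<le> \<bar>s\<bar> \<Longrightarrow> \<eta> s = 0" using test_real_support[OF assms(1)] by blast
  have "continuous_on UNIV (\<lambda>s. g s * \<eta> s)"
    by (rule continuous_on_mult[OF assms(2) smooth_real_continuous[OF test_real_smooth[OF assms(1)]]])
  then show ?thesis by (rule integrable_continuous_compact_support[of _ T]) (simp add: T)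
qed

lemma dominatedI: "(\<And>t. \<bar>f t\<bar> \<le> C * y t) \<Longrightarrow> dominated y f"
  unfolding dominated_def by blast

text \<open>Divided by 2 c this solves c^2 y - y'' = \<eta>; the normalisation is left to
  \<open>green_conv\<close>.\<close>

definition exp_conv :: "real \<Rightarrow> (real \<Rightarrow> real) \<Rightarrow> real \<Rightarrow> real" where
  "exp_conv c \<eta> t = (\<integral>s. exp (- c * \<bar>t - s\<bar>) * \<eta> s \<partial>lborel)"

text \<open>The convolution is split at s = t into exp (- c t) A + exp (c t) B, with A and B
  integrals over the two half-lines. The boundary terms + \<eta> and - \<eta> cancel in the first
  derivative and add up to - 2 c \<eta> in the second.\<close>

lemma exp_conv_facts:
  assumes \<eta>: "test_real \<eta>" and c: "c > 0"
  obtains K1 where "\<And>t. (exp_conv c \<eta> has_real_derivative K1 t) (at t)"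
    and "\<And>t. (K1 has_real_derivative c\<^sup>2 * exp_conv c \<eta> t - 2 * c * \<eta> t) (at t)"
    and "dominated (\<lambda>t. exp (- c * \<bar>t\<bar>)) (exp_conv c \<eta>)" and "dominated (\<lambda>t. exp (- c * \<bar>t\<bar>)) K1"
proof -
  obtain T where T: "\<And>s. T \<le> \<bar>s\<bar> \<Longrightarrow> \<eta> s = 0" using test_real_support[OF \<eta>] by blast
  have c\<eta>: "continuous_on UNIV \<eta>" by (intro smooth_real_continuous test_real_smooth \<eta>)
  have i: "integrable lborel (\<lambda>s. exp (d * s) * \<eta> s)" for d
    by (intro integrable_test_real_mult \<eta> continuous_intros)
  have ii: "integrable lborel (\<lambda>s. indicator A s * (exp (d * s) * \<eta> s))" if "A \<in> sets borel" for d A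
    using that by (intro integrable_bounded_mult[OF i, of _ 1]) (auto simp: indicator_def)
  define A where "A t = (\<integral>s. indicator {..t} s * (exp (c * s) * \<eta> s) \<partial>lborel)" for t
  define B where "B t = (\<integral>s. exp (- c * s) * \<eta> s \<partial>lborel) - (\<integral>s. indicator {..t} s * (exp (- c * s) * \<eta> s) \<partial>lborel)" for t
  have dA: "(A has_real_derivative exp (c * t) * \<eta> t) (at t)" for t
    unfolding A_def by (rule DERIV_integral_atMost[of _ T]) (auto intro!: continuous_intros c\<eta> simp: T)
  have dB: "(B has_real_derivative - (exp (- c * t) * \<eta> t)) (at t)" for t
  proof -
    have "((\<lambda>t. \<integral>s. indicator {..t} s * (exp (- c * s) * \<eta> s) \<partial>lborel) has_real_derivative exp (- c * t) * \<eta> t) (at t)"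
      by (rule DERIV_integral_atMost[of _ T]) (auto intro!: continuous_intros c\<eta> simp: T)
    from DERIV_diff[OF DERIV_const this] show ?thesis unfolding B_def by simp
  qed
  have Beq: "B t = (\<integral>s. indicator {t<..} s * (exp (- c * s) * \<eta> s) \<partial>lborel)" for t
  proof -
    have "B t = (\<integral>s. exp (- c * s) * \<eta> s - indicator {..t} s * (exp (- c * s) * \<eta> s) \<partial>lborel)"
      unfolding B_def by (intro Bochner_Integration.integral_diff[symmetric] i ii) auto
    also have "\<dots> = (\<integral>s. indicator {t<..} s * (exp (- c * s) * \<eta> s) \<partial>lborel)"
      by (intro Bochner_Integration.integral_cong) (auto simp: indicator_def)
    finally show ?thesis .
  qed
  have K: "exp_conv c \<eta> t = exp (- c * t) * A t + exp (c * t) * B t" for t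
  proof -
    have "exp_conv c \<eta> t = (\<integral>s. exp (- c * t) * (indicator {..t} s * (exp (c * s) * \<eta> s))
        + exp (c * t) * (indicator {t<..} s * (exp (- c * s) * \<eta> s)) \<partial>lborel)"
      unfolding exp_conv_def
    proof (rule Bochner_Integration.integral_cong[OF refl])
      fix s
      have "exp (- c * \<bar>t - s\<bar>) = (if s \<le> t then exp (- c * t) * exp (c * s) else exp (c * t) * exp (- c * s))"
        unfolding exp_add[symmetric] by (auto simp: algebra_simps)
      then show "exp (- c * \<bar>t - s\<bar>) * \<eta> s = exp (- c * t) * (indicator {..t} s * (exp (c * s) * \<eta> s))
        + exp (c * t) * (indicator {t<..} s * (exp (- c * s) * \<eta> s))" by (auto simp: indicator_def)
    qed
    also have "\<dots> = exp (- c * t) * A t + exp (c * t) * B t"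
      unfolding A_def Beq
      by (subst Bochner_Integration.integral_add[OF integrable_mult_right[OF ii] integrable_mult_right[OF ii]]) simp_all
    finally show ?thesis .
  qed
  let ?K1 = "\<lambda>t. c * (exp (c * t) * B t - exp (- c * t) * A t)"
  have ex: "exp (c * t) * exp (- c * t) = 1" for t by (simp add: exp_add[symmetric])
  have d1: "((\<lambda>t. exp (- c * t) * A t) has_real_derivative - c * (exp (- c * t) * A t) + \<eta> t) (at t)" for t
  proof -
    have "((\<lambda>t. exp (- c * t)) has_real_derivative - c * exp (- c * t)) (at t)"
      by (auto intro!: derivative_eq_intros)
    from DERIV_mult[OF this dA[of t]]
    have "((\<lambda>t. exp (- c * t) * A t) has_real_derivative - c * exp (- c * t) * A t + exp (c * t) * \<eta> t * exp (- c * t)) (at t)" .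
    moreover have "exp (c * t) * \<eta> t * exp (- c * t) = (exp (c * t) * exp (- c * t)) * \<eta> t" by (simp only: mult_ac)
    ultimately show ?thesis by (simp only: ex mult.assoc mult_1)
  qed
  have d2: "((\<lambda>t. exp (c * t) * B t) has_real_derivative c * (exp (c * t) * B t) - \<eta> t) (at t)" for t
  proof -
    have "((\<lambda>t. exp (c * t)) has_real_derivative c * exp (c * t)) (at t)"
      by (auto intro!: derivative_eq_intros)
    from DERIV_mult[OF this dB[of t]]
    have "((\<lambda>t. exp (c * t) * B t) has_real_derivative c * exp (c * t) * B t + - (exp (- c * t) * \<eta> t) * exp (c * t)) (at t)" .
    moreover have "- (exp (- c * t) * \<eta> t) * exp (c * t) = - ((exp (c * t) * exp (- c * t)) * \<eta> t)"
      by (simp add: mult.commute mult.left_commute)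
    ultimately show ?thesis by (simp only: ex mult.assoc mult_1 add_uminus_conv_diff)
  qed
  have K': "exp_conv c \<eta> = (\<lambda>t. exp (- c * t) * A t + exp (c * t) * B t)" using K by auto
  have r1: "(exp_conv c \<eta> has_real_derivative ?K1 t) (at t)" for t
    unfolding K' using DERIV_add[OF d1[of t] d2[of t]] by (simp add: algebra_simps)
  have r2: "(?K1 has_real_derivative c\<^sup>2 * exp_conv c \<eta> t - 2 * c * \<eta> t) (at t)" for t
    unfolding K using DERIV_cmult[OF DERIV_diff[OF d2[of t] d1[of t]], of c] by (simp add: algebra_simps power2_eq_square)
  let ?C = "\<integral>s. exp (c * \<bar>s\<bar>) * \<bar>\<eta> s\<bar> \<partial>lborel"
  \<comment> \<open>The triangle inequality gives exp (- c |t - s|) <= exp (c |s|) exp (- c |t|).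
    Stating the bound for any \<open>g\<close> below the kernel covers the convolution and its two
    halves alike.\<close>
  have le: "\<bar>\<integral>s. g s * \<eta> s \<partial>lborel\<bar> \<le> (\<integral>s. exp (c * \<bar>s\<bar>) * \<bar>\<eta> s\<bar> \<partial>lborel) * exp (- c * \<bar>t\<bar>)"
    if g: "\<And>s. \<bar>g s\<bar> \<le> exp (- c * \<bar>t - s\<bar>)" for g t
  proof -
    have "\<bar>\<integral>s. g s * \<eta> s \<partial>lborel\<bar> \<le> (\<integral>s. \<bar>g s * \<eta> s\<bar> \<partial>lborel)" by (rule integral_abs_bound)
    also have "\<dots> \<le> (\<integral>s. (exp (c * \<bar>s\<bar>) * \<bar>\<eta> s\<bar>) * exp (- c * \<bar>t\<bar>) \<partial>lborel)"
    proof (rule integral_mono_AE')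
      have "integrable lborel (\<lambda>s. \<bar>exp (c * \<bar>s\<bar>) * \<eta> s\<bar>)"
        by (intro integrable_abs integrable_test_real_mult \<eta> continuous_intros)
      then show "integrable lborel (\<lambda>s. (exp (c * \<bar>s\<bar>) * \<bar>\<eta> s\<bar>) * exp (- c * \<bar>t\<bar>))"
        by (intro integrable_mult_left) (simp add: abs_mult)
      show "AE s in lborel. \<bar>g s * \<eta> s\<bar> \<le> (exp (c * \<bar>s\<bar>) * \<bar>\<eta> s\<bar>) * exp (- c * \<bar>t\<bar>)"
      proof (rule AE_I2)
        fix s
        have "\<bar>t\<bar> \<le> \<bar>t - s\<bar> + \<bar>s\<bar>" by linarith
        then have "c * \<bar>t\<bar> \<le> c * \<bar>t - s\<bar> + c * \<bar>s\<bar>" using c by (simp add: distrib_left[symmetric])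
        then have "exp (- c * \<bar>t - s\<bar>) \<le> exp (c * \<bar>s\<bar>) * exp (- c * \<bar>t\<bar>)" unfolding exp_add[symmetric] by simp
        with g[of s] have "\<bar>g s\<bar> \<le> exp (c * \<bar>s\<bar>) * exp (- c * \<bar>t\<bar>)" by linarith
        then have "\<bar>g s\<bar> * \<bar>\<eta> s\<bar> \<le> exp (c * \<bar>s\<bar>) * exp (- c * \<bar>t\<bar>) * \<bar>\<eta> s\<bar>" by (intro mult_right_mono) auto
        then show "\<bar>g s * \<eta> s\<bar> \<le> (exp (c * \<bar>s\<bar>) * \<bar>\<eta> s\<bar>) * exp (- c * \<bar>t\<bar>)"
          by (simp only: abs_mult mult_ac)
      qed
    qed auto
    finally show ?thesis by simp
  qed
  have r3: "dominated (\<lambda>t. exp (- c * \<bar>t\<bar>)) (exp_conv c \<eta>)"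
    unfolding exp_conv_def by (rule dominatedI[of _ ?C]) (rule le, simp)
  have r4: "dominated (\<lambda>t. exp (- c * \<bar>t\<bar>)) ?K1"
  proof (intro dominated_cmult dominated_diff)
    have "exp (c * t) * B t = (\<integral>s. (indicator {t<..} s * (exp (c * t) * exp (- c * s))) * \<eta> s \<partial>lborel)" for t
      unfolding Beq integral_mult_right_zero[symmetric] by (simp only: mult_ac)
    moreover have "\<bar>indicator {t<..} s * (exp (c * t) * exp (- c * s))\<bar> \<le> exp (- c * \<bar>t - s\<bar>)" for t s
      unfolding exp_add[symmetric] by (auto simp: indicator_def algebra_simps)
    ultimately show "dominated (\<lambda>t. exp (- c * \<bar>t\<bar>)) (\<lambda>t. exp (c * t) * B t)"
      by (intro dominatedI[of _ ?C]) (simp only: le)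
    have "exp (- c * t) * A t = (\<integral>s. (indicator {..t} s * (exp (- c * t) * exp (c * s))) * \<eta> s \<partial>lborel)" for t
      unfolding A_def integral_mult_right_zero[symmetric] by (simp only: mult_ac)
    moreover have "\<bar>indicator {..t} s * (exp (- c * t) * exp (c * s))\<bar> \<le> exp (- c * \<bar>t - s\<bar>)" for t s
      unfolding exp_add[symmetric] by (auto simp: indicator_def algebra_simps)
    ultimately show "dominated (\<lambda>t. exp (- c * \<bar>t\<bar>)) (\<lambda>t. exp (- c * t) * A t)"
      by (intro dominatedI[of _ ?C]) (simp only: le)
  qed
  show thesis by (rule that[OF r1 r2 r3 r4])
qed

text \<open>The convolution and its derivative \<open>K1\<close> go through the induction together:
  the second-order equation expresses the derivative of \<open>K1\<close> by the convolution and
  \<eta>, so each gains an order from the other.\<close>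

lemma smooth_exp_conv:
  assumes \<eta>: "test_real \<eta>" and c: "c > 0"
  shows "smooth_real (exp_conv c \<eta>)"
proof -
  obtain K1 where K1: "\<And>t. (exp_conv c \<eta> has_real_derivative K1 t) (at t)"
    "\<And>t. (K1 has_real_derivative c\<^sup>2 * exp_conv c \<eta> t - 2 * c * \<eta> t) (at t)"
    "dominated (\<lambda>t. exp (- c * \<bar>t\<bar>)) (exp_conv c \<eta>)" "dominated (\<lambda>t. exp (- c * \<bar>t\<bar>)) K1"
    by (rule exp_conv_facts[OF assms], rule that)
  have "Ck_real k (exp_conv c \<eta>) \<and> Ck_real k K1" for k
  proof (induction k)
    case 0
    then show ?case using continuous_on_of_DERIV[OF K1(1)] continuous_on_of_DERIV[OF K1(2)] by simp
  next
    case (Suc k)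
    have "Ck_real k \<eta>" using \<eta> by (simp add: test_real_def smooth_real_def)
    then have "Ck_real k (\<lambda>t. c\<^sup>2 * exp_conv c \<eta> t + (- 2 * c) * \<eta> t)"
      using Suc by (intro Ck_real_add Ck_real_mult Ck_real_const) auto
    then have "Ck_real k (\<lambda>t. c\<^sup>2 * exp_conv c \<eta> t - 2 * c * \<eta> t)" by simp
    then show ?case using Suc Ck_real_SucI[OF K1(1)] Ck_real_SucI[OF K1(2)] by blast
  qed
  then show ?thesis by (simp add: smooth_real_def)
qed


section \<open>Cutoffs and testing with Green convolutions\<close>

lemma dominated_weaken:
  assumes "dominated y f" "\<And>t. 0 \<le> y t" "\<And>t. y t \<le> z t"
  shows "dominated z f"
proof -
  obtain C where C: "\<And>t. \<bar>f t\<bar> \<le> C * y t" using assms(1) by (auto simp: dominated_def)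
  have "\<bar>f t\<bar> \<le> \<bar>C\<bar> * z t" for t
  proof -
    have "C * y t \<le> \<bar>C\<bar> * z t" using assms(2,3)[of t] by (intro mult_mono) auto
    then show ?thesis using C[of t] by linarith
  qed
  then show ?thesis by (rule dominatedI)
qed

lemma deriv_chain:
  assumes "\<And>t. (f has_real_derivative f1 t) (at t)" "\<And>t. (f1 has_real_derivative f2 t) (at t)"
    "\<And>t. (f2 has_real_derivative f3 t) (at t)" "\<And>t. (f3 has_real_derivative f4 t) (at t)"
  shows "deriv (deriv f) = f2" "deriv (deriv (deriv (deriv f))) = f4"
proof -
  have "deriv f = f1" "deriv f1 = f2" "deriv f2 = f3" "deriv f3 = f4"
    using assms by (auto intro!: ext DERIV_imp_deriv)
  then show "deriv (deriv f) = f2" "deriv (deriv (deriv (deriv f))) = f4" by simp_all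
qed

lemma deriv_mult_chain:
  assumes f: "\<And>t. (f0 has_real_derivative f1 t) (at t)" "\<And>t. (f1 has_real_derivative f2 t) (at t)"
    "\<And>t. (f2 has_real_derivative f3 t) (at t)" "\<And>t. (f3 has_real_derivative f4 t) (at t)"
    and g: "\<And>t. (g0 has_real_derivative g1 t) (at t)" "\<And>t. (g1 has_real_derivative g2 t) (at t)"
    "\<And>t. (g2 has_real_derivative g3 t) (at t)" "\<And>t. (g3 has_real_derivative g4 t) (at t)"
  shows "deriv (deriv (\<lambda>t. f0 t * g0 t)) = (\<lambda>t. f2 t * g0 t + 2 * f1 t * g1 t + f0 t * g2 t)"
    and "deriv (deriv (deriv (deriv (\<lambda>t. f0 t * g0 t)))) =
      (\<lambda>t. f4 t * g0 t + 4 * f3 t * g1 t + 6 * f2 t * g2 t + 4 * f1 t * g3 t + f0 t * g4 t)"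
proof -
  have d0: "((\<lambda>t. f0 t * g0 t) has_real_derivative f1 t * g0 t + f0 t * g1 t) (at t)" for t
    using DERIV_mult[OF f(1) g(1), of t] by (simp add: mult.commute)
  have d1: "((\<lambda>t. f1 t * g0 t + f0 t * g1 t) has_real_derivative
      f2 t * g0 t + 2 * f1 t * g1 t + f0 t * g2 t) (at t)" for t
    using DERIV_add[OF DERIV_mult[OF f(2) g(1), of t] DERIV_mult[OF f(1) g(2), of t]]
    by (simp add: algebra_simps)
  have d2: "((\<lambda>t. f2 t * g0 t + 2 * f1 t * g1 t + f0 t * g2 t) has_real_derivative
      f3 t * g0 t + 3 * f2 t * g1 t + 3 * f1 t * g2 t + f0 t * g3 t) (at t)" for t
    using DERIV_add[OF DERIV_add[OF DERIV_mult[OF f(3) g(1), of t]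
          DERIV_cmult[OF DERIV_mult[OF f(2) g(2), of t], of 2]] DERIV_mult[OF f(1) g(3), of t]]
    by (simp add: algebra_simps)
  have d3: "((\<lambda>t. f3 t * g0 t + 3 * f2 t * g1 t + 3 * f1 t * g2 t + f0 t * g3 t) has_real_derivative
      f4 t * g0 t + 4 * f3 t * g1 t + 6 * f2 t * g2 t + 4 * f1 t * g3 t + f0 t * g4 t) (at t)" for t
    using DERIV_add[OF DERIV_add[OF DERIV_add[OF DERIV_mult[OF f(4) g(1), of t]
          DERIV_cmult[OF DERIV_mult[OF f(3) g(2), of t], of 3]]
          DERIV_cmult[OF DERIV_mult[OF f(2) g(3), of t], of 3]] DERIV_mult[OF f(1) g(4), of t]]
    by (simp add: algebra_simps)
  show "deriv (deriv (\<lambda>t. f0 t * g0 t)) = (\<lambda>t. f2 t * g0 t + 2 * f1 t * g1 t + f0 t * g2 t)"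
    "deriv (deriv (deriv (deriv (\<lambda>t. f0 t * g0 t)))) =
      (\<lambda>t. f4 t * g0 t + 4 * f3 t * g1 t + 6 * f2 t * g2 t + 4 * f1 t * g3 t + f0 t * g4 t)"
    by (rule deriv_chain[OF d0 d1 d2 d3])+
qed

text \<open>Equal to 1 on [-1, 1] and to 0 outside (-2, 2); both factors have the affine form that
  \<open>smooth_real_affine\<close> expects.\<close>

definition plateau :: "real \<Rightarrow> real" where
  "plateau t = smooth_step (1 * t + 2) * smooth_step (- 1 * t + 2)"

lemma test_real_plateau: "test_real plateau"
  unfolding test_real_def
proof (intro conjI exI[of _ 2] allI impI)
  show "smooth_real plateau" unfolding plateau_def[abs_def]
    by (intro smooth_real_mult smooth_real_affine smooth_smooth_step)
  fix t :: real assume "2 \<le> \<bar>t\<bar>"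
  then show "plateau t = 0" by (auto simp: plateau_def abs_if smooth_step_eq_0 split: if_splits)
qed

lemma plateau_0: "plateau 0 = 1"
  by (simp add: plateau_def smooth_step_eq_1)

lemma plateau_bounds: "0 \<le> plateau t" "plateau t \<le> 1"
  using smooth_step_bounds by (auto simp: plateau_def intro!: mult_le_one)

definition green_conv :: "real \<Rightarrow> real \<Rightarrow> (real \<Rightarrow> real) \<Rightarrow> real \<Rightarrow> real" where
  "green_conv \<alpha> \<beta> \<eta> t = (exp_conv \<beta> \<eta> t / (2 * \<beta>) - exp_conv \<alpha> \<eta> t / (2 * \<alpha>)) / (\<alpha>\<^sup>2 - \<beta>\<^sup>2)"

text \<open>The convolution \<open>green_conv \<alpha> \<beta> \<eta>\<close> solves \<open>L \<psi> = \<eta>\<close> and decays exponentially,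
  so after a cutoff it is admissible as a test function.\<close>

lemma weak_equation_green:
  fixes w f F :: "real \<Rightarrow> real"
  assumes \<beta>: "0 < \<beta>" and \<beta>\<alpha>: "\<beta> < \<alpha>"
    and w [measurable]: "w \<in> borel_measurable borel" and w2: "integrable lborel (\<lambda>t. (w t)\<^sup>2)"
    and f [measurable]: "f \<in> borel_measurable borel" and f0: "\<And>t. 0 \<le> f t"
    and F: "integrable lborel F" "\<And>t. f t \<le> 1 + F t" "\<And>t. 0 \<le> F t"
    and weak: "\<And>\<psi>. test_real \<psi> \<Longrightarrow>
      (\<integral>t. w t * (deriv (deriv (deriv (deriv \<psi>))) t - (\<alpha>\<^sup>2 + \<beta>\<^sup>2) * deriv (deriv \<psi>) t + \<alpha>\<^sup>2 * \<beta>\<^sup>2 * \<psi> t) \<partial>lborel)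
      = (\<integral>t. f t * \<psi> t \<partial>lborel)"
    and \<eta>: "test_real \<eta>"
  shows "(\<integral>t. w t * \<eta> t \<partial>lborel) = (\<integral>t. f t * green_conv \<alpha> \<beta> \<eta> t \<partial>lborel)"
proof -
  define D where "D = \<alpha>\<^sup>2 - \<beta>\<^sup>2"
  have D: "D > 0" using sq_diff_pos[OF \<beta> \<beta>\<alpha>] by (simp add: D_def)
  have \<alpha>: "\<alpha> > 0" using \<beta> \<beta>\<alpha> by simp
  define A where "A = exp_conv \<alpha> \<eta>"
  define B where "B = exp_conv \<beta> \<eta>"
  obtain A1 where A1: "\<And>t. (A has_real_derivative A1 t) (at t)"
    "\<And>t. (A1 has_real_derivative \<alpha>\<^sup>2 * A t - 2 * \<alpha> * \<eta> t) (at t)"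
    "dominated (\<lambda>t. exp (- \<alpha> * \<bar>t\<bar>)) A" "dominated (\<lambda>t. exp (- \<alpha> * \<bar>t\<bar>)) A1"
    by (rule exp_conv_facts[OF \<eta> \<alpha>, folded A_def], rule that)
  obtain B1 where B1: "\<And>t. (B has_real_derivative B1 t) (at t)"
    "\<And>t. (B1 has_real_derivative \<beta>\<^sup>2 * B t - 2 * \<beta> * \<eta> t) (at t)"
    "dominated (\<lambda>t. exp (- \<beta> * \<bar>t\<bar>)) B" "dominated (\<lambda>t. exp (- \<beta> * \<bar>t\<bar>)) B1"
    by (rule exp_conv_facts[OF \<eta> \<beta>, folded B_def], rule that)
  let ?e = "\<lambda>t. exp (- \<beta> * \<bar>t\<bar>)"
  have ae: "exp (- \<alpha> * \<bar>t\<bar>) \<le> ?e t" for t using \<beta>\<alpha> by (simp add: mult_right_mono)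
  have dA: "dominated ?e A" "dominated ?e A1"
    using dominated_weaken[OF A1(3) _ ae] dominated_weaken[OF A1(4) _ ae] by auto
  define s0 where "s0 t = 1 / (2 * \<beta> * D) * B t - 1 / (2 * \<alpha> * D) * A t" for t
  define s1 where "s1 t = 1 / (2 * \<beta> * D) * B1 t - 1 / (2 * \<alpha> * D) * A1 t" for t
  \<comment> \<open>The \<eta> terms of the two convolutions cancel in the second derivative, so no
    derivative of \<eta> appears in the chain; in \<open>s4\<close> they return with the coefficient
    (\<alpha>^2 - \<beta>^2) / D = 1.\<close>
  define s2 where "s2 t = \<beta>\<^sup>2 / (2 * \<beta> * D) * B t - \<alpha>\<^sup>2 / (2 * \<alpha> * D) * A t" for t
  define s3 where "s3 t = \<beta>\<^sup>2 / (2 * \<beta> * D) * B1 t - \<alpha>\<^sup>2 / (2 * \<alpha> * D) * A1 t" for t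
  define s4 where "s4 t = \<beta>\<^sup>2 / (2 * \<beta> * D) * (\<beta>\<^sup>2 * B t - 2 * \<beta> * \<eta> t)
      - \<alpha>\<^sup>2 / (2 * \<alpha> * D) * (\<alpha>\<^sup>2 * A t - 2 * \<alpha> * \<eta> t)" for t
  have ds0: "(s0 has_real_derivative s1 t) (at t)" for t
    unfolding s0_def s1_def by (intro DERIV_diff DERIV_cmult A1 B1)
  have ds1: "(s1 has_real_derivative s2 t) (at t)" for t
  proof -
    have "(s1 has_real_derivative 1 / (2 * \<beta> * D) * (\<beta>\<^sup>2 * B t - 2 * \<beta> * \<eta> t)
        - 1 / (2 * \<alpha> * D) * (\<alpha>\<^sup>2 * A t - 2 * \<alpha> * \<eta> t)) (at t)"
      unfolding s1_def by (intro DERIV_diff DERIV_cmult A1 B1)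
    moreover have "1 / (2 * \<beta> * D) * (\<beta>\<^sup>2 * B t - 2 * \<beta> * \<eta> t) - 1 / (2 * \<alpha> * D) * (\<alpha>\<^sup>2 * A t - 2 * \<alpha> * \<eta> t) = s2 t"
      using \<alpha> \<beta> D unfolding s2_def by (simp add: right_diff_distrib)
    ultimately show ?thesis by simp
  qed
  have ds2: "(s2 has_real_derivative s3 t) (at t)" for t
    unfolding s2_def s3_def by (intro DERIV_diff DERIV_cmult A1 B1)
  have ds3: "(s3 has_real_derivative s4 t) (at t)" for t
    unfolding s3_def s4_def by (intro DERIV_diff DERIV_cmult A1 B1)
  have L: "s4 t - (\<alpha>\<^sup>2 + \<beta>\<^sup>2) * s2 t + \<alpha>\<^sup>2 * \<beta>\<^sup>2 * s0 t = \<eta> t" for t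
  proof -
    have "s4 t = \<beta>\<^sup>2 / (2 * \<beta> * D) * \<beta>\<^sup>2 * B t - \<alpha>\<^sup>2 / (2 * \<alpha> * D) * \<alpha>\<^sup>2 * A t + (\<alpha>\<^sup>2 - \<beta>\<^sup>2) / D * \<eta> t"
      unfolding s4_def using \<alpha> \<beta> D by (simp add: diff_divide_distrib algebra_simps)
    then show ?thesis unfolding s2_def s0_def D_def[symmetric] using D by (simp add: add_divide_distrib algebra_simps)
  qed
  have smooth: "smooth_real s0"
    unfolding s0_def A_def B_def by (intro smooth_real_intros smooth_exp_conv \<eta> \<alpha> \<beta>)
  obtain B\<eta> where "\<And>t. \<bar>\<eta> t\<bar> \<le> B\<eta> * ?e t" using test_real_exp_bound[OF \<eta>, of \<beta>] by blast
  then have d\<eta>: "dominated ?e \<eta>" by (rule dominatedI)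
  have dom: "dominated ?e s0" "dominated ?e s1" "dominated ?e s2" "dominated ?e s3" "dominated ?e s4"
    unfolding s0_def s1_def s2_def s3_def s4_def by (intro dominated_intros dA B1(3,4) d\<eta>)+
  obtain C1 where C1: "\<And>t. \<bar>s0 t\<bar> \<le> C1 * ?e t" "\<And>t. \<bar>s1 t\<bar> \<le> C1 * ?e t" "\<And>t. \<bar>s2 t\<bar> \<le> C1 * ?e t"
    by (rule dominated_common[OF dom(1-3)]) auto
  obtain C2 where C2: "\<And>t. \<bar>s3 t\<bar> \<le> C2 * ?e t" "\<And>t. \<bar>s4 t\<bar> \<le> C2 * ?e t" "\<And>t. \<bar>s4 t\<bar> \<le> C2 * ?e t"
    by (rule dominated_common[OF dom(4,5,5)]) auto
  define r1 where "r1 = deriv plateau"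
  define r2 where "r2 = deriv r1"
  define r3 where "r3 = deriv r2"
  define r4 where "r4 = deriv r3"
  have tr: "test_real r1" "test_real r2" "test_real r3" "test_real r4"
    unfolding r1_def r2_def r3_def r4_def by (intro test_real_deriv test_real_plateau)+
  have dr: "(plateau has_real_derivative r1 t) (at t)" "(r1 has_real_derivative r2 t) (at t)"
    "(r2 has_real_derivative r3 t) (at t)" "(r3 has_real_derivative r4 t) (at t)" for t
    using smooth_real_deriv(1)[OF test_real_smooth] tr test_real_plateau
    by (auto simp: r1_def[symmetric] r2_def[symmetric] r3_def[symmetric] r4_def[symmetric]
        intro: smooth_real_deriv(1)[OF test_real_smooth, of plateau, folded r1_def]
          smooth_real_deriv(1)[OF test_real_smooth, of r1, folded r2_def]
          smooth_real_deriv(1)[OF test_real_smooth, of r2, folded r3_def]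
          smooth_real_deriv(1)[OF test_real_smooth, of r3, folded r4_def])
  obtain S1 where S1: "\<And>t. \<bar>r1 t\<bar> \<le> S1" "S1 \<ge> 0" using test_real_bounded[OF tr(1)] by blast
  obtain S2 where S2: "\<And>t. \<bar>r2 t\<bar> \<le> S2" "S2 \<ge> 0" using test_real_bounded[OF tr(2)] by blast
  obtain S3 where S3: "\<And>t. \<bar>r3 t\<bar> \<le> S3" "S3 \<ge> 0" using test_real_bounded[OF tr(3)] by blast
  obtain S4 where S4: "\<And>t. \<bar>r4 t\<bar> \<le> S4" "S4 \<ge> 0" using test_real_bounded[OF tr(4)] by blast
  define \<epsilon> where "\<epsilon> n = inverse (real (Suc n))" for n
  have ep: "0 < \<epsilon> n" "\<epsilon> n \<le> 1" for n by (auto simp: \<epsilon>_def field_simps)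
  have eplim: "\<epsilon> \<longlonglongrightarrow> 0" unfolding \<epsilon>_def by (rule LIMSEQ_inverse_real_of_nat)
  \<comment> \<open>The widening plateau and its derivatives: each differentiation gains a factor
    \<open>\<epsilon> n\<close> that vanishes in the limit, while \<open>R0\<close> tends to 1. The
    \<open>+ 0\<close> keeps the affine form.\<close>
  define R0 where "R0 n t = plateau (\<epsilon> n * t + 0)" for n t
  define R1 where "R1 n t = \<epsilon> n * r1 (\<epsilon> n * t + 0)" for n t
  define R2 where "R2 n t = \<epsilon> n * (\<epsilon> n * r2 (\<epsilon> n * t + 0))" for n t
  define R3 where "R3 n t = \<epsilon> n * (\<epsilon> n * (\<epsilon> n * r3 (\<epsilon> n * t + 0)))" for n t
  define R4 where "R4 n t = \<epsilon> n * (\<epsilon> n * (\<epsilon> n * (\<epsilon> n * r4 (\<epsilon> n * t + 0))))" for n t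
  have aff: "((\<lambda>t. g (\<epsilon> n * t + 0)) has_real_derivative \<epsilon> n * g' (\<epsilon> n * t + 0)) (at t)"
    if "\<And>t. (g has_real_derivative g' t) (at t)" for g g' n t
  proof -
    have "((\<lambda>t. \<epsilon> n * t + 0) has_real_derivative \<epsilon> n) (at t)" by (auto intro!: derivative_eq_intros)
    from DERIV_chain2[OF that this] show ?thesis by (simp add: mult.commute)
  qed
  have dR0: "(R0 n has_real_derivative R1 n t) (at t)" for n t
    unfolding R0_def R1_def by (rule aff[OF dr(1)])
  have dR1: "(R1 n has_real_derivative R2 n t) (at t)" for n t
    unfolding R1_def R2_def by (rule DERIV_cmult[OF aff[OF dr(2)]])
  have dR2: "(R2 n has_real_derivative R3 n t) (at t)" for n t
    unfolding R2_def R3_def by (rule DERIV_cmult[OF DERIV_cmult[OF aff[OF dr(3)]]])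
  have dR3: "(R3 n has_real_derivative R4 n t) (at t)" for n t
    unfolding R3_def R4_def by (rule DERIV_cmult[OF DERIV_cmult[OF DERIV_cmult[OF aff[OF dr(4)]]]])
  define S where "S = 1 + S1 + S2 + S3 + S4"
  have S: "S \<ge> 0" using S1 S2 S3 S4 by (simp add: S_def)
  have epm: "\<bar>\<epsilon> n * x\<bar> \<le> y" if "\<bar>x\<bar> \<le> y" for n x y
  proof -
    have "\<bar>\<epsilon> n * x\<bar> \<le> 1 * \<bar>x\<bar>" unfolding abs_mult using ep[of n] by (intro mult_right_mono) auto
    then show ?thesis using that by simp
  qed
  have Rb: "\<bar>R0 n t\<bar> \<le> S" "\<bar>R1 n t\<bar> \<le> S" "\<bar>R2 n t\<bar> \<le> S" "\<bar>R3 n t\<bar> \<le> S" "\<bar>R4 n t\<bar> \<le> S" for n t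
  proof -
    have "\<bar>R0 n t\<bar> \<le> 1" using plateau_bounds by (simp add: R0_def)
    then show "\<bar>R0 n t\<bar> \<le> S" using S1 S2 S3 S4 by (simp add: S_def)
    have "\<bar>R1 n t\<bar> \<le> S1" unfolding R1_def by (intro epm S1)
    then show "\<bar>R1 n t\<bar> \<le> S" using S1(2) S2(2) S3(2) S4(2) by (simp add: S_def)
    have "\<bar>R2 n t\<bar> \<le> S2" unfolding R2_def by (intro epm S2)
    then show "\<bar>R2 n t\<bar> \<le> S" using S1(2) S2(2) S3(2) S4(2) by (simp add: S_def)
    have "\<bar>R3 n t\<bar> \<le> S3" unfolding R3_def by (intro epm S3)
    then show "\<bar>R3 n t\<bar> \<le> S" using S1(2) S2(2) S3(2) S4(2) by (simp add: S_def)
    have "\<bar>R4 n t\<bar> \<le> S4" unfolding R4_def by (intro epm S4)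
    then show "\<bar>R4 n t\<bar> \<le> S" using S1(2) S2(2) S3(2) S4(2) by (simp add: S_def)
  qed
  have lim: "(\<lambda>n. g (\<epsilon> n * t + 0)) \<longlonglongrightarrow> g 0" if "smooth_real g" for g t
  proof -
    have "(\<lambda>n. \<epsilon> n * t + 0) \<longlonglongrightarrow> 0 * t + 0" by (intro tendsto_intros eplim)
    then have "(\<lambda>n. \<epsilon> n * t + 0) \<longlonglongrightarrow> 0" by simp
    moreover have "isCont g 0"
      using smooth_real_continuous[OF that, of UNIV] by (simp add: continuous_on_eq_continuous_at)
    ultimately show ?thesis by (rule isCont_tendsto_compose[rotated])
  qed
  have l0: "(\<lambda>n. R0 n t) \<longlonglongrightarrow> 1" for t
    unfolding R0_def using lim[OF test_real_smooth[OF test_real_plateau], of t] by (simp only: plateau_0)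
  note eps_mult = tendsto_mult[OF eplim, simplified mult_zero_left]
  have l1: "(\<lambda>n. R1 n t) \<longlonglongrightarrow> 0" for t
    unfolding R1_def by (rule eps_mult[OF lim[OF test_real_smooth[OF tr(1)]]])
  have l2: "(\<lambda>n. R2 n t) \<longlonglongrightarrow> 0" for t
    unfolding R2_def by (rule eps_mult[OF eps_mult[OF lim[OF test_real_smooth[OF tr(2)]]]])
  have l3: "(\<lambda>n. R3 n t) \<longlonglongrightarrow> 0" for t
    unfolding R3_def by (rule eps_mult[OF eps_mult[OF eps_mult[OF lim[OF test_real_smooth[OF tr(3)]]]]])
  have l4: "(\<lambda>n. R4 n t) \<longlonglongrightarrow> 0" for t
    unfolding R4_def by (rule eps_mult[OF eps_mult[OF eps_mult[OF eps_mult[OF lim[OF test_real_smooth[OF tr(4)]]]]]])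
  have test: "test_real (\<lambda>t. R0 n t * s0 t)" for n
  proof -
    have sR: "smooth_real (R0 n)" unfolding R0_def
      by (intro smooth_real_affine test_real_smooth test_real_plateau)
    have "R0 n t = 0" if "2 / \<epsilon> n \<le> \<bar>t\<bar>" for t
    proof -
      have "2 \<le> \<bar>\<epsilon> n * t + 0\<bar>" using that ep(1)[of n] by (simp add: abs_mult field_simps)
      then show ?thesis
        by (auto simp: R0_def plateau_def abs_if smooth_step_eq_0 split: if_splits)
    qed
    then have "test_real (R0 n)" unfolding test_real_def using sR by blast
    from test_real_mult[OF smooth this] show ?thesis by (simp only: mult.commute)
  qed
  define h2 where "h2 n t = R2 n t * s0 t + 2 * R1 n t * s1 t + R0 n t * s2 t" for n t
  define h4 where "h4 n t = R4 n t * s0 t + 4 * R3 n t * s1 t + 6 * R2 n t * s2 t + 4 * R1 n t * s3 t + R0 n t * s4 t" for n t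
  define l where "l n t = h4 n t - (\<alpha>\<^sup>2 + \<beta>\<^sup>2) * h2 n t + \<alpha>\<^sup>2 * \<beta>\<^sup>2 * (R0 n t * s0 t)" for n t
  have eq: "(\<integral>t. w t * l n t \<partial>lborel) = (\<integral>t. f t * (R0 n t * s0 t) \<partial>lborel)" for n
    using weak[OF test[of n]]
    unfolding deriv_mult_chain(2)[OF dR0 dR1 dR2 dR3 ds0 ds1 ds2 ds3]
    unfolding deriv_mult_chain(1)[OF dR0 dR1 dR2 dR3 ds0 ds1 ds2 ds3] l_def h2_def h4_def .
  have cR: "continuous_on UNIV (R0 n)" "continuous_on UNIV (R1 n)" "continuous_on UNIV (R2 n)" "continuous_on UNIV (R3 n)"
    "continuous_on UNIV (R4 n)" for n
  proof -
    show "continuous_on UNIV (R4 n)" unfolding R4_def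
      by (intro continuous_intros smooth_real_continuous smooth_real_affine test_real_smooth tr)
  qed (rule continuous_on_of_DERIV[OF dR0], rule continuous_on_of_DERIV[OF dR1],
      rule continuous_on_of_DERIV[OF dR2], rule continuous_on_of_DERIV[OF dR3])
  have c\<eta>: "continuous_on UNIV \<eta>" by (intro smooth_real_continuous test_real_smooth \<eta>)
  have cs: "continuous_on UNIV s0" "continuous_on UNIV s1" "continuous_on UNIV s2" "continuous_on UNIV s3"
    by (rule continuous_on_of_DERIV[OF ds0], rule continuous_on_of_DERIV[OF ds1],
      rule continuous_on_of_DERIV[OF ds2], rule continuous_on_of_DERIV[OF ds3])
  have cs4: "continuous_on UNIV s4" unfolding s4_def
    by (intro continuous_intros c\<eta> continuous_on_of_DERIV[OF A1(1)] continuous_on_of_DERIV[OF B1(1)])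
  have [measurable]: "l n \<in> borel_measurable borel" for n
    unfolding l_def h2_def h4_def
    by (intro borel_measurable_continuous_onI continuous_intros cR cs cs4)
  have [measurable]: "\<eta> \<in> borel_measurable borel" "s0 \<in> borel_measurable borel" "R0 n \<in> borel_measurable borel" for n
    by (intro borel_measurable_continuous_onI c\<eta> cs cR)+
  define C where "C = \<bar>C1\<bar> + \<bar>C2\<bar>"
  have sb: "\<bar>s0 t\<bar> \<le> C * ?e t" "\<bar>s1 t\<bar> \<le> C * ?e t" "\<bar>s2 t\<bar> \<le> C * ?e t" "\<bar>s3 t\<bar> \<le> C * ?e t" "\<bar>s4 t\<bar> \<le> C * ?e t" for t
  proof -
    have "C1 * ?e t \<le> C * ?e t" "C2 * ?e t \<le> C * ?e t"
      by (auto simp: C_def intro!: mult_right_mono)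
    then show "\<bar>s0 t\<bar> \<le> C * ?e t" "\<bar>s1 t\<bar> \<le> C * ?e t" "\<bar>s2 t\<bar> \<le> C * ?e t" "\<bar>s3 t\<bar> \<le> C * ?e t" "\<bar>s4 t\<bar> \<le> C * ?e t"
      using C1(1)[of t] C1(2)[of t] C1(3)[of t] C2(1)[of t] C2(2)[of t] by linarith+
  qed
  have prod: "\<bar>x * y\<bar> \<le> S * (C * ?e t)" if "\<bar>x\<bar> \<le> S" "\<bar>y\<bar> \<le> C * ?e t" for x y t
    unfolding abs_mult using that S by (intro mult_mono) auto
  \<comment> \<open>16 and 4 are the sums of the binomial coefficients in the Leibniz formulas of
    orders four and two.\<close>
  define m where "m = 16 + (\<alpha>\<^sup>2 + \<beta>\<^sup>2) * 4 + \<alpha>\<^sup>2 * \<beta>\<^sup>2"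
  have lb: "\<bar>l n t\<bar> \<le> m * (S * (C * ?e t))" for n t
  proof -
    let ?X = "S * (C * ?e t)"
    note pr = prod[OF Rb(5)[of n t] sb(1)[of t]] prod[OF Rb(4)[of n t] sb(2)[of t]] prod[OF Rb(3)[of n t] sb(3)[of t]]
      prod[OF Rb(2)[of n t] sb(4)[of t]] prod[OF Rb(1)[of n t] sb(5)[of t]]
      prod[OF Rb(3)[of n t] sb(1)[of t]] prod[OF Rb(2)[of n t] sb(2)[of t]] prod[OF Rb(1)[of n t] sb(3)[of t]] prod[OF Rb(1)[of n t] sb(1)[of t]]
    have "\<bar>h4 n t\<bar> \<le> 16 * ?X"
      unfolding h4_def mult.assoc using pr(1-5) by linarith
    moreover have "\<bar>h2 n t\<bar> \<le> 4 * ?X"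
      unfolding h2_def mult.assoc using pr(6-8) by linarith
    then have "\<bar>(\<alpha>\<^sup>2 + \<beta>\<^sup>2) * h2 n t\<bar> \<le> (\<alpha>\<^sup>2 + \<beta>\<^sup>2) * (4 * ?X)"
      unfolding abs_mult by (intro mult_mono) auto
    moreover have "\<bar>\<alpha>\<^sup>2 * \<beta>\<^sup>2 * (R0 n t * s0 t)\<bar> \<le> \<alpha>\<^sup>2 * \<beta>\<^sup>2 * ?X"
      unfolding abs_mult[of "\<alpha>\<^sup>2 * \<beta>\<^sup>2"] using pr(9) by (intro mult_mono) auto
    ultimately have "\<bar>l n t\<bar> \<le> 16 * ?X + (\<alpha>\<^sup>2 + \<beta>\<^sup>2) * (4 * ?X) + \<alpha>\<^sup>2 * \<beta>\<^sup>2 * ?X"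
      unfolding l_def by linarith
    also have "\<dots> = m * ?X" unfolding m_def by (simp add: algebra_simps)
    finally show ?thesis .
  qed
  have e2: "integrable lborel (\<lambda>t. (?e t)\<^sup>2)"
  proof -
    have "(\<lambda>t. (?e t)\<^sup>2) = (\<lambda>t. exp (- (2 * \<beta>) * \<bar>t\<bar>))"
      by (simp add: power2_eq_square exp_add[symmetric] fun_eq_iff)
    then show ?thesis using integrable_exp_abs[of "2 * \<beta>"] \<beta> by simp
  qed
  \<comment> \<open>From square integrability of \<open>w\<close> alone: 2 a b <= a^2 + b^2 trades
    the product with the exponential for two integrable squares.\<close>
  have we: "integrable lborel (\<lambda>t. \<bar>w t\<bar> * ?e t)"
  proof (rule Bochner_Integration.integrable_bound)
    show "integrable lborel (\<lambda>t. (w t)\<^sup>2 + (?e t)\<^sup>2)" by (intro Bochner_Integration.integrable_add w2 e2)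
    show "AE t in lborel. norm (\<bar>w t\<bar> * ?e t) \<le> norm ((w t)\<^sup>2 + (?e t)\<^sup>2)"
    proof (rule AE_I2)
      fix t
      have "0 \<le> (\<bar>w t\<bar> - ?e t)\<^sup>2" by simp
      then have "2 * (\<bar>w t\<bar> * ?e t) \<le> (w t)\<^sup>2 + (?e t)\<^sup>2" by (simp add: power2_diff)
      moreover have "0 \<le> \<bar>w t\<bar> * ?e t" by simp
      ultimately show "norm (\<bar>w t\<bar> * ?e t) \<le> norm ((w t)\<^sup>2 + (?e t)\<^sup>2)"
        unfolding real_norm_def by linarith
    qed
  qed measurable
  \<comment> \<open>In \<open>f \<le> 1 + F\<close> the constant part is integrated against the
    exponential, and for \<open>F\<close> the exponential is bounded by 1.\<close>
  have fe: "integrable lborel (\<lambda>t. f t * ?e t)"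
  proof (rule Bochner_Integration.integrable_bound)
    show "integrable lborel (\<lambda>t. ?e t + F t)"
      using integrable_exp_abs[OF \<beta>] F(1) by (intro Bochner_Integration.integrable_add)
    show "AE t in lborel. norm (f t * ?e t) \<le> norm (?e t + F t)"
    proof (rule AE_I2)
      fix t
      have "f t * ?e t \<le> (1 + F t) * ?e t" using F(2) by (intro mult_right_mono) auto
      also have "\<dots> = ?e t + F t * ?e t" by (simp add: distrib_right)
      also have "F t * ?e t \<le> F t * 1" using F(3) \<beta> by (intro mult_left_mono) auto
      finally show "norm (f t * ?e t) \<le> norm (?e t + F t)" using f0 F(3) by simp
    qed
  qed measurable
  have lim1: "(\<lambda>n. \<integral>t. w t * l n t \<partial>lborel) \<longlonglongrightarrow> (\<integral>t. w t * \<eta> t \<partial>lborel)"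
  proof (rule integral_dominated_convergence[where w = "\<lambda>t. (m * (S * C)) * (\<bar>w t\<bar> * ?e t)"])
    show "AE t in lborel. (\<lambda>n. w t * l n t) \<longlonglongrightarrow> w t * \<eta> t"
    proof (rule AE_I2)
      fix t
      have "(\<lambda>n. l n t) \<longlonglongrightarrow> (0 * s0 t + 4 * 0 * s1 t + 6 * 0 * s2 t + 4 * 0 * s3 t + 1 * s4 t)
         - (\<alpha>\<^sup>2 + \<beta>\<^sup>2) * (0 * s0 t + 2 * 0 * s1 t + 1 * s2 t) + \<alpha>\<^sup>2 * \<beta>\<^sup>2 * (1 * s0 t)"
        unfolding l_def h2_def h4_def by (intro tendsto_intros l0 l1 l2 l3 l4)
      then have "(\<lambda>n. l n t) \<longlonglongrightarrow> \<eta> t" by (simp add: L)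
      then show "(\<lambda>n. w t * l n t) \<longlonglongrightarrow> w t * \<eta> t" by (rule tendsto_mult_left)
    qed
    show "AE t in lborel. norm (w t * l n t) \<le> (m * (S * C)) * (\<bar>w t\<bar> * ?e t)" for n
    proof (rule AE_I2)
      fix t
      have "\<bar>w t\<bar> * \<bar>l n t\<bar> \<le> \<bar>w t\<bar> * (m * (S * (C * ?e t)))" by (intro mult_left_mono lb) auto
      then show "norm (w t * l n t) \<le> (m * (S * C)) * (\<bar>w t\<bar> * ?e t)"
        unfolding real_norm_def abs_mult by (simp only: mult_ac)
    qed
    show "integrable lborel (\<lambda>t. (m * (S * C)) * (\<bar>w t\<bar> * ?e t))" by (intro integrable_mult_right we)
  qed measurable
  have lim2: "(\<lambda>n. \<integral>t. f t * (R0 n t * s0 t) \<partial>lborel) \<longlonglongrightarrow> (\<integral>t. f t * s0 t \<partial>lborel)"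
  proof (rule integral_dominated_convergence[where w = "\<lambda>t. (S * C) * (f t * ?e t)"])
    show "AE t in lborel. (\<lambda>n. f t * (R0 n t * s0 t)) \<longlonglongrightarrow> f t * s0 t"
    proof (rule AE_I2)
      fix t
      have "(\<lambda>n. f t * (R0 n t * s0 t)) \<longlonglongrightarrow> f t * (1 * s0 t)" by (intro tendsto_intros l0)
      then show "(\<lambda>n. f t * (R0 n t * s0 t)) \<longlonglongrightarrow> f t * s0 t" by simp
    qed
    show "AE t in lborel. norm (f t * (R0 n t * s0 t)) \<le> (S * C) * (f t * ?e t)" for n
    proof (rule AE_I2)
      fix t
      have "f t * \<bar>R0 n t * s0 t\<bar> \<le> f t * (S * (C * ?e t))"
        by (intro mult_left_mono prod Rb sb f0)
      then show "norm (f t * (R0 n t * s0 t)) \<le> (S * C) * (f t * ?e t)"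
        unfolding real_norm_def abs_mult[of "f t"] abs_of_nonneg[OF f0] by (simp only: mult_ac)
    qed
    show "integrable lborel (\<lambda>t. (S * C) * (f t * ?e t))" by (intro integrable_mult_right fe)
  qed measurable
  have "s0 = green_conv \<alpha> \<beta> \<eta>"
    unfolding s0_def green_conv_def A_def B_def D_def by (auto simp: diff_divide_distrib)
  then show ?thesis using LIMSEQ_unique[OF lim1 lim2[folded eq]] by simp
qed


section \<open>From equality of test integrals to equality almost everywhere\<close>

lemma AE_zero_of_tail_integrals:
  fixes g :: "real \<Rightarrow> real"
  assumes g: "integrable lborel g" and z: "\<And>x. (\<integral>t. indicator {x<..} t * g t \<partial>lborel) = 0"
  shows "AE t in lborel. g t = 0"
proof -
  have [measurable]: "g \<in> borel_measurable borel" using g by auto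
  let ?p = "\<lambda>t. max 0 (g t)" and ?n = "\<lambda>t. max 0 (- g t)"
  have i: "integrable lborel ?p" "integrable lborel ?n" using g by auto
  have ii: "integrable lborel (\<lambda>t. indicator {x<..} t * h t)" if "integrable lborel h" for h :: "real \<Rightarrow> real" and x
    using that by (intro integrable_bounded_mult[of _ _ _ 1]) (auto simp: indicator_def)
  have em: "emeasure (density lborel (\<lambda>t. ennreal (h t))) {x<..} = ennreal (\<integral>t. indicator {x<..} t * h t \<partial>lborel)"
    if h: "integrable lborel h" "\<And>t. 0 \<le> h t" for h :: "real \<Rightarrow> real" and x
  proof -
    have [measurable]: "h \<in> borel_measurable borel" using h(1) by auto
    have "emeasure (density lborel (\<lambda>t. ennreal (h t))) {x<..} = (\<integral>\<^sup>+t. ennreal (h t) * indicator {x<..} t \<partial>lborel)"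
      by (rule emeasure_density) auto
    also have "\<dots> = (\<integral>\<^sup>+t. ennreal (indicator {x<..} t * h t) \<partial>lborel)"
      by (intro nn_integral_cong) (auto simp: indicator_def)
    also have "\<dots> = ennreal (\<integral>t. indicator {x<..} t * h t \<partial>lborel)"
      using h by (intro nn_integral_eq_integral ii) auto
    finally show ?thesis .
  qed
  \<comment> \<open>Positive and negative part of \<open>g\<close> have the same integral over every
    half-line, so as densities they define the same measure and agree almost everywhere; they can
    agree only where \<open>g\<close> is 0.\<close>
  have "density lborel (\<lambda>t. ennreal (?p t)) = density lborel (\<lambda>t. ennreal (?n t))"
  proof (rule measure_eqI_lessThan)
    fix x
    show "emeasure (density lborel (\<lambda>t. ennreal (?p t))) {x<..} < \<infinity>"
      by (subst em[OF i(1)]) auto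
    have "(\<integral>t. indicator {x<..} t * ?p t \<partial>lborel) - (\<integral>t. indicator {x<..} t * ?n t \<partial>lborel)
        = (\<integral>t. indicator {x<..} t * ?p t - indicator {x<..} t * ?n t \<partial>lborel)"
      by (rule Bochner_Integration.integral_diff[OF ii[OF i(1)] ii[OF i(2)], symmetric])
    also have "\<dots> = (\<integral>t. indicator {x<..} t * g t \<partial>lborel)"
      by (intro Bochner_Integration.integral_cong) (auto simp: indicator_def)
    finally show "emeasure (density lborel (\<lambda>t. ennreal (?p t))) {x<..} = emeasure (density lborel (\<lambda>t. ennreal (?n t))) {x<..}"
      using z[of x] by (subst (1 2) em) (auto simp: i)
  qed auto
  then have "AE t in lborel. ennreal (?p t) = ennreal (?n t)"
    by (intro sigma_finite_measure.density_unique[OF sigma_finite_lborel]) auto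
  then show ?thesis by eventually_elim (auto simp: max_def split: if_splits)
qed

text \<open>Half of the hyperbolic secant.\<close>

definition bell :: "real \<Rightarrow> real" where
  "bell t = inverse (exp (1 * t) + exp (- 1 * t))"

lemma smooth_bell: "smooth_real bell"
proof -
  have "exp (1 * t) + exp (- 1 * t) \<noteq> (0::real)" for t
    using add_pos_pos[of "exp (1 * t)" "exp (- 1 * t)"] by auto
  then have "Ck_real k (\<lambda>t. inverse (exp (1 * t) + exp (- 1 * t)))" for k
    by (intro Ck_real_inverse Ck_real_add Ck_real_exp) auto
  then show ?thesis unfolding smooth_real_def bell_def[abs_def] by blast
qed

lemma bell_pos: "bell t > 0"
  unfolding bell_def by (intro positive_imp_inverse_positive add_pos_pos) auto

lemma bell_le: "bell t \<le> exp (- 1 * \<bar>t\<bar>)"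
proof -
  have "exp \<bar>t\<bar> \<le> exp (1 * t) + exp (- 1 * t)" by (cases "t \<ge> 0") auto
  then have "bell t \<le> inverse (exp \<bar>t\<bar>)" unfolding bell_def by (intro le_imp_inverse_le) auto
  then show ?thesis by (simp add: exp_minus)
qed

text \<open>The weight \<open>bell\<close> makes \<open>w - v\<close> integrable, so that it suffices to test against half-lines.\<close>

lemma AE_eq_of_test_integrals:
  fixes w v :: "real \<Rightarrow> real"
  assumes w [measurable]: "w \<in> borel_measurable borel" and w2: "integrable lborel (\<lambda>t. (w t)\<^sup>2)"
    and v [measurable]: "v \<in> borel_measurable borel" and vM: "\<And>t. \<bar>v t\<bar> \<le> M"
    and eq: "\<And>\<eta>. test_real \<eta> \<Longrightarrow> (\<integral>t. w t * \<eta> t \<partial>lborel) = (\<integral>t. v t * \<eta> t \<partial>lborel)"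
  shows "AE t in lborel. w t = v t"
proof -
  have [measurable]: "bell \<in> borel_measurable borel" "smooth_step \<in> borel_measurable borel" "plateau \<in> borel_measurable borel"
    by (intro smooth_real_borel smooth_bell smooth_smooth_step test_real_smooth test_real_plateau)+
  have ib: "integrable lborel bell"
    by (rule Bochner_Integration.integrable_bound[OF integrable_exp_abs[of 1]])
      (use bell_le bell_pos in \<open>auto simp: less_imp_le abs_of_pos\<close>)
  have iv: "integrable lborel (\<lambda>t. v t * bell t)"
    by (rule integrable_bounded_mult[OF ib _ vM]) auto
  have iw: "integrable lborel (\<lambda>t. w t * bell t)"
  proof (rule Bochner_Integration.integrable_bound)
    show "integrable lborel (\<lambda>t. (w t)\<^sup>2 + bell t)" by (intro Bochner_Integration.integrable_add w2 ib)
    show "AE t in lborel. norm (w t * bell t) \<le> norm ((w t)\<^sup>2 + bell t)"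
    proof (rule AE_I2)
      fix t
      have b: "0 < bell t" "bell t \<le> 1" using bell_pos bell_le[of t] by (auto intro: order_trans)
      have "0 \<le> (\<bar>w t\<bar> - bell t)\<^sup>2" by simp
      then have "2 * (\<bar>w t\<bar> * bell t) \<le> (w t)\<^sup>2 + (bell t)\<^sup>2" by (simp add: power2_diff)
      moreover have "(bell t)\<^sup>2 \<le> bell t" using b by (simp add: power2_eq_square)
      moreover have "0 \<le> \<bar>w t\<bar> * bell t" using b by simp
      ultimately have "\<bar>w t\<bar> * bell t \<le> (w t)\<^sup>2 + bell t" by linarith
      then show "norm (w t * bell t) \<le> norm ((w t)\<^sup>2 + bell t)"
        using b by (simp add: abs_mult)
    qed
  qed measurable
  let ?g = "\<lambda>t. w t * bell t - v t * bell t"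
  have ig: "integrable lborel ?g" by (intro Bochner_Integration.integrable_diff iw iv)
  have "AE t in lborel. ?g t = 0"
  proof (rule AE_zero_of_tail_integrals[OF ig])
    fix x :: real
    \<comment> \<open>A step of width 1 / (n + 1) to the right of \<open>x\<close>, cut off by a
      plateau whose length grows with n. It tends to the indicator of the open half-line, since the
      step is 0 at t = x.\<close>
    define X where "X n t = smooth_step (real (Suc n) * t + - real (Suc n) * x) * plateau (inverse (real (Suc n)) * t + 0)" for n t
    have tX: "test_real (\<lambda>t. bell t * X n t)" for n
    proof -
      have "plateau (inverse (real (Suc n)) * t + 0) = 0" if "2 * real (Suc n) \<le> \<bar>t\<bar>" for t
      proof -
        have "2 \<le> \<bar>inverse (real (Suc n)) * t + 0\<bar>" using that by (simp add: abs_mult field_simps)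
        then show ?thesis
          by (auto simp: plateau_def abs_if smooth_step_eq_0 split: if_splits)
      qed
      then have "test_real (\<lambda>t. plateau (inverse (real (Suc n)) * t + 0))"
        unfolding test_real_def using smooth_real_affine[OF test_real_smooth[OF test_real_plateau]] by blast
      then show ?thesis unfolding X_def
        by (intro test_real_mult smooth_bell smooth_real_affine smooth_smooth_step)
    qed
    have Xb: "\<bar>X n t\<bar> \<le> 1" for n t
      unfolding X_def abs_mult using smooth_step_bounds plateau_bounds by (intro mult_le_one) auto
    have [measurable]: "X n \<in> borel_measurable borel" for n unfolding X_def by measurable
    have zero: "(\<integral>t. X n t * ?g t \<partial>lborel) = 0" for n
    proof -
      have "(\<integral>t. X n t * ?g t \<partial>lborel) = (\<integral>t. X n t * (w t * bell t) - X n t * (v t * bell t) \<partial>lborel)"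
        by (simp add: right_diff_distrib)
      also have "\<dots> = (\<integral>t. X n t * (w t * bell t) \<partial>lborel) - (\<integral>t. X n t * (v t * bell t) \<partial>lborel)"
        by (intro Bochner_Integration.integral_diff integrable_bounded_mult[OF iw _ Xb] integrable_bounded_mult[OF iv _ Xb]) auto
      also have "\<dots> = 0" using eq[OF tX[of n]] by (simp add: mult_ac)
      finally show ?thesis .
    qed
    have "(\<lambda>n. \<integral>t. X n t * ?g t \<partial>lborel) \<longlonglongrightarrow> (\<integral>t. indicator {x<..} t * ?g t \<partial>lborel)"
    proof (rule integral_dominated_convergence[where w = "\<lambda>t. \<bar>?g t\<bar>"])
      show "AE t in lborel. (\<lambda>n. X n t * ?g t) \<longlonglongrightarrow> indicator {x<..} t * ?g t"
      proof (rule AE_I2)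
        fix t
        have "(\<lambda>n. plateau (inverse (real (Suc n)) * t + 0)) \<longlonglongrightarrow> plateau 0"
        proof -
          have "isCont plateau 0"
            using smooth_real_continuous[OF test_real_smooth[OF test_real_plateau], of UNIV]
            by (simp add: continuous_on_eq_continuous_at)
          moreover have "(\<lambda>n. inverse (real (Suc n)) * t + 0) \<longlonglongrightarrow> 0 * t + 0"
            by (intro tendsto_intros LIMSEQ_inverse_real_of_nat)
          then have "(\<lambda>n. inverse (real (Suc n)) * t + 0) \<longlonglongrightarrow> 0" by simp
          ultimately show ?thesis by (rule isCont_tendsto_compose)
        qed
        moreover have "(\<lambda>n. smooth_step (real (Suc n) * t + - real (Suc n) * x)) \<longlonglongrightarrow> indicator {x<..} t"
        proof (cases "x < t")
          case True
          have "eventually (\<lambda>n. smooth_step (real (Suc n) * t + - real (Suc n) * x) = 1) sequentially"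
            using eventually_ge_at_top[of "nat \<lceil>1 / (t - x)\<rceil>"]
          proof eventually_elim
            case (elim n)
            then have "1 / (t - x) \<le> real (Suc n)" by linarith
            then have "1 \<le> real (Suc n) * t + - real (Suc n) * x" using True by (simp add: field_simps)
            then show ?case by (rule smooth_step_eq_1)
          qed
          then show ?thesis using True by (simp add: tendsto_eventually)
        next
          case False
          have "real (Suc n) * t + - real (Suc n) * x \<le> 0" for n
            using False mult_left_mono[of t x "real (Suc n)"] by (simp only: mult_minus_left) simp
          then have "smooth_step (real (Suc n) * t + - real (Suc n) * x) = 0" for n by (rule smooth_step_eq_0)
          then show ?thesis using False by simp
        qed
        ultimately have "(\<lambda>n. X n t * ?g t) \<longlonglongrightarrow> (indicator {x<..} t * plateau 0) * ?g t"
          unfolding X_def by (intro tendsto_intros)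
        then show "(\<lambda>n. X n t * ?g t) \<longlonglongrightarrow> indicator {x<..} t * ?g t" by (simp add: plateau_0)
      qed
      show "AE t in lborel. norm (X n t * ?g t) \<le> \<bar>?g t\<bar>" for n
        using Xb[of n] by (intro AE_I2) (auto simp: abs_mult intro!: mult_left_le_one_le)
      show "integrable lborel (\<lambda>t. \<bar>?g t\<bar>)" using ig by (rule integrable_abs)
    qed measurable
    then show "(\<integral>t. indicator {x<..} t * ?g t \<partial>lborel) = 0" unfolding zero by (simp add: LIMSEQ_const_iff)
  qed
  then show ?thesis
  proof eventually_elim
    case (elim t)
    then have "(w t - v t) * bell t = 0" by (simp add: left_diff_distrib)
    then show ?case using bell_pos[of t] by simp
  qed
qed

lemma green_even: "green \<alpha> \<beta> (t - s) = green \<alpha> \<beta> (s - t)"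
  by (simp add: green_def abs_minus_commute)

text \<open>The kernel has the argument order in which Fubini produces it; evenness of the Green
  function turns this into the convolution.\<close>

lemma green_conv_eq:
  assumes \<beta>: "0 < \<beta>" and \<beta>\<alpha>: "\<beta> < \<alpha>" and \<eta>: "test_real \<eta>"
  shows "green_conv \<alpha> \<beta> \<eta> s = (\<integral>t. green \<alpha> \<beta> (t - s) * \<eta> t \<partial>lborel)"
proof -
  have i: "integrable lborel (\<lambda>t. exp (- c * \<bar>s - t\<bar>) * \<eta> t)" for c
    by (intro integrable_test_real_mult \<eta> continuous_intros)
  let ?D = "\<alpha>\<^sup>2 - \<beta>\<^sup>2"
  have "(\<integral>t. green \<alpha> \<beta> (t - s) * \<eta> t \<partial>lborel) = (\<integral>t. 1 / (2 * \<beta> * ?D) * (exp (- \<beta> * \<bar>s - t\<bar>) * \<eta> t)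
      - 1 / (2 * \<alpha> * ?D) * (exp (- \<alpha> * \<bar>s - t\<bar>) * \<eta> t) \<partial>lborel)"
    by (intro Bochner_Integration.integral_cong refl, subst green_even)
      (simp add: green_def diff_divide_distrib left_diff_distrib)
  also have "\<dots> = 1 / (2 * \<beta> * ?D) * exp_conv \<beta> \<eta> s - 1 / (2 * \<alpha> * ?D) * exp_conv \<alpha> \<eta> s"
    unfolding exp_conv_def
    by (subst Bochner_Integration.integral_diff[OF integrable_mult_right[OF i] integrable_mult_right[OF i]])
      (simp only: integral_mult_right_zero)
  finally show ?thesis by (simp add: green_conv_def diff_divide_distrib)
qed

text \<open>Fubini moves the Green function from the test function to \<open>f\<close>, so
  \<open>w\<close> and \<open>v\<close> have the same integrals against all test functions. The
  bound by a constant plus an integrable \<open>F\<close> makes \<open>v\<close> bounded, because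
  the kernel is both integrable and bounded.\<close>

lemma weak_solution_green_representation:
  fixes w f F :: "real \<Rightarrow> real"
  assumes \<beta>: "0 < \<beta>" and \<beta>\<alpha>: "\<beta> < \<alpha>"
    and w [measurable]: "w \<in> borel_measurable borel" and w2: "integrable lborel (\<lambda>t. (w t)\<^sup>2)"
    and f [measurable]: "f \<in> borel_measurable borel" and f0: "\<And>t. 0 \<le> f t"
    and F: "integrable lborel F" "\<And>t. f t \<le> 1 + F t" "\<And>t. 0 \<le> F t"
    and weak: "\<And>\<psi>. test_real \<psi> \<Longrightarrow>
      (\<integral>t. w t * (deriv (deriv (deriv (deriv \<psi>))) t - (\<alpha>\<^sup>2 + \<beta>\<^sup>2) * deriv (deriv \<psi>) t + \<alpha>\<^sup>2 * \<beta>\<^sup>2 * \<psi> t) \<partial>lborel)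
      = (\<integral>t. f t * \<psi> t \<partial>lborel)"
  defines "v \<equiv> \<lambda>t. \<integral>s. green \<alpha> \<beta> (t - s) * f s \<partial>lborel"
  shows "v \<in> borel_measurable borel" and "\<And>t. 0 \<le> v t" and "\<exists>M. \<forall>t. v t \<le> M"
    and "AE t in lborel. w t = v t"
proof -
  show vb [measurable]: "v \<in> borel_measurable borel" unfolding v_def by measurable
  show v0: "0 \<le> v t" for t
    unfolding v_def using green_nonneg[OF \<beta> \<beta>\<alpha>] f0 by (intro integral_nonneg_AE) auto
  let ?c = "1 / (2 * \<beta> * (\<alpha>\<^sup>2 - \<beta>\<^sup>2))"
  have c: "?c > 0" using \<beta> sq_diff_pos[OF \<beta> \<beta>\<alpha>] by simp
  have dom: "integrable lborel (\<lambda>s. ?c * (exp (- \<beta> * \<bar>t - s\<bar>) + F s))" for t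
    by (intro integrable_mult_right Bochner_Integration.integrable_add integral_exp_abs(1)[OF \<beta>] F(1))
  have gf: "green \<alpha> \<beta> (t - s) * f s \<le> ?c * (exp (- \<beta> * \<bar>t - s\<bar>) + F s)" for t s
  proof -
    let ?e = "exp (- \<beta> * \<bar>t - s\<bar>)"
    have "green \<alpha> \<beta> (t - s) * f s \<le> (?c * ?e) * (1 + F s)"
      using green_le[OF \<beta> \<beta>\<alpha>] green_nonneg[OF \<beta> \<beta>\<alpha>] f0 F c by (intro mult_mono) auto
    also have "\<dots> = ?c * (?e + ?e * F s)" by (simp only: distrib_left mult.assoc mult_1_right)
    also have "\<dots> \<le> ?c * (?e + 1 * F s)"
      using c F(3) \<beta> by (intro mult_left_mono add_left_mono mult_right_mono) auto
    finally show ?thesis by simp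
  qed
  have gf0: "0 \<le> green \<alpha> \<beta> (t - s) * f s" for t s using green_nonneg[OF \<beta> \<beta>\<alpha>] f0 by simp
  have igf: "integrable lborel (\<lambda>s. green \<alpha> \<beta> (t - s) * f s)" for t
  proof (rule Bochner_Integration.integrable_bound[OF dom[of t]])
    show "AE s in lborel. norm (green \<alpha> \<beta> (t - s) * f s) \<le> norm (?c * (exp (- \<beta> * \<bar>t - s\<bar>) + F s))"
      unfolding real_norm_def abs_of_nonneg[OF gf0] by (intro AE_I2 order_trans[OF gf abs_ge_self])
  qed measurable
  \<comment> \<open>The constant 1 meets the mass 2 / \<beta> of the exponential; for
    \<open>F\<close> the exponential is replaced by its supremum 1.\<close>
  define M where "M = ?c * (2 / \<beta> + (\<integral>s. F s \<partial>lborel))"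
  have vM: "v t \<le> M" for t
  proof -
    have "v t \<le> (\<integral>s. ?c * (exp (- \<beta> * \<bar>t - s\<bar>) + F s) \<partial>lborel)"
      unfolding v_def by (intro integral_mono igf dom gf)
    also have "\<dots> = M" unfolding M_def
      using integral_exp_abs[OF \<beta>, of t] F(1) by (simp add: Bochner_Integration.integral_add)
    finally show ?thesis .
  qed
  then show "\<exists>M. \<forall>t. v t \<le> M" by blast
  show "AE t in lborel. w t = v t"
  proof (rule AE_eq_of_test_integrals[OF w w2 vb])
    show "\<bar>v t\<bar> \<le> M" for t using v0 vM by simp
    fix \<eta> assume \<eta>: "test_real \<eta>"
    have [measurable]: "\<eta> \<in> borel_measurable borel" by (rule test_real_borel[OF \<eta>])
    let ?h = "\<lambda>t s. \<eta> t * (green \<alpha> \<beta> (t - s) * f s)"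
    have i\<eta>: "integrable lborel \<eta>" using integrable_test_real_mult[OF \<eta>, of "\<lambda>_. 1"] by simp
    have "integrable (lborel \<Otimes>\<^sub>M lborel) (\<lambda>(t, s). ?h t s)"
    proof (rule lborel_pair.Fubini_integrable)
      show "(\<lambda>(t, s). ?h t s) \<in> borel_measurable (lborel \<Otimes>\<^sub>M lborel)" by measurable
      have "(\<integral>s. norm (?h t s) \<partial>lborel) = v t * \<bar>\<eta> t\<bar>" for t
        unfolding v_def using gf0 by (simp add: abs_mult[of "\<eta> t"] abs_of_nonneg mult.commute)
      moreover have "integrable lborel (\<lambda>t. v t * \<bar>\<eta> t\<bar>)"
        using v0 vM by (intro integrable_bounded_mult[OF integrable_abs[OF i\<eta>], of _ M]) (auto simp: abs_of_nonneg)
      ultimately show "integrable lborel (\<lambda>t. \<integral>s. norm (case (t, s) of (t, s) \<Rightarrow> ?h t s) \<partial>lborel)" by simp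
      show "AE t in lborel. integrable lborel (\<lambda>s. case (t, s) of (t, s) \<Rightarrow> ?h t s)"
        using igf by (intro AE_I2) simp
    qed
    from lborel_pair.Fubini_integral[OF this]
    have "(\<integral>s. (\<integral>t. ?h t s \<partial>lborel) \<partial>lborel) = (\<integral>t. (\<integral>s. ?h t s \<partial>lborel) \<partial>lborel)" .
    moreover have "(\<integral>t. ?h t s \<partial>lborel) = f s * green_conv \<alpha> \<beta> \<eta> s" for s
    proof -
      have "?h t s = f s * (green \<alpha> \<beta> (t - s) * \<eta> t)" for t by (simp only: mult_ac)
      then show ?thesis unfolding green_conv_eq[OF \<beta> \<beta>\<alpha> \<eta>] by (simp only: integral_mult_right_zero)
    qed
    moreover have "(\<integral>s. ?h t s \<partial>lborel) = v t * \<eta> t" for t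
      unfolding v_def by (simp only: integral_mult_right_zero mult.commute)
    ultimately show "(\<integral>t. w t * \<eta> t \<partial>lborel) = (\<integral>t. v t * \<eta> t \<partial>lborel)"
      using weak_equation_green[OF \<beta> \<beta>\<alpha> w w2 f f0 F weak \<eta>] by (simp only:)
  qed
qed


section \<open>Classification of the radial solutions\<close>

lemma integrable_square_mult:
  fixes w g :: "real \<Rightarrow> real"
  assumes [measurable]: "w \<in> borel_measurable borel" and w2: "integrable lborel (\<lambda>t. (w t)\<^sup>2)"
    and g: "test_real g"
  shows "integrable lborel (\<lambda>t. w t * g t)"
proof (rule Bochner_Integration.integrable_bound)
  have [measurable]: "g \<in> borel_measurable borel" by (rule test_real_borel[OF g])
  have "integrable lborel (\<lambda>t. g t * g t)"
    by (intro integrable_test_real_mult g smooth_real_continuous test_real_smooth)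
  then show "integrable lborel (\<lambda>t. (w t)\<^sup>2 + (g t)\<^sup>2)"
    by (intro Bochner_Integration.integrable_add w2) (simp add: power2_eq_square)
  show "AE t in lborel. norm (w t * g t) \<le> norm ((w t)\<^sup>2 + (g t)\<^sup>2)"
  proof (rule AE_I2)
    fix t
    have "0 \<le> (\<bar>w t\<bar> - \<bar>g t\<bar>)\<^sup>2" by simp
    then have "2 * (\<bar>w t\<bar> * \<bar>g t\<bar>) \<le> (w t)\<^sup>2 + (g t)\<^sup>2" by (simp add: power2_diff)
    moreover have "0 \<le> \<bar>w t\<bar> * \<bar>g t\<bar>" by simp
    ultimately have "\<bar>w t\<bar> * \<bar>g t\<bar> \<le> (w t)\<^sup>2 + (g t)\<^sup>2" by linarith
    then show "norm (w t * g t) \<le> norm ((w t)\<^sup>2 + (g t)\<^sup>2)" by (simp add: abs_mult)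
  qed
  show "(\<lambda>t. w t * g t) \<in> borel_measurable lborel" by measurable
qed

lemma lift_class_lap:
  assumes "test_real \<psi>"
  shows "test_real (\<lambda>t. exp (- 2 * t) * (deriv (deriv \<psi>) t + c * deriv \<psi> t))"
  using assms by (intro test_real_mult test_real_add test_real_cmult test_real_deriv smooth_real_exp)

text \<open>The profile is read off along one coordinate axis. Radiality holds at every point but
  positivity only almost everywhere, hence the truncation at 0, which changes a null set
  only.\<close>

lemma pos_radial_solution_profile:
  fixes u :: "real^'n::finite \<Rightarrow> real"
  assumes u: "pos_radial_solution \<mu> u"
  obtains w where "w \<in> borel_measurable borel" "\<And>t. 0 \<le> w t" "AE t in lborel. 0 < w t"
    "AE x in lborel. u x = exp (- b * ln (norm x)) * w (ln (norm x))"
proof -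
  from u have rad: "radial u" and pos: "AE x in lborel. 0 < u x"
    and [measurable]: "u \<in> borel_measurable borel"
    by (auto simp: pos_radial_solution_def weak_solution_def E_mu_wit_def)
  obtain i :: 'n where True by blast
  define y where "y t = exp (b * t) * u (exp t *\<^sub>R axis i 1)" for t
  have [measurable]: "y \<in> borel_measurable borel" unfolding y_def[abs_def] by measurable
  have uy: "u x = exp (- b * ln (norm x)) * y (ln (norm x))" if "x \<noteq> 0" for x
  proof -
    have "u (exp (ln (norm x)) *\<^sub>R axis i 1) = u x"
    proof -
      have "norm (exp (ln (norm x)) *\<^sub>R (axis i 1 :: real^'n)) = norm x" using that by simp
      then show ?thesis using rad unfolding radial_def by blast
    qed
    then show ?thesis by (simp add: y_def exp_add[symmetric] flip: mult.assoc)
  qed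
  have "AE x in lborel. 0 < y (ln (norm (x::real^'n)))"
    using pos AE_nonzero
  proof eventually_elim
    case (elim x)
    then show ?case using uy[OF elim(2)] by (simp add: zero_less_mult_iff)
  qed
  then have ypos: "AE t in lborel. 0 < y t" by (subst (asm) AE_radial_iff) auto
  show thesis
  proof (rule that[of "\<lambda>t. max 0 (y t)"])
    show "AE t in lborel. 0 < max 0 (y t)" using ypos by eventually_elim simp
    have "AE x in lborel. 0 < y (ln (norm (x::real^'n)))" using ypos by (subst AE_radial_iff) auto
    then show "AE x in lborel. u x = exp (- b * ln (norm x)) * max 0 (y (ln (norm x)))"
      using AE_nonzero
    proof eventually_elim
      case (elim x)
      then show ?case using uy[OF elim(2)] by simp
    qed
  qed auto
qed

text \<open>The one-dimensional operator is even in D, hence formally self-adjoint, so the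
  Emden-Fowler computation for the explicit solutions can be applied to the test profile instead.
  All derivatives fall on the test function, and \<open>g\<close> and \<open>h\<close> are
  eliminated through the weak identities that define them.\<close>

lemma pos_radial_solution_1d:
  fixes u :: "real^'n::finite \<Rightarrow> real" and \<mu> :: real
  assumes N5: "CARD('n) \<ge> 5" and mu: "0 < \<mu>" "\<mu> < real CARD('n) - 4"
    and b: "b = (real CARD('n) - 4) / 2" and k: "k = 1 - \<mu> / (real CARD('n) - 4)"
    and u: "pos_radial_solution \<mu> u"
    and w [measurable]: "w \<in> borel_measurable borel" and w0: "\<And>t. 0 \<le> w t"
    and uw: "AE x in lborel. u x = exp (- b * ln (norm x)) * w (ln (norm x))"
  shows "integrable lborel (\<lambda>t. (w t)\<^sup>2)" and "integrable lborel (\<lambda>t. w t powr crit_exp CARD('n))"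
    and "\<And>\<psi>. test_real \<psi> \<Longrightarrow>
      (\<integral>t. w t * (deriv (deriv (deriv (deriv \<psi>))) t - ((k * (b + 2))\<^sup>2 + (k * b)\<^sup>2) * deriv (deriv \<psi>) t
        + (k * (b + 2))\<^sup>2 * (k * b)\<^sup>2 * \<psi> t) \<partial>lborel)
      = (\<integral>t. w t powr ((b + 4) / b) * \<psi> t \<partial>lborel)"
proof -
  have N: "real CARD('n) = 2 * b + 4" using b by (simp add: field_simps)
  have b0: "b > 0" using N5 b by simp
  from u obtain g h where E: "E_mu_wit \<mu> u g h" and weak: "\<And>\<phi>. test_fun (- {0}) \<phi> \<Longrightarrow>
        (\<integral>x. h x * lap \<phi> x \<partial>lborel)
          - C1 CARD('n) \<mu> * (\<integral>x. (g x \<bullet> grad \<phi> x) / (norm x)\<^sup>2 \<partial>lborel)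
          + C2 CARD('n) \<mu> * (\<integral>x. u x * \<phi> x / (norm x) ^ 4 \<partial>lborel)
        = (\<integral>x. u x powr (crit_exp CARD('n) - 1) * \<phi> x \<partial>lborel)"
    unfolding pos_radial_solution_def weak_solution_def by blast
  from E have [measurable]: "u \<in> borel_measurable borel"
    and ip: "integrable lborel (\<lambda>x. \<bar>u x\<bar> powr crit_exp CARD('n))"
    and i2: "integrable lborel (\<lambda>x. (u x)\<^sup>2 / norm x ^ 4)"
    and wl: "weak_lap u h" and wg: "weak_grad u g"
    unfolding E_mu_wit_def by auto
  have n4: "exp (- 4 * ln (norm x)) = 1 / norm x ^ 4" if "x \<noteq> 0" for x :: "real^'n"
    using exp_ln_norm_powr[OF that, of "- 4"] that powr_minus[of "norm x" 4] by (simp add: divide_inverse)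
  show w2: "integrable lborel (\<lambda>t. (w t)\<^sup>2)"
  proof -
    have "integrable lborel (\<lambda>x::real^'n. exp (- real CARD('n) * ln (norm x)) * (w (ln (norm x)))\<^sup>2)"
    proof (rule integrable_cong_AE_imp[OF i2])
      show "AE x in lborel. (u x)\<^sup>2 / norm x ^ 4 = exp (- real CARD('n) * ln (norm x)) * (w (ln (norm x)))\<^sup>2"
        using uw AE_nonzero
      proof eventually_elim
        case (elim x)
        let ?t = "ln (norm x)"
        have "(u x)\<^sup>2 / norm x ^ 4 = exp (- 4 * ?t) * (exp (- b * ?t) * w ?t)\<^sup>2"
          using n4[OF elim(2)] elim(1) by simp
        also have "\<dots> = (exp (- 4 * ?t) * (exp (- b * ?t) * exp (- b * ?t))) * (w ?t)\<^sup>2"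
          by (simp only: power2_eq_square mult_ac)
        also have "exp (- 4 * ?t) * (exp (- b * ?t) * exp (- b * ?t)) = exp (- real CARD('n) * ?t)"
          unfolding exp_add[symmetric] by (simp add: N algebra_simps)
        finally show ?case .
      qed
    qed measurable
    then have "integrable lborel (\<lambda>t. exp (real CARD('n) * t) * (exp (- real CARD('n) * t) * (w t)\<^sup>2))"
      by (subst (asm) integrable_radial_iff[of "\<lambda>t. exp (- real CARD('n) * t) * (w t)\<^sup>2"]) auto
    then show ?thesis by (simp only: exp_cancel)
  qed
  show "integrable lborel (\<lambda>t. w t powr crit_exp CARD('n))"
  proof -
    have c: "b * crit_exp CARD('n) = real CARD('n)" using b0 by (simp add: crit_exp_def N)
    have "integrable lborel (\<lambda>x::real^'n. exp (- real CARD('n) * ln (norm x)) * w (ln (norm x)) powr crit_exp CARD('n))"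
    proof (rule integrable_cong_AE_imp[OF ip])
      show "AE x in lborel. \<bar>u x\<bar> powr crit_exp CARD('n) = exp (- real CARD('n) * ln (norm x)) * w (ln (norm x)) powr crit_exp CARD('n)"
        using uw
      proof eventually_elim
        case (elim x)
        let ?t = "ln (norm x)"
        have "\<bar>u x\<bar> powr crit_exp CARD('n) = exp (- b * ?t) powr crit_exp CARD('n) * w ?t powr crit_exp CARD('n)"
          using w0[of ?t] unfolding elim by (simp add: abs_mult powr_mult)
        also have "exp (- b * ?t) powr crit_exp CARD('n) = exp (- (b * crit_exp CARD('n)) * ?t)"
          by (simp add: exp_powr_real mult_ac)
        finally show ?case unfolding c .
      qed
    qed measurable
    then have "integrable lborel (\<lambda>t. exp (real CARD('n) * t) * (exp (- real CARD('n) * t) * w t powr crit_exp CARD('n)))"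
      by (subst (asm) integrable_radial_iff[of "\<lambda>t. exp (- real CARD('n) * t) * w t powr crit_exp CARD('n)"]) auto
    then show ?thesis by (simp only: exp_cancel)
  qed
  let ?K = "radial_const CARD('n)"
  have K: "?K > 0" by (simp add: radial_const_pos)
  \<comment> \<open>The Jacobian exp (N t) and the weight exp (- b t) of \<open>u\<close> leave exp
    ((b + 4) t), the inverse of the weight that the operator terms carry.\<close>
  have red: "(\<integral>x. u x * radial_lift S x \<partial>lborel) = ?K * (\<integral>t. w t * (exp ((b + 4) * t) * S t) \<partial>lborel)"
    if [measurable]: "S \<in> borel_measurable borel" for S
  proof -
    have [measurable]: "(radial_lift S :: real^'n \<Rightarrow> real) \<in> borel_measurable borel" by (rule radial_lift_borel) fact
    have "(\<integral>x. u x * radial_lift S x \<partial>lborel) = (\<integral>x. exp (- b * ln (norm (x::real^'n))) * w (ln (norm x)) * S (ln (norm x)) \<partial>lborel)"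
    proof (rule integral_cong_AE)
      show "AE x in lborel. u x * radial_lift S x = exp (- b * ln (norm (x::real^'n))) * w (ln (norm x)) * S (ln (norm x))"
        using uw radial_lift_AE[of S, where 'n = 'n] by eventually_elim simp
    qed measurable
    also have "\<dots> = ?K * (\<integral>t. exp (real CARD('n) * t) * (exp (- b * t) * w t * S t) \<partial>lborel)"
      by (rule integral_radial) measurable
    also have "(\<lambda>t. exp (real CARD('n) * t) * (exp (- b * t) * w t * S t)) = (\<lambda>t. w t * (exp ((b + 4) * t) * S t))"
    proof
      fix t
      have "exp ((b + 4) * t) = exp (real CARD('n) * t) * exp (- b * t)"
        unfolding exp_add[symmetric] by (simp add: N algebra_simps)
      then show "exp (real CARD('n) * t) * (exp (- b * t) * w t * S t) = w t * (exp ((b + 4) * t) * S t)"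
        by (simp only: mult_ac)
    qed
    finally show ?thesis .
  qed
  fix \<psi> assume \<psi>: "test_real \<psi>"
  define w1 where "w1 = deriv \<psi>"
  define w2' where "w2' = deriv w1"
  define w3 where "w3 = deriv w2'"
  define w4 where "w4 = deriv w3"
  have tw: "test_real w1" "test_real w2'" "test_real w3" "test_real w4"
    unfolding w1_def w2'_def w3_def w4_def by (intro test_real_deriv \<psi>)+
  have dw: "(\<psi> has_real_derivative w1 t) (at t)" "(w1 has_real_derivative w2' t) (at t)"
    "(w2' has_real_derivative w3 t) (at t)" "(w3 has_real_derivative w4 t) (at t)" for t
    unfolding w1_def w2'_def w3_def w4_def
    by (intro smooth_real_deriv(1) test_real_smooth test_real_deriv \<psi>)+
  define v1 where "v1 = (\<lambda>t. w1 t - b * \<psi> t)"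
  define v2 where "v2 = (\<lambda>t. w2' t - 2 * b * w1 t + b ^ 2 * \<psi> t)"
  define v3 where "v3 = (\<lambda>t. w3 t - 3 * b * w2' t + 3 * b ^ 2 * w1 t - b ^ 3 * \<psi> t)"
  define v4 where "v4 = (\<lambda>t. w4 t - 4 * b * w3 t + 6 * b ^ 2 * w2' t - 4 * b ^ 3 * w1 t + b ^ 4 * \<psi> t)"
  note ef = emden_fowler_chain[OF dw v1_def v2_def v3_def v4_def]
  let ?n = "2 * b + 2"
  let ?H = "\<lambda>t. exp (- (b + 2) * t) * (v2 t + ?n * v1 t)"
  let ?H1 = "\<lambda>t. exp (- (b + 2) * t) * ((v3 t - 2 * v2 t) + ?n * (v2 t - 2 * v1 t))"
  let ?H2 = "\<lambda>t. exp (- (b + 2) * t) * ((v4 t - 4 * v3 t + 4 * v2 t) + ?n * (v3 t - 4 * v2 t + 4 * v1 t))"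
  let ?z = "\<lambda>t. exp (- (b + 4) * t) * v1 t"
  let ?z' = "\<lambda>t. exp (- (b + 4) * t) * (v2 t - 4 * v1 t)"
  \<comment> \<open>The test profile is weighted like \<open>u\<close> itself, so that
    \<open>emden_fowler_chain\<close> applies with \<psi> in the role of w.\<close>
  let ?\<chi> = "\<lambda>t. exp (- b * t) * \<psi> t"
  have t\<chi>: "test_real ?\<chi>" by (intro test_real_mult smooth_real_exp \<psi>)
  have d\<chi>: "deriv ?\<chi> = (\<lambda>t. exp (- b * t) * v1 t)" "deriv (\<lambda>t. exp (- b * t) * v1 t) = (\<lambda>t. exp (- b * t) * v2 t)"
    using ef(1,2) by (auto intro!: ext DERIV_imp_deriv)
  have dH: "deriv ?H = ?H1" "deriv ?H1 = ?H2" "deriv ?z = ?z'"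
    using ef(3-5) by (auto intro!: ext DERIV_imp_deriv)
  have n2: "real CARD('n) - 2 = ?n" by (simp add: N)
  have ee: "exp (- 2 * t) * (exp (- c * t) * f) = exp (- (c + 2) * t) * f" for c t f :: real
    by (simp add: exp_add[symmetric] algebra_simps flip: mult.assoc)
  let ?\<phi> = "radial_lift ?\<chi> :: real^'n \<Rightarrow> real"
  have \<phi>: "test_fun (- {0}) ?\<phi>" by (rule lift_class_test_fun(1)[OF lift_class.lift[OF t\<chi>]])
  have Heq: "(\<lambda>t. exp (- 2 * t) * (deriv (deriv ?\<chi>) t + (real CARD('n) - 2) * deriv ?\<chi> t)) = ?H"
  proof
    fix t
    have "exp (- b * t) * v2 t + ?n * (exp (- b * t) * v1 t) = exp (- b * t) * (v2 t + ?n * v1 t)"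
      by (simp only: distrib_left mult.left_commute)
    then show "exp (- 2 * t) * (deriv (deriv ?\<chi>) t + (real CARD('n) - 2) * deriv ?\<chi> t) = ?H t"
      unfolding d\<chi> n2 by (simp only: ee)
  qed
  have tH: "test_real ?H" using lift_class_lap[OF t\<chi>, of "real CARD('n) - 2"] unfolding Heq .
  have lap1: "lap ?\<phi> = radial_lift ?H"
    unfolding lap_radial_lift[OF t\<chi>] Heq ..
  let ?G = "\<lambda>t. exp (- 2 * t) * (?H2 t + ?n * ?H1 t)"
  have lap2: "lap (radial_lift ?H :: real^'n \<Rightarrow> real) = radial_lift ?G"
    unfolding lap_radial_lift[OF tH] dH n2 ..
  have tG: "test_real ?G" using lift_class_lap[OF tH, of ?n] unfolding dH .
  have tHU: "test_fun UNIV (radial_lift ?H :: real^'n \<Rightarrow> real)"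
    by (rule lift_class_test_fun(2)[OF lift_class.lift[OF tH]])
  \<comment> \<open>The Laplacian of the test function is again a test function, so the weak
    Laplacian replaces \<open>h\<close> by \<open>u\<close> and a second Laplacian.\<close>
  have T1: "(\<integral>x. h x * lap ?\<phi> x \<partial>lborel) = (\<integral>x. u x * radial_lift ?G x \<partial>lborel)"
    using wl tHU unfolding weak_lap_def lap1 lap2[symmetric] by simp
  have tz: "test_real ?z"
  proof -
    have "(\<lambda>t. exp (- 4 * t) * (exp (- b * t) * v1 t)) = ?z"
      by (simp add: exp_add[symmetric] algebra_simps fun_eq_iff flip: mult.assoc)
    then show ?thesis using test_real_lift_deriv[OF t\<chi>, of "- 4"] unfolding d\<chi> by (simp only:)
  qed
  \<comment> \<open>The components of the gradient of the test function over |x|^2 are a coordinate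
    times a lift, hence admissible in the weak gradient identity; their divergence is
    radial.\<close>
  have tzi: "test_fun UNIV (\<lambda>x::real^'n. x $ i * radial_lift ?z x)" for i
    by (rule lift_class_test_fun(2)[OF lift_class.coord[OF lift_class.lift[OF tz]]])
  let ?Z = "\<lambda>t. (2 * b + 4) * ?z t + ?z' t"
  have div: "(\<Sum>i\<in>UNIV. pd i (\<lambda>x. x $ i * radial_lift ?z x) x) = radial_lift ?Z x" for x :: "real^'n"
    using sum_pd_coord_radial_lift[OF tz, of x] unfolding dH N by simp
  have tZ: "test_real ?Z"
    using test_real_add[OF test_real_cmult[OF tz, of "2 * b + 4"] test_real_deriv[OF tz]] unfolding dH .
  have T2: "(\<integral>x. (g x \<bullet> grad ?\<phi> x) / (norm x)\<^sup>2 \<partial>lborel) = - (\<integral>x. u x * radial_lift ?Z x \<partial>lborel)"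
  proof -
    have gi: "integrable lborel (\<lambda>x. u x * pd i (\<lambda>x. x $ i * radial_lift ?z x) x)"
      "integrable lborel (\<lambda>x. g x $ i * (x $ i * radial_lift ?z x))"
      "(\<integral>x. u x * pd i (\<lambda>x. x $ i * radial_lift ?z x) x \<partial>lborel) = - (\<integral>x. g x $ i * (x $ i * radial_lift ?z x) \<partial>lborel)" for i
      using wg tzi unfolding weak_grad_def by blast+
    have "(g x \<bullet> grad ?\<phi> x) / (norm x)\<^sup>2 = (\<Sum>i\<in>UNIV. g x $ i * (x $ i * radial_lift ?z x))" for x
    proof (cases "x = 0")
      case True
      then show ?thesis by simp
    next
      case False
      have "radial_lift ?z x = radial_lift (\<lambda>t. exp (- 2 * t) * (exp (- b * t) * v1 t)) x / (norm x)\<^sup>2"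
      proof -
        let ?t = "ln (norm x)"
        have "?z ?t = exp (- 2 * ?t) * (exp (- 2 * ?t) * (exp (- b * ?t) * v1 ?t))"
          unfolding ee by (simp add: algebra_simps)
        also have "\<dots> = (exp (- 2 * ?t) * (exp (- b * ?t) * v1 ?t)) / (norm x)\<^sup>2"
          using False exp_minus2_ln[of "norm x"] by simp
        finally show ?thesis using False by (simp only: radial_lift_def if_False)
      qed
      then show ?thesis
        unfolding grad_def pd_radial_lift[OF t\<chi>] d\<chi>
        by (simp add: inner_vec_def sum_divide_distrib)
    qed
    then have "(\<integral>x. (g x \<bullet> grad ?\<phi> x) / (norm x)\<^sup>2 \<partial>lborel) = (\<Sum>i\<in>UNIV. \<integral>x. g x $ i * (x $ i * radial_lift ?z x) \<partial>lborel)"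
      using gi(2) by (simp only:) (rule Bochner_Integration.integral_sum)
    also have "\<dots> = - (\<Sum>i\<in>UNIV. \<integral>x. u x * pd i (\<lambda>x. x $ i * radial_lift ?z x) x \<partial>lborel)"
      unfolding gi(3) by (simp add: sum_negf)
    also have "\<dots> = - (\<integral>x. (\<Sum>i\<in>UNIV. u x * pd i (\<lambda>x. x $ i * radial_lift ?z x) x) \<partial>lborel)"
      using gi(1) by (subst Bochner_Integration.integral_sum) auto
    finally show ?thesis unfolding sum_distrib_left[symmetric] div .
  qed
  let ?F = "\<lambda>t. exp (- 4 * t) * ?\<chi> t"
  have tF: "test_real ?F" by (intro test_real_mult smooth_real_exp t\<chi>)
  have T3: "(\<integral>x. u x * ?\<phi> x / norm x ^ 4 \<partial>lborel) = (\<integral>x. u x * radial_lift ?F x \<partial>lborel)"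
  proof (intro Bochner_Integration.integral_cong refl)
    fix x :: "real^'n"
    show "u x * ?\<phi> x / norm x ^ 4 = u x * radial_lift ?F x"
      using n4[of x] by (cases "x = 0") (auto simp: radial_lift_def)
  qed
  have p: "crit_exp CARD('n) - 1 = (b + 4) / b" using b0 by (simp add: crit_exp_def N field_simps)
  have T4: "(\<integral>x. u x powr (crit_exp CARD('n) - 1) * ?\<phi> x \<partial>lborel) = ?K * (\<integral>t. w t powr ((b + 4) / b) * \<psi> t \<partial>lborel)"
  proof -
    have [measurable]: "\<psi> \<in> borel_measurable borel" by (rule test_real_borel[OF \<psi>])
    have [measurable]: "?\<phi> \<in> borel_measurable borel" by (rule radial_lift_borel) measurable
    let ?q = "\<lambda>t. exp (- real CARD('n) * t) * (w t powr ((b + 4) / b) * \<psi> t)"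
    have "(\<integral>x. u x powr (crit_exp CARD('n) - 1) * ?\<phi> x \<partial>lborel) = (\<integral>x. ?q (ln (norm (x::real^'n))) \<partial>lborel)"
    proof (rule integral_cong_AE)
      show "AE x in lborel. u x powr (crit_exp CARD('n) - 1) * ?\<phi> x = ?q (ln (norm x))"
        using uw radial_lift_AE[of ?\<chi>, where 'n = 'n]
      proof eventually_elim
        case (elim x)
        let ?t = "ln (norm x)"
        have "u x powr ((b + 4) / b) = exp (- b * ?t) powr ((b + 4) / b) * w ?t powr ((b + 4) / b)"
          unfolding elim(1) by (rule powr_mult)
        also have "exp (- b * ?t) powr ((b + 4) / b) = exp (- (b + 4) * ?t)"
          using b0 by (simp add: exp_powr_real field_simps)
        finally have "u x powr ((b + 4) / b) * ?\<phi> x = (exp (- (b + 4) * ?t) * exp (- b * ?t)) * (w ?t powr ((b + 4) / b) * \<psi> ?t)"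
          unfolding elim(2) by (simp only: mult_ac)
        also have "exp (- (b + 4) * ?t) * exp (- b * ?t) = exp (- real CARD('n) * ?t)"
          unfolding exp_add[symmetric] by (simp add: N algebra_simps)
        finally show ?case unfolding p .
      qed
    qed measurable
    also have "\<dots> = ?K * (\<integral>t. exp (real CARD('n) * t) * ?q t \<partial>lborel)"
      by (rule integral_radial) measurable
    finally show ?thesis by (simp only: exp_cancel)
  qed
  let ?c1 = "C1 CARD('n) \<mu>" and ?c2 = "C2 CARD('n) \<mu>"
  let ?m = "\<lambda>S t. w t * (exp ((b + 4) * t) * S t)"
  have im: "integrable lborel (?m S)" if "test_real S" for S
    by (intro integrable_square_mult w w2 test_real_mult smooth_real_exp that)
  have bG: "?G \<in> borel_measurable borel" and bZ: "?Z \<in> borel_measurable borel" and bF: "?F \<in> borel_measurable borel"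
    using tG tZ tF by (auto intro: test_real_borel simp only:)
  have "?K * (\<integral>t. ?m ?G t \<partial>lborel) + ?c1 * (?K * (\<integral>t. ?m ?Z t \<partial>lborel)) + ?c2 * (?K * (\<integral>t. ?m ?F t \<partial>lborel))
      = ?K * (\<integral>t. w t powr ((b + 4) / b) * \<psi> t \<partial>lborel)"
    using weak[OF \<phi>] unfolding T1 T2 T3 T4 red[OF bG] red[OF bZ] red[OF bF] by simp
  then have "?K * ((\<integral>t. ?m ?G t \<partial>lborel) + ?c1 * (\<integral>t. ?m ?Z t \<partial>lborel) + ?c2 * (\<integral>t. ?m ?F t \<partial>lborel))
      = ?K * (\<integral>t. w t powr ((b + 4) / b) * \<psi> t \<partial>lborel)"
    by (simp only: distrib_left mult.left_commute)
  then have "(\<integral>t. w t powr ((b + 4) / b) * \<psi> t \<partial>lborel) =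
      (\<integral>t. ?m ?G t \<partial>lborel) + ?c1 * (\<integral>t. ?m ?Z t \<partial>lborel) + ?c2 * (\<integral>t. ?m ?F t \<partial>lborel)"
    using K by simp
  also have "\<dots> = (\<integral>t. ?m ?G t + ?c1 * ?m ?Z t + ?c2 * ?m ?F t \<partial>lborel)"
    using im[OF tG] im[OF tZ] im[OF tF]
    by (simp only: Bochner_Integration.integral_add Bochner_Integration.integrable_add
        integrable_mult_right integral_mult_right_zero)
  also have "(\<lambda>t. ?m ?G t + ?c1 * ?m ?Z t + ?c2 * ?m ?F t) = (\<lambda>t. w t * (w4 t - ((k * (b + 2))\<^sup>2 + (k * b)\<^sup>2) * w2' t
        + (k * (b + 2))\<^sup>2 * (k * b)\<^sup>2 * \<psi> t))"
  proof
    fix t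
    have e1: "exp ((b + 4) * t) * (exp (- (b + 4) * t) * y) = y" for y by (rule exp_cancel)
    have F: "?F t = exp (- (b + 4) * t) * \<psi> t" by (simp add: exp_add[symmetric] algebra_simps flip: mult.assoc)
    have "?m ?G t + ?c1 * ?m ?Z t + ?c2 * ?m ?F t = w t * ((w4 t - ((b + 2)\<^sup>2 + b\<^sup>2) * w2' t + (b + 2)\<^sup>2 * b\<^sup>2 * \<psi> t)
       + ?c1 * (w2' t - b\<^sup>2 * \<psi> t) + ?c2 * \<psi> t)"
      unfolding ef(6,7) F e1 by (simp only: distrib_left mult.left_commute)
    also have "(w4 t - ((b + 2)\<^sup>2 + b\<^sup>2) * w2' t + (b + 2)\<^sup>2 * b\<^sup>2 * \<psi> t)
       + ?c1 * (w2' t - b\<^sup>2 * \<psi> t) + ?c2 * \<psi> t =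
       w4 t - ((k * (b + 2))\<^sup>2 + (k * b)\<^sup>2) * w2' t + (k * (b + 2))\<^sup>2 * (k * b)\<^sup>2 * \<psi> t"
      unfolding C1_eq[OF N5 b k] C2_eq[OF N5 b k]
      by (simp add: algebra_simps power2_eq_square)
    finally show "?m ?G t + ?c1 * ?m ?Z t + ?c2 * ?m ?F t = w t * (w4 t - ((k * (b + 2))\<^sup>2 + (k * b)\<^sup>2) * w2' t
        + (k * (b + 2))\<^sup>2 * (k * b)\<^sup>2 * \<psi> t)" .
  qed
  finally show "(\<integral>t. w t * (deriv (deriv (deriv (deriv \<psi>))) t - ((k * (b + 2))\<^sup>2 + (k * b)\<^sup>2) * deriv (deriv \<psi>) t
        + (k * (b + 2))\<^sup>2 * (k * b)\<^sup>2 * \<psi> t) \<partial>lborel)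
      = (\<integral>t. w t powr ((b + 4) / b) * \<psi> t \<partial>lborel)"
    unfolding w4_def w3_def w2'_def w1_def by simp
qed


text \<open>The critical exponent is p + 1, and w^p <= 1 + w^(p + 1) bounds the right side by a
  constant plus an integrable function. As \<open>w\<close> equals \<open>v\<close> almost
  everywhere, it may be replaced under the integral, which closes the equation for \<open>v\<close>
  at every t.\<close>

lemma pos_radial_solution_green:
  fixes u :: "real^'n::finite \<Rightarrow> real" and \<mu> :: real
  assumes N5: "CARD('n) \<ge> 5" and mu: "0 < \<mu>" "\<mu> < real CARD('n) - 4"
    and b: "b = (real CARD('n) - 4) / 2" and k: "k = 1 - \<mu> / (real CARD('n) - 4)"
    and u: "pos_radial_solution \<mu> u"
    and w [measurable]: "w \<in> borel_measurable borel" and w0: "\<And>t. 0 \<le> w t"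
    and uw: "AE x in lborel. u x = exp (- b * ln (norm x)) * w (ln (norm x))"
  obtains v M where "green_solution (k * (b + 2)) (k * b) ((b + 4) / b) M v" "AE t in lborel. w t = v t"
proof -
  have N: "real CARD('n) = 2 * b + 4" using b by (simp add: field_simps)
  have b0: "b > 0" using N5 b by simp
  have k0: "k > 0" using mu by (simp add: k)
  let ?\<alpha> = "k * (b + 2)" and ?\<beta> = "k * b" and ?p = "(b + 4) / b"
  have \<beta>: "0 < ?\<beta>" and \<beta>\<alpha>: "?\<beta> < ?\<alpha>" using b0 k0 by auto
  note w1d = pos_radial_solution_1d[OF N5 mu b k u w w0 uw]
  have p: "crit_exp CARD('n) = ?p + 1" using b0 by (simp add: crit_exp_def N field_simps)
  have fF: "w t powr ?p \<le> 1 + w t powr (?p + 1)" for t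
  proof (cases "w t \<le> 1")
    case True
    then have "w t powr ?p \<le> 1" using w0[of t] b0 by (intro powr_le1) auto
    then show ?thesis by (simp add: add_increasing2)
  next
    case False
    then have "w t powr ?p \<le> w t powr (?p + 1)" by (intro powr_mono) auto
    then show ?thesis by simp
  qed
  define v where "v t = (\<integral>s. green ?\<alpha> ?\<beta> (t - s) * w s powr ?p \<partial>lborel)" for t
  have fb: "(\<lambda>t. w t powr ?p) \<in> borel_measurable borel" by measurable
  have nn1: "0 \<le> w t powr ?p" and nn2: "0 \<le> w t powr (?p + 1)" for t by auto
  note rep = weak_solution_green_representation[OF \<beta> \<beta>\<alpha> w w1d(1) fb nn1 w1d(2)[unfolded p] fF nn2 w1d(3),
      folded v_def]
  obtain M where M: "\<And>t. v t \<le> M" using rep(3) by blast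
  have wv: "AE t in lborel. w t = v t" by (rule rep(4))
  note [measurable] = rep(1)
  have "green_solution ?\<alpha> ?\<beta> ?p M v"
  proof
    show "0 < ?\<beta>" "?\<beta> < ?\<alpha>" by (rule \<beta>, rule \<beta>\<alpha>)
    \<comment> \<open>The second inequality compares \<alpha> = k (b + 2) with p \<beta> = k (b +
      4).\<close>
    show "1 < ?p" "?\<alpha> < ?p * ?\<beta>" using b0 k0 by (auto simp: field_simps)
    show "v \<in> borel_measurable borel" by (rule rep(1))
    show "0 \<le> v t" for t by (rule rep(2))
    show "v t \<le> M" for t by (rule M)
    show "integrable lborel (\<lambda>t. (v t)\<^sup>2)"
      by (rule integrable_cong_AE_imp[OF w1d(1)]) (use wv in \<open>auto elim: eventually_mono\<close>)
    show "v t = (\<integral>s. green ?\<alpha> ?\<beta> (t - s) * v s powr ?p \<partial>lborel)" for t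
      unfolding v_def[of t]
    proof (rule integral_cong_AE)
      show "AE s in lborel. green ?\<alpha> ?\<beta> (t - s) * w s powr ?p = green ?\<alpha> ?\<beta> (t - s) * v s powr ?p"
        using wv by eventually_elim simp
    qed measurable
  qed
  then show thesis using wv that by blast
qed

lemma integral_exp_shift:
  fixes f :: "real \<Rightarrow> real"
  assumes [measurable]: "f \<in> borel_measurable borel"
  shows "(\<integral>s. exp (- c * s) * f (s + \<tau>) \<partial>lborel) = exp (c * \<tau>) * (\<integral>s. exp (- c * s) * f s \<partial>lborel)"
proof -
  have "(\<integral>s. exp (- c * s) * f (s + \<tau>) \<partial>lborel) = (\<integral>s. (\<lambda>s. exp (- c * (s - \<tau>)) * f s) (\<tau> + s) \<partial>lborel)"
    by (simp add: add.commute)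
  also have "\<dots> = (\<integral>s. exp (- c * (s - \<tau>)) * f s \<partial>lborel)"
    by (rule integral_translate(1)) measurable
  also have "\<dots> = (\<integral>s. exp (c * \<tau>) * (exp (- c * s) * f s) \<partial>lborel)"
  proof (rule Bochner_Integration.integral_cong[OF refl])
    fix s
    have "exp (- c * (s - \<tau>)) = exp (c * \<tau>) * exp (- c * s)"
      unfolding exp_add[symmetric] by (simp add: algebra_simps)
    then show "exp (- c * (s - \<tau>)) * f s = exp (c * \<tau>) * (exp (- c * s) * f s)" by (simp only: mult.assoc)
  qed
  finally show ?thesis by simp
qed

lemma AE_lborel_False: "\<not> (AE t in (lborel :: real measure). False)"
  by (subst AE_iff_measurable[of UNIV]) auto

text \<open>Positivity permits a translation to match two values of \<open>P\<close> through the
  logarithm of their ratio.\<close>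

lemma green_solution_P_pos:
  assumes v: "green_solution \<alpha> \<beta> p M v" and pos: "AE t in lborel. 0 < v t"
  shows "0 < (\<integral>s. exp (- \<beta> * s) * v s powr p \<partial>lborel)"
proof -
  interpret green_solution \<alpha> \<beta> p M v by (rule v)
  have i: "integrable lborel (\<lambda>s. exp (- \<beta> * s) * v s powr p)" using integrable_exp_v[of \<beta>] \<beta> \<beta>\<alpha> by simp
  have "(\<integral>s. exp (- \<beta> * s) * v s powr p \<partial>lborel) \<noteq> 0"
  proof
    assume "(\<integral>s. exp (- \<beta> * s) * v s powr p \<partial>lborel) = 0"
    then have "AE s in lborel. exp (- \<beta> * s) * v s powr p = 0"
      by (subst (asm) integral_nonneg_eq_0_iff_AE[OF i]) auto
    then have "AE s in (lborel :: real measure). False" using pos by eventually_elim simp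
    then show False using AE_lborel_False by blast
  qed
  moreover have "0 \<le> (\<integral>s. exp (- \<beta> * s) * v s powr p \<partial>lborel)" by (intro integral_nonneg_AE) auto
  ultimately show ?thesis by (metis less_eq_real_def)
qed

lemma pos_radial_solution_unique:
  fixes u :: "real^'n::finite \<Rightarrow> real" and \<mu> :: real
  assumes N5: "CARD('n) \<ge> 5" and mu: "0 < \<mu>" "\<mu> < real CARD('n) - 4"
    and u: "pos_radial_solution \<mu> u"
  shows "\<exists>lam>0. AE x in lborel. u x = U_scaled \<mu> lam x"
proof -
  define b where "b = (real CARD('n) - 4) / 2"
  define k where "k = 1 - \<mu> / (real CARD('n) - 4)"
  have b0: "b > 0" using N5 by (simp add: b_def)
  have k0: "k > 0" using mu by (simp add: k_def)
  let ?\<alpha> = "k * (b + 2)" and ?\<beta> = "k * b" and ?p = "(b + 4) / b"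
  have \<beta>: "?\<beta> > 0" using b0 k0 by simp
  obtain w where w: "w \<in> borel_measurable borel" "\<And>t. 0 \<le> w t" "AE t in lborel. 0 < w t"
    "AE x in lborel. u x = exp (- b * ln (norm x)) * w (ln (norm x))"
    using pos_radial_solution_profile[OF u, of b] by blast
  obtain v M where v: "green_solution ?\<alpha> ?\<beta> ?p M v" and wv: "AE t in lborel. w t = v t"
    using pos_radial_solution_green[OF N5 mu b_def k_def u w(1,2,4)] by blast
  interpret v: green_solution ?\<alpha> ?\<beta> ?p M v by (rule v)
  let ?W = "\<lambda>\<tau>. profile b k (k * \<tau>)"
  have Wpos: "0 < profile b k \<tau> t" for \<tau> t
    using amplitude_pos[OF b0 k0] cosh_pow_pos by (simp add: profile_def)
  have Wb [measurable]: "profile b k \<tau> \<in> borel_measurable borel" for \<tau>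
    unfolding profile_def[abs_def] cosh_pow_def
    by (intro borel_measurable_continuous_onI continuous_intros) auto
  \<comment> \<open>The scaled explicit functions are positive radial solutions, so the general
    reduction supplies the integral equation for their profiles.\<close>
  have model: "\<exists>V M. green_solution ?\<alpha> ?\<beta> ?p M V \<and> (AE t in lborel. ?W (ln lam) t = V t)" if "lam > 0" for lam
  proof -
    have "AE x in lborel. U_scaled \<mu> lam (x::real^'n) = exp (- b * ln (norm x)) * ?W (ln lam) (ln (norm x))"
      unfolding U_scaled_eq_radial_lift[OF N5 mu that b_def k_def] by (rule radial_lift_AE)
    from pos_radial_solution_green[OF N5 mu b_def k_def pos_radial_solution_U_scaled[OF N5 mu that] Wb
        less_imp_le[OF Wpos] this]
    show ?thesis by blast
  qed
  let ?I = "\<lambda>f. \<integral>s. exp (- ?\<beta> * s) * f s powr ?p \<partial>lborel"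
  have I_cong: "?I f = ?I g" if "AE t in lborel. f t = g t" "f \<in> borel_measurable borel" "g \<in> borel_measurable borel" for f g
    using that by (intro integral_cong_AE) (auto elim: eventually_mono)
  have Iv: "0 < ?I v"
  proof (rule green_solution_P_pos[OF v])
    show "AE t in lborel. 0 < v t" using w(3) wv by eventually_elim simp
  qed
  obtain V1 M1 where V1: "green_solution ?\<alpha> ?\<beta> ?p M1 V1" "AE t in lborel. ?W (ln 1) t = V1 t"
    using model[of 1] by auto
  have I1: "0 < ?I (profile b k 0)"
  proof -
    have "AE t in lborel. 0 < V1 t" using V1(2) by eventually_elim (metis Wpos)
    from green_solution_P_pos[OF V1(1) this] show ?thesis
      using I_cong[OF V1(2) Wb green_solution.v_borel[OF V1(1)]] by simp
  qed
  \<comment> \<open>A translation by \<tau> multiplies the integral by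
    \<open>exp (?\<beta> * \<tau>)\<close>, so this value makes the two constants \<open>P\<close>
    equal; with \<open>lam = exp \<tau>\<close> it is the phase of a scaled solution.\<close>
  define \<tau> where "\<tau> = ln (?I v / ?I (profile b k 0)) / ?\<beta>"
  have e\<tau>: "exp (?\<beta> * \<tau>) * ?I (profile b k 0) = ?I v"
  proof -
    have "exp (c * (ln (x / y) / c)) * y = x" if "c > 0" "x > 0" "y > 0" for c x y :: real
      using that by simp
    from this[OF \<beta> Iv I1] show ?thesis unfolding \<tau>_def .
  qed
  define lam where "lam = exp \<tau>"
  have lam: "lam > 0" "ln lam = \<tau>" by (auto simp: lam_def)
  obtain V M' where V: "green_solution ?\<alpha> ?\<beta> ?p M' V" and WV: "AE t in lborel. ?W \<tau> t = V t"
    using model[OF lam(1)] unfolding lam(2) by blast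
  interpret V: green_solution ?\<alpha> ?\<beta> ?p M' V by (rule V)
  have "?I V = ?I (?W \<tau>)" by (rule I_cong[OF WV Wb V.v_borel, symmetric])
  also have "\<dots> = exp (?\<beta> * \<tau>) * ?I (profile b k 0)"
    unfolding profile_shift by (rule integral_exp_shift) measurable
  finally have "v.P = V.P" unfolding v.P_def V.P_def e\<tau> by simp
  then have vV: "v = V" by (rule green_solution_unique[OF v V])
  have "AE t in lborel. w t = ?W \<tau> t" using wv WV by eventually_elim (simp add: vV)
  then have "AE x in lborel. w (ln (norm (x::real^'n))) = ?W \<tau> (ln (norm x))"
    using w(1) by (subst AE_radial_iff) auto
  moreover have "AE x in lborel. U_scaled \<mu> lam (x::real^'n) = exp (- b * ln (norm x)) * ?W \<tau> (ln (norm x))"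
    unfolding U_scaled_eq_radial_lift[OF N5 mu lam(1) b_def k_def] lam(2) by (rule radial_lift_AE)
  ultimately have "AE x in lborel. u x = U_scaled \<mu> lam x"
    using w(4) by eventually_elim simp
  then show ?thesis using lam(1) by blast
qed

theorem theorem1p1:
  fixes \<mu> :: real
  assumes "CARD('n::finite) \<ge> 5"
    and "0 < \<mu>" and "\<mu> < real CARD('n) - 4"
  shows "(\<forall>lam>0. pos_radial_solution \<mu> (U_scaled \<mu> lam :: real^'n \<Rightarrow> real))
       \<and> (\<forall>u :: real^'n \<Rightarrow> real. pos_radial_solution \<mu> u \<longrightarrow>
            (\<exists>lam>0. AE x in lborel. u x = U_scaled \<mu> lam x))"
  using pos_radial_solution_U_scaled[OF assms] pos_radial_solution_unique[OF assms] by blast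

end
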